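(* Let $\mathcal{L}_\epsilon^{-1}$ be the Stokes slender body PDE operator on $\partial\mathcal{C}_\epsilon$ mapping fiber velocity to force density (defined in the context). There is a constant $C$, independent of $\epsilon$ and $\bm u$, such that for all $0<\epsilon<1$ and all zero-mean $\bm u\in H^1(\mathbb{T})$, $$\left\|\mathcal{L}_\epsilon^{-1}[\bm u]\right\|_{L^2(\mathbb{T})}\le\frac{C}{|\log\epsilon|}\,\|\bm u\|_{H^1(\mathbb{T})}.$$
   Context: Let $\mathbb{T}=\mathbb{R}/2\mathbb{Z}$. In cylindrical coordinates $(r,\theta,z)$, let $\mathcal{C}_\epsilon=\{(r,\theta,z): 0\le r\le\epsilon,\ 0\le\theta<2\pi,\ z\in\mathbb{T}\}\subset\mathbb{R}^2\times\mathbb{T}$ and $\Omega_\epsilon=(\mathbb{R}^2\times\mathbb{T})\setminus\overline{\mathcal{C}_\epsilon}$. All functions on $\mathbb{T}$ are assumed to have zero mean (only the Fourier modes $k\ne0$ are considered). For zero-mean $\overline{\bm u}\in H^{1/2}(\mathbb{T})$ (three-component vector valued), let $(\bm u,p)$ be the unique solution of $-\Delta\bm u+\nabla p=0$, $\operatorname{div}\bm u=0$ in $\Omega_\epsilon$, $\bm u=\overline{\bm u}(z)$ on $\partial\mathcal{C}_\epsilon$ (independent of $\theta$), $\bm u\to0$ and $p\to0$ as $r\to\infty$. With $\bm\sigma=\nabla\bm u+(\nabla\bm u)^{\mathrm T}-p\,\mathbf I$ and $\bm n$ the unit normal on $\partial\mathcal{C}_\epsilon$ pointing into $\mathcal{C}_\epsilon$,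 $$\mathcal{L}_\epsilon^{-1}[\overline{\bm u}](z)=\int_0^{2\pi}(\bm\sigma\bm n)\,\epsilon\,d\theta .$$ *)

theory Defs
  imports "HOL-Analysis.Analysis"
begin

section \<open>Function spaces on \<open>\<real>/2\<int>\<close>\<close>

text \<open>Functions on \<open>\<real>/2\<int>\<close> are represented by 2-periodic functions on \<open>\<real>\<close>, and norms are
  taken over the fundamental domain \<open>[0,2]\<close>.\<close>

definition periodic2 :: "(real \<Rightarrow> 'a) \<Rightarrow> bool" where
  "periodic2 f \<longleftrightarrow> (\<forall>z. f (z + 2) = f z)"

definition test_function :: "(real \<Rightarrow> real) \<Rightarrow> bool" where
  "test_function \<phi> \<longleftrightarrow> periodic2 \<phi> \<and> (\<forall>n z. ((deriv ^^ n) \<phi>) differentiable (at z))"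

definition L2_T :: "(real \<Rightarrow> real^3) \<Rightarrow> bool" where
  "L2_T f \<longleftrightarrow> periodic2 f \<and> f \<in> borel_measurable borel \<and>
     set_integrable lborel {0..2} (\<lambda>z. (norm (f z))\<^sup>2)"

definition L2_norm :: "(real \<Rightarrow> real^3) \<Rightarrow> real" where
  "L2_norm f = sqrt (LBINT z:{0..2}. (norm (f z))\<^sup>2)"

definition zero_mean :: "(real \<Rightarrow> real^3) \<Rightarrow> bool" where
  "zero_mean f \<longleftrightarrow> (LBINT z:{0..2}. f z) = 0"

definition has_weak_deriv :: "(real \<Rightarrow> real^3) \<Rightarrow> (real \<Rightarrow> real^3) \<Rightarrow> bool" where
  "has_weak_deriv f g \<longleftrightarrow> (\<forall>\<phi>. test_function \<phi> \<longrightarrow>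
     (LBINT z:{0..2}. deriv \<phi> z *\<^sub>R f z) = - (LBINT z:{0..2}. \<phi> z *\<^sub>R g z))"

definition H1_T :: "(real \<Rightarrow> real^3) \<Rightarrow> bool" where
  "H1_T f \<longleftrightarrow> L2_T f \<and> (\<exists>g. L2_T g \<and> has_weak_deriv f g)"

text \<open>The weak derivative is unique up to null sets, so the choice does not affect the norm.\<close>

definition weak_deriv :: "(real \<Rightarrow> real^3) \<Rightarrow> real \<Rightarrow> real^3" where
  "weak_deriv f = (SOME g. L2_T g \<and> has_weak_deriv f g)"

definition H1_norm :: "(real \<Rightarrow> real^3) \<Rightarrow> real" where
  "H1_norm f = sqrt ((L2_norm f)\<^sup>2 + (L2_norm (weak_deriv f))\<^sup>2)"


section \<open>The exterior Stokes problem\<close>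

text \<open>Points of \<open>\<real>\<^sup>2 \<times> \<real>/2\<int>\<close> are points of \<open>\<real>\<^sup>3\<close>, with functions required to be 2-periodic in
  the third coordinate. Vector fields are written in Cartesian components.\<close>

definition cyl_radius :: "real^3 \<Rightarrow> real" where
  "cyl_radius x = sqrt ((x$1)\<^sup>2 + (x$2)\<^sup>2)"

definition cyl :: "real \<Rightarrow> real \<Rightarrow> real \<Rightarrow> real^3" where
  "cyl r \<theta> z = vector [r * cos \<theta>, r * sin \<theta>, z]"

definition exterior_domain :: "real \<Rightarrow> (real^3) set" where
  "exterior_domain \<epsilon> = {x. \<epsilon> < cyl_radius x}"

definition partial_deriv :: "3 \<Rightarrow> (real^3 \<Rightarrow> 'b::real_normed_vector) \<Rightarrow> real^3 \<Rightarrow> 'b" where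
  "partial_deriv i f x = frechet_derivative f (at x) (axis i 1)"

definition C1_on :: "(real^3) set \<Rightarrow> (real^3 \<Rightarrow> 'b::real_normed_vector) \<Rightarrow> bool" where
  "C1_on S f \<longleftrightarrow> (\<forall>x\<in>S. f differentiable (at x)) \<and> (\<forall>i. continuous_on S (partial_deriv i f))"

definition C2_on :: "(real^3) set \<Rightarrow> (real^3 \<Rightarrow> 'b::real_normed_vector) \<Rightarrow> bool" where
  "C2_on S f \<longleftrightarrow> C1_on S f \<and> (\<forall>i. C1_on S (partial_deriv i f))"

definition gradient :: "(real^3 \<Rightarrow> real) \<Rightarrow> real^3 \<Rightarrow> real^3" where
  "gradient p x = (\<chi> i. partial_deriv i p x)"

definition divergence :: "(real^3 \<Rightarrow> real^3) \<Rightarrow> real^3 \<Rightarrow> real" where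
  "divergence u x = (\<Sum>i\<in>UNIV. partial_deriv i u x $ i)"

definition laplacian :: "(real^3 \<Rightarrow> real^3) \<Rightarrow> real^3 \<Rightarrow> real^3" where
  "laplacian u x = (\<Sum>i\<in>UNIV. partial_deriv i (partial_deriv i u) x)"

definition stress :: "(real^3 \<Rightarrow> real^3) \<Rightarrow> (real^3 \<Rightarrow> real) \<Rightarrow> real^3 \<Rightarrow> real^3^3" where
  "stress u p x = jacobian u (at x) + transpose (jacobian u (at x)) - mat (p x)"

text \<open>Boundary data are only defined almost everywhere, so the condition \<open>u = ubar\<close> on the
  cylinder of radius \<open>\<epsilon>\<close> is imposed as an \<open>L\<^sup>2\<close> limit from outside.
  The limits at infinity are uniform in \<open>\<theta>\<close> and \<open>z\<close>.\<close>

definition stokes_solution ::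
  "real \<Rightarrow> (real \<Rightarrow> real^3) \<Rightarrow> (real^3 \<Rightarrow> real^3) \<Rightarrow> (real^3 \<Rightarrow> real) \<Rightarrow> bool" where
  "stokes_solution \<epsilon> ubar u p \<longleftrightarrow>
     C2_on (exterior_domain \<epsilon>) u \<and>
     C1_on (exterior_domain \<epsilon>) p \<and>
     (\<forall>x\<in>exterior_domain \<epsilon>. u (x + axis 3 2) = u x \<and> p (x + axis 3 2) = p x) \<and>
     (\<forall>x\<in>exterior_domain \<epsilon>. - laplacian u x + gradient p x = 0) \<and>
     (\<forall>x\<in>exterior_domain \<epsilon>. divergence u x = 0) \<and>
     ((\<lambda>r. LBINT \<theta>:{0..2*pi}. LBINT z:{0..2}. (norm (u (cyl r \<theta> z) - ubar z))\<^sup>2)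
        \<longlongrightarrow> 0) (at_right \<epsilon>) \<and>
     (u \<longlongrightarrow> 0) (filtercomap cyl_radius at_top) \<and>
     (p \<longlongrightarrow> 0) (filtercomap cyl_radius at_top)"


section \<open>The force density\<close>

definition inward_normal :: "real \<Rightarrow> real^3" where
  "inward_normal \<theta> = vector [- cos \<theta>, - sin \<theta>, 0]"

definition angular_force ::
  "real \<Rightarrow> (real^3 \<Rightarrow> real^3) \<Rightarrow> (real^3 \<Rightarrow> real) \<Rightarrow> real \<Rightarrow> real \<Rightarrow> real^3" where
  "angular_force \<epsilon> u p r z =
     (LBINT \<theta>:{0..2*pi}. \<epsilon> *\<^sub>R (stress u p (cyl r \<theta> z) *v inward_normal \<theta>))"

text \<open>For rough data the normal stress on the boundary exists only as a distribution, so the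
  force density is the limit, as the radius decreases to \<open>\<epsilon>\<close>, in the sense of distributions on
  \<open>\<real>/2\<int>\<close>. If \<open>(u, p)\<close> solves the problem with data \<open>ubar\<close>, then \<open>has_force_density \<epsilon> u p f\<close>
  says that the distribution \<open>\<L>\<^sub>\<epsilon>\<^sup>-\<^sup>1[ubar]\<close> is the function \<open>f\<close>; this determines \<open>f\<close>
  almost everywhere among functions in \<open>L\<^sup>2\<close>.\<close>

definition has_force_density ::
  "real \<Rightarrow> (real^3 \<Rightarrow> real^3) \<Rightarrow> (real^3 \<Rightarrow> real) \<Rightarrow> (real \<Rightarrow> real^3) \<Rightarrow> bool" where
  "has_force_density \<epsilon> u p f \<longleftrightarrow> (\<forall>\<phi>. test_function \<phi> \<longrightarrow>
     ((\<lambda>r. LBINT z:{0..2}. \<phi> z *\<^sub>R angular_force \<epsilon> u p r z)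
        \<longlongrightarrow> (LBINT z:{0..2}. \<phi> z *\<^sub>R f z)) (at_right \<epsilon>))"

end

theory Submission
  imports Defs
begin

text \<open>
  Fourier coefficients in \<open>\<theta>\<close> and \<open>z\<close> turn the Stokes system into an ODE system in \<open>r\<close> for each pair
  of modes, and only three families of modes see the total force: one axisymmetric family for the
  axial component and two families of angular order one for the transverse components. The ODE is
  regular at \<open>r = \<epsilon>\<close>, so each mode has a classical traction \<open>\<tau>\<close> there.
  The energy of the mode equals \<open>- \<tau> v\<close>, where \<open>v\<close> is the boundary datum, and testing the equation
  with an explicit divergence free field equal to a unit vector on the boundary gives
  \<open>\<tau>\<^sup>2 \<le> e \<cdot> energy\<close>, where \<open>e\<close> is the energy of the test field. Hence \<open>\<bar>\<tau>\<bar> \<le> e \<bar>v\<bar>\<close>. No Bessel functions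
  are needed: a logarithmic cutoff at distance \<open>1 / \<kappa>\<close>, where \<open>\<kappa> = \<pi> k\<close>, has
  \<open>e \<le> C / ln (1 + 1 / (\<kappa> \<epsilon>)) \<le> C \<kappa> / ln (1 / \<epsilon>)\<close>, and the factor \<open>\<kappa>\<close> is absorbed by the derivative
  in the \<open>H\<^sup>1\<close> norm. The same bound on every circle of radius close to \<open>\<epsilon>\<close> provides the domination
  that is needed to sum the modes in the distributional limit.
\<close>

section \<open>A radial Stokes system\<close>

text \<open>Two gaps in the hypotheses shape the argument. At infinity only \<open>u\<close> and
  \<open>p\<close> are known to vanish, not their derivatives, so a finite energy cannot be
  presupposed. At the cylinder the data are attained only in the L2 sense. Both are met by replacing
  energies over the whole exterior by one monotone function of the radius, the flux of a mode
  through the circle of radius \<open>r\<close>: it is shown to be non-positive, and its limit at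
  \<open>\<epsilon>\<close> is the traction times the datum. The logarithm is the planar capacity of
  a disc of radius \<open>\<rho>\<close> inside one of radius \<open>\<rho> + 1 / \<kappa>\<close>.
  The force density is prescribed only as a distribution, so the function has to be constructed:
  Bessel's inequality for the weak derivative makes the limiting tractions square summable, and a
  Riesz-Fischer argument turns them into a function. The constant \<open>400 * pi\<close> is 100
  from the energies of the test fields, \<open>2 * pi\<close> from the angular integral of the datum
  and 2 from the transverse modes.\<close>

lemma linear_growth_limit_at_right:
  fixes Y Y' :: "real \<Rightarrow> 'a::euclidean_space"
  assumes ab: "a < b"
    and dY: "\<And>r. a < r \<Longrightarrow> r \<le> b \<Longrightarrow> (Y has_vector_derivative Y' r) (at r)"
    and bnd: "\<And>r. a < r \<Longrightarrow> r \<le> b \<Longrightarrow> norm (Y' r) \<le> M * norm (Y r)"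
  obtains l where "(Y \<longlongrightarrow> l) (at_right a)"
proof -
  \<comment> \<open>Gronwall's argument backwards from \<open>b\<close>: the exponential weight
    makes \<open>g\<close> non-decreasing, so \<open>Y\<close> stays bounded down to
    \<open>a\<close>. Then \<open>Y'\<close> is bounded too, \<open>Y\<close> is Lipschitz and
    extends continuously to \<open>a\<close>.\<close>
  define g where "g r = exp (2 * M * r) * (Y r \<bullet> Y r)" for r
  have g': "(g has_real_derivative exp (2 * M * r) * (2 * M * (Y r \<bullet> Y r) + 2 * (Y r \<bullet> Y' r))) (at r)"
    if "a < r" "r \<le> b" for r
  proof -
    have "((\<lambda>r. Y r \<bullet> Y r) has_vector_derivative Y r \<bullet> Y' r + Y' r \<bullet> Y r) (at r)"
      using dY[OF that] by (intro bounded_bilinear.has_vector_derivative[OF bounded_bilinear_inner])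
    then have "((\<lambda>r. Y r \<bullet> Y r) has_real_derivative 2 * (Y r \<bullet> Y' r)) (at r)"
      by (simp add: has_real_derivative_iff_has_vector_derivative inner_commute)
    then show ?thesis
      unfolding g_def by (auto intro!: derivative_eq_intros simp: algebra_simps)
  qed
  have mono: "g r \<le> g b" if "a < r" "r \<le> b" for r
  proof (rule DERIV_nonneg_imp_nondecreasing[OF \<open>r \<le> b\<close>])
    fix x assume x: "r \<le> x" "x \<le> b"
    then have ax: "a < x" using that by simp
    have "- (Y x \<bullet> Y' x) \<le> norm (Y x) * norm (Y' x)"
      using norm_cauchy_schwarz[of "- Y x" "Y' x"] by simp
    also have "\<dots> \<le> norm (Y x) * (M * norm (Y x))"
      using bnd[OF ax x(2)] by (intro mult_left_mono) auto
    also have "\<dots> = M * (Y x \<bullet> Y x)"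
      by (simp add: dot_square_norm power2_eq_square)
    finally have "0 \<le> exp (2 * M * x) * (2 * M * (Y x \<bullet> Y x) + 2 * (Y x \<bullet> Y' x))"
      by (intro mult_nonneg_nonneg) auto
    then show "\<exists>y. (g has_real_derivative y) (at x) \<and> 0 \<le> y"
      using g'[OF ax x(2)] by blast
  qed
  \<comment> \<open>For negative \<open>M\<close> the growth bound forces \<open>Y = 0\<close>; this
    case is split off because a Lipschitz constant must be non-negative.\<close>
  have M0: "0 \<le> M \<or> (\<forall>r. a < r \<longrightarrow> r \<le> b \<longrightarrow> Y r = 0)"
  proof (cases "0 \<le> M")
    case False
    then have "Y r = 0" if "a < r" "r \<le> b" for r
      using bnd[OF that] norm_ge_zero[of "Y' r"] mult_neg_pos[of M "norm (Y r)"]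
      by (metis le_less_trans not_le norm_le_zero_iff)
    then show ?thesis by blast
  qed simp
  then show ?thesis
  proof
    assume z: "\<forall>r. a < r \<longrightarrow> r \<le> b \<longrightarrow> Y r = 0"
    have "((\<lambda>r. 0) \<longlongrightarrow> (0::'a)) (at_right a)" by simp
    moreover have "\<forall>\<^sub>F r in at_right a. 0 = Y r"
      using z ab by (auto simp: eventually_at_right_field intro!: exI[of _ b])
    ultimately show ?thesis using that Lim_transform_eventually by blast
  next
    assume M: "0 \<le> M"
    define B where "B = sqrt (g b * exp (2 * \<bar>M\<bar> * \<bar>a\<bar>))"
    have Yb: "norm (Y r) \<le> B" if "a < r" "r \<le> b" for r
    proof -
      have "M * (- \<bar>a\<bar>) \<le> M * r" using that M by (intro mult_left_mono) auto
      then have "- (2 * M * r) \<le> 2 * \<bar>M\<bar> * \<bar>a\<bar>" using M by simp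
      then have e: "exp (- (2 * M * r)) \<le> exp (2 * \<bar>M\<bar> * \<bar>a\<bar>)" by simp
      have "(norm (Y r))\<^sup>2 = exp (- (2 * M * r)) * g r"
        by (simp add: g_def exp_minus dot_square_norm)
      also have "\<dots> \<le> exp (2 * \<bar>M\<bar> * \<bar>a\<bar>) * g b"
        using mono[OF that] e by (intro mult_mono) (auto simp: g_def)
      finally show ?thesis unfolding B_def by (intro real_le_rsqrt) (simp add: mult.commute)
    qed
    have lip: "(M * B)-lipschitz_on {a<..b} Y"
    proof (rule bounded_derivative_imp_lipschitz)
      show "(Y has_derivative (\<lambda>h. h *\<^sub>R Y' x)) (at x within {a<..b})" if "x \<in> {a<..b}" for x
        using dY[of x] that by (auto simp: has_vector_derivative_def intro: has_derivative_at_withinI)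
      show "onorm (\<lambda>h. h *\<^sub>R Y' x) \<le> M * B" if "x \<in> {a<..b}" for x
      proof (rule onorm_le)
        fix h :: real
        have "norm (Y' x) \<le> M * B"
          using bnd[of x] Yb[of x] that M by (auto intro: order_trans mult_left_mono)
        then show "norm (h *\<^sub>R Y' x) \<le> M * B * norm h"
          by (simp add: mult.commute[of _ "\<bar>h\<bar>"] mult_left_mono mult.commute[of M B])
      qed
      show "0 \<le> M * B" using M Yb[of b] ab norm_ge_zero[of "Y b"]
        by (meson mult_nonneg_nonneg order_trans order_refl)
    qed simp
    then have "uniformly_continuous_on {a<..b} Y"
      by (rule lipschitz_on_uniformly_continuous)
    moreover have "a \<in> closure {a<..b}" using ab by simp
    ultimately obtain l where "(Y \<longlongrightarrow> l) (at a within {a<..b})"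
      by (rule uniformly_continuous_on_extension_at_closure)
    moreover have "at a within {a<..b} = at_right a"
      using ab by (intro at_within_nhd[of a "{..<b}"]) auto
    ultimately have "(Y \<longlongrightarrow> l) (at_right a)" by simp
    then show ?thesis by (rule that)
  qed
qed

text \<open>For angular order \<open>m\<close> and axial frequency \<open>\<kappa>\<close>, the functions \<open>Up\<close>, \<open>Um\<close>, \<open>W\<close> and \<open>P\<close> are the
  Fourier coefficients of \<open>u\<^sub>1 + i u\<^sub>2\<close> (of angular order \<open>m + 1\<close>), \<open>u\<^sub>1 - i u\<^sub>2\<close> (of order \<open>m - 1\<close>), \<open>u\<^sub>3\<close> and
  \<open>p\<close> (of order \<open>m\<close>). In these variables the vector Laplacian is diagonal. The suffixes \<open>1\<close> and \<open>2\<close>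
  stand for derivatives.\<close>

locale radial_stokes =
  fixes \<epsilon> \<kappa> m :: real and Up Up1 Up2 Um Um1 Um2 W W1 W2 P P1 :: "real \<Rightarrow> real"
  assumes eps: "0 < \<epsilon>" and kap: "0 \<le> \<kappa>" and m01: "m = 0 \<or> m = 1"
    and dUp: "\<And>r. \<epsilon> < r \<Longrightarrow> (Up has_real_derivative Up1 r) (at r)"
    and dUp1: "\<And>r. \<epsilon> < r \<Longrightarrow> (Up1 has_real_derivative Up2 r) (at r)"
    and dUm: "\<And>r. \<epsilon> < r \<Longrightarrow> (Um has_real_derivative Um1 r) (at r)"
    and dUm1: "\<And>r. \<epsilon> < r \<Longrightarrow> (Um1 has_real_derivative Um2 r) (at r)"
    and dW: "\<And>r. \<epsilon> < r \<Longrightarrow> (W has_real_derivative W1 r) (at r)"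
    and dW1: "\<And>r. \<epsilon> < r \<Longrightarrow> (W1 has_real_derivative W2 r) (at r)"
    and dP: "\<And>r. \<epsilon> < r \<Longrightarrow> (P has_real_derivative P1 r) (at r)"
    and eqp: "\<And>r. \<epsilon> < r \<Longrightarrow> Up2 r + Up1 r / r - ((m+1)\<^sup>2 / r\<^sup>2 + \<kappa>\<^sup>2) * Up r = P1 r - m * P r / r"
    and eqm: "\<And>r. \<epsilon> < r \<Longrightarrow> Um2 r + Um1 r / r - ((m-1)\<^sup>2 / r\<^sup>2 + \<kappa>\<^sup>2) * Um r = P1 r + m * P r / r"
    and eqw: "\<And>r. \<epsilon> < r \<Longrightarrow> W2 r + W1 r / r - (m\<^sup>2 / r\<^sup>2 + \<kappa>\<^sup>2) * W r = - \<kappa> * P r"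
    and div0: "\<And>r. \<epsilon> < r \<Longrightarrow> Up1 r + (m+1) * Up r / r + Um1 r - (m-1) * Um r / r + 2 * \<kappa> * W r = 0"
    and Up_inf: "(Up \<longlongrightarrow> 0) at_top" and Um_inf: "(Um \<longlongrightarrow> 0) at_top"
    and W_inf: "(W \<longlongrightarrow> 0) at_top" and P_inf: "(P \<longlongrightarrow> 0) at_top"
begin

section \<open>Reduction of the mode equations to a linear first-order system\<close>

lemma div1:
  assumes r: "\<epsilon> < r"
  shows "Up2 r + (m+1) * (Up1 r / r - Up r / r\<^sup>2) + Um2 r - (m-1) * (Um1 r / r - Um r / r\<^sup>2)
           + 2 * \<kappa> * W1 r = 0"
proof -
  have r0: "r \<noteq> 0" using r eps by simp
  let ?f = "\<lambda>r. Up1 r + (m+1) * Up r / r + Um1 r - (m-1) * Um r / r + 2 * \<kappa> * W r"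
  have 1: "(?f has_real_derivative Up2 r + (m+1) * (Up1 r / r - Up r / r\<^sup>2) + Um2 r
      - (m-1) * (Um1 r / r - Um r / r\<^sup>2) + 2 * \<kappa> * W1 r) (at r)"
    using r0 by (auto intro!: derivative_eq_intros dUp[OF r] dUp1[OF r] dUm[OF r] dUm1[OF r] dW[OF r]
      simp: field_simps power2_eq_square)
  have 2: "(?f has_real_derivative 0) (at r)"
  proof (rule DERIV_cong_ev[THEN iffD2, OF refl _ refl])
    show "\<forall>\<^sub>F x in nhds r. ?f x = 0"
      using eventually_nhds_in_open[of "{\<epsilon><..}" r] r by (auto elim!: eventually_mono simp: div0)
  qed simp
  show ?thesis using DERIV_unique[OF 1 2] .
qed

text \<open>In the sum of \<open>eqp\<close> and \<open>eqm\<close> the terms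
  \<open>m * P r / r\<close> cancel, and \<open>div1\<close> replaces \<open>Up2 + Um2\<close> by
  lower derivatives. The pressure gradient thus becomes a function of the state
  \<open>(Up, Up1, Um, Um1, W, W1, P)\<close>, which closes the equations into a linear first-order
  system.\<close>

lemma P1_eq:
  assumes r: "\<epsilon> < r"
  shows "2 * P1 r = - (m+1) * (Up1 r / r - Up r / r\<^sup>2) + (m-1) * (Um1 r / r - Um r / r\<^sup>2)
           - 2 * \<kappa> * W1 r + Up1 r / r + Um1 r / r
           - ((m+1)\<^sup>2 / r\<^sup>2 + \<kappa>\<^sup>2) * Up r - ((m-1)\<^sup>2 / r\<^sup>2 + \<kappa>\<^sup>2) * Um r"
  using div1[OF r] eqp[OF r] eqm[OF r] by (simp add: algebra_simps add_divide_distrib diff_divide_distrib)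

text \<open>The coefficients of that system are bounded for \<open>r > \<epsilon>\<close>, so
  nothing singular happens at the boundary. Hence derivatives and pressure have one-sided limits,
  although only the trace of the velocity is prescribed, and that weakly.\<close>

lemma state_limits:
  obtains up up1 um um1 w w1 p where
    "(Up \<longlongrightarrow> up) (at_right \<epsilon>)" "(Up1 \<longlongrightarrow> up1) (at_right \<epsilon>)"
    "(Um \<longlongrightarrow> um) (at_right \<epsilon>)" "(Um1 \<longlongrightarrow> um1) (at_right \<epsilon>)"
    "(W \<longlongrightarrow> w) (at_right \<epsilon>)" "(W1 \<longlongrightarrow> w1) (at_right \<epsilon>)" "(P \<longlongrightarrow> p) (at_right \<epsilon>)"
proof -
  define Y where "Y r = (Up r, Up1 r, Um r, Um1 r, W r, W1 r, P r)" for r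
  define Y' where "Y' r = (Up1 r, Up2 r, Um1 r, Um2 r, W1 r, W2 r, P1 r)" for r
  \<comment> \<open>\<open>c\<close> dominates 1, \<open>1 / r\<close> and \<open>\<kappa>\<close>;
    every coefficient is then at most a small multiple of \<open>c\<^sup>2\<close>, and every term
    on the right-hand sides a small multiple of \<open>K\<close>. The factor 1000 is only a generous
    count of them.\<close>
  define c where "c = 1 / \<epsilon> + 1 + \<kappa>"
  have c: "1 \<le> c" "1 / \<epsilon> \<le> c" "\<kappa> \<le> c" using eps kap by (auto simp: c_def)
  have dY: "(Y has_vector_derivative Y' r) (at r)" if r: "\<epsilon> < r" for r
    unfolding Y_def Y'_def
    by (intro has_vector_derivative_Pair; simp flip: has_real_derivative_iff_has_vector_derivative
      add: dUp[OF r] dUp1[OF r] dUm[OF r] dUm1[OF r] dW[OF r] dW1[OF r] dP[OF r])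
  have bnd: "norm (Y' r) \<le> (1000 * c\<^sup>2) * norm (Y r)" if r: "\<epsilon> < r" for r
  proof -
    define n where "n = norm (Y r)"
    have n: "\<bar>Up r\<bar> \<le> n" "\<bar>Up1 r\<bar> \<le> n" "\<bar>Um r\<bar> \<le> n" "\<bar>Um1 r\<bar> \<le> n" "\<bar>W r\<bar> \<le> n" "\<bar>W1 r\<bar> \<le> n" "\<bar>P r\<bar> \<le> n"
      unfolding n_def Y_def norm_Pair by (auto intro!: real_le_rsqrt simp: add_nonneg_nonneg)
    have n0: "0 \<le> n" by (simp add: n_def)
    define i where "i = 1 / r"
    have i: "0 \<le> i" "i \<le> c" using c r eps
      by (auto simp: i_def intro!: order_trans[OF _ c(2)] divide_left_mono)
    have ii: "0 \<le> i\<^sup>2" "i\<^sup>2 \<le> c\<^sup>2" "0 \<le> \<kappa>\<^sup>2" "\<kappa>\<^sup>2 \<le> c\<^sup>2" using i c kap by (auto intro!: power_mono)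
    have cc: "c \<le> c\<^sup>2" "1 \<le> c\<^sup>2" using c self_le_power[of c 2] by auto
    define K where "K = c\<^sup>2 * n"
    have b: "\<bar>x * y\<bar> \<le> K" if "\<bar>x\<bar> \<le> c\<^sup>2" "\<bar>y\<bar> \<le> n" for x y
      unfolding K_def abs_mult using that by (intro mult_mono) auto
    have bi: "\<bar>i * y\<bar> \<le> K" "\<bar>i\<^sup>2 * y\<bar> \<le> K" "\<bar>\<kappa> * y\<bar> \<le> K" "\<bar>\<kappa>\<^sup>2 * y\<bar> \<le> K" "\<bar>1 * y\<bar> \<le> K" if "\<bar>y\<bar> \<le> n" for y
      using i ii cc kap c that by (intro b; simp)+
    have ri: "x / r = i * x" "x / r\<^sup>2 = i\<^sup>2 * x" for x
      by (auto simp: i_def power_divide)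
    have m: "m = 0 \<or> m = 1" by (rule m01)
    note P1' = P1_eq[OF r, unfolded ri] and p' = eqp[OF r, unfolded ri] and m' = eqm[OF r, unfolded ri]
      and w' = eqw[OF r, unfolded ri]
    have K: "\<bar>i * Up r\<bar> \<le> K" "\<bar>i\<^sup>2 * Up r\<bar> \<le> K" "\<bar>\<kappa>\<^sup>2 * Up r\<bar> \<le> K" "\<bar>i * Up1 r\<bar> \<le> K"
      "\<bar>i\<^sup>2 * Um r\<bar> \<le> K" "\<bar>\<kappa>\<^sup>2 * Um r\<bar> \<le> K" "\<bar>i * Um1 r\<bar> \<le> K" "\<bar>i\<^sup>2 * W r\<bar> \<le> K" "\<bar>\<kappa>\<^sup>2 * W r\<bar> \<le> K"
      "\<bar>i * W1 r\<bar> \<le> K" "\<bar>\<kappa> * W1 r\<bar> \<le> K" "\<bar>i * P r\<bar> \<le> K" "\<bar>\<kappa> * P r\<bar> \<le> K"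
      using bi n by blast+
    have K1: "\<bar>Up1 r\<bar> \<le> K" "\<bar>Um1 r\<bar> \<le> K" "\<bar>W1 r\<bar> \<le> K" using bi(5) n by simp_all
    have P1b: "\<bar>P1 r\<bar> \<le> 20 * K"
      using m
    proof
      assume "m = 0"
      then have "2 * P1 r = - 2 * (\<kappa> * W1 r) - \<kappa>\<^sup>2 * Up r - \<kappa>\<^sup>2 * Um r"
        using P1' by (simp add: algebra_simps)
      then show ?thesis using K(3,6,11) unfolding abs_le_iff by linarith
    next
      assume "m = 1"
      then have "2 * P1 r = - (i * Up1 r) - 2 * (i\<^sup>2 * Up r) + i * Um1 r - 2 * (\<kappa> * W1 r) - \<kappa>\<^sup>2 * Up r - \<kappa>\<^sup>2 * Um r"
        using P1' by (simp add: algebra_simps)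
      then show ?thesis using K(2-4,6,7,11) unfolding abs_le_iff by linarith
    qed
    have Upb: "\<bar>Up2 r\<bar> \<le> 40 * K"
      using m
    proof
      assume "m = 0"
      then have "Up2 r = P1 r - i * Up1 r + i\<^sup>2 * Up r + \<kappa>\<^sup>2 * Up r"
        using p' by (simp add: algebra_simps)
      then show ?thesis using P1b K(2-4) unfolding abs_le_iff by linarith
    next
      assume "m = 1"
      then have "Up2 r = P1 r - i * P r - i * Up1 r + 4 * (i\<^sup>2 * Up r) + \<kappa>\<^sup>2 * Up r"
        using p' by (simp add: algebra_simps)
      then show ?thesis using P1b K(2-4,12) unfolding abs_le_iff by linarith
    qed
    have Umb: "\<bar>Um2 r\<bar> \<le> 40 * K"
      using m
    proof
      assume "m = 0"
      then have "Um2 r = P1 r - i * Um1 r + i\<^sup>2 * Um r + \<kappa>\<^sup>2 * Um r"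
        using m' by (simp add: algebra_simps)
      then show ?thesis using P1b K(5-7) unfolding abs_le_iff by linarith
    next
      assume "m = 1"
      then have "Um2 r = P1 r + i * P r - i * Um1 r + \<kappa>\<^sup>2 * Um r"
        using m' by (simp add: algebra_simps)
      then show ?thesis using P1b K(6,7,12) unfolding abs_le_iff by linarith
    qed
    have Wb: "\<bar>W2 r\<bar> \<le> 40 * K"
      using m
    proof
      assume "m = 0"
      then have "W2 r = - (i * W1 r) + \<kappa>\<^sup>2 * W r - \<kappa> * P r"
        using w' by (simp add: algebra_simps)
      then show ?thesis using K(8-13) unfolding abs_le_iff by linarith
    next
      assume "m = 1"
      then have "W2 r = - (i * W1 r) + i\<^sup>2 * W r + \<kappa>\<^sup>2 * W r - \<kappa> * P r"
        using w' by (simp add: algebra_simps)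
      then show ?thesis using K(8-13) unfolding abs_le_iff by linarith
    qed
    have "norm (Y' r) \<le> \<bar>Up1 r\<bar> + (\<bar>Up2 r\<bar> + (\<bar>Um1 r\<bar> + (\<bar>Um2 r\<bar> + (\<bar>W1 r\<bar> + (\<bar>W2 r\<bar> + \<bar>P1 r\<bar>)))))"
      unfolding Y'_def by (intro order_trans[OF norm_Pair_le] add_mono) auto
    also have "\<dots> \<le> 1000 * K" using P1b Upb Umb Wb K1 by linarith
    finally show ?thesis by (simp add: K_def n_def)
  qed
  obtain l where l: "(Y \<longlongrightarrow> l) (at_right \<epsilon>)"
    by (rule linear_growth_limit_at_right[of \<epsilon> "\<epsilon> + 1" Y Y' "1000 * c\<^sup>2"]) (use dY bnd in auto)
  note l1 = tendsto_snd[OF l] and l2 = tendsto_snd[OF tendsto_snd[OF l]]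
  note l3 = tendsto_snd[OF l2] and l4 = tendsto_snd[OF tendsto_snd[OF l2]]
  note l5 = tendsto_snd[OF l4]
  show ?thesis
    using that tendsto_fst[OF l] tendsto_fst[OF l1] tendsto_fst[OF l2] tendsto_fst[OF l3]
      tendsto_fst[OF l4] tendsto_fst[OF l5] tendsto_snd[OF l5]
    by (simp add: Y_def)
qed

text \<open>The squared modulus of the mode. The halves come from \<open>\<bar>u\<^sub>1 + i
  u\<^sub>2\<bar>\<^sup>2 + \<bar>u\<^sub>1 - i u\<^sub>2\<bar>\<^sup>2 = 2
  (\<bar>u\<^sub>1\<bar>\<^sup>2 + \<bar>u\<^sub>2\<bar>\<^sup>2)\<close>; the same weights appear
  in \<open>flux\<close> and \<open>form\<close>.\<close>

definition N where "N r = (Up r)\<^sup>2 / 2 + (Um r)\<^sup>2 / 2 + (W r)\<^sup>2"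

text \<open>The pairing of a test field with \<open>r (\<partial>\<^sub>r u - p e\<^sub>r)\<close>. The transposed gradient in the stress is left
  out, because it does not contribute to the total force on the boundary.\<close>

definition flux where
  "flux tp tm tw r = r * ((Up1 r - P r) * tp r / 2 + (Um1 r - P r) * tm r / 2 + W1 r * tw r)"

text \<open>The symmetric bilinear density of the Dirichlet integral of a mode: unprimed arguments
  belong to one field, primed ones to the other, and \<open>a1\<close> stands for the radial
  derivative of \<open>a\<close>. The angular orders \<open>m + 1\<close>, \<open>m - 1\<close>,
  \<open>m\<close> of the three components give the coefficients of
  \<open>1 / r\<^sup>2\<close>.\<close>

definition form where
  "form r a1 a b1 b c1 c a1' a' b1' b' c1' c' =
     (a1 * a1' + ((m+1)\<^sup>2 / r\<^sup>2 + \<kappa>\<^sup>2) * a * a') / 2 + (b1 * b1' + ((m-1)\<^sup>2 / r\<^sup>2 + \<kappa>\<^sup>2) * b * b') / 2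
     + c1 * c1' + (m\<^sup>2 / r\<^sup>2 + \<kappa>\<^sup>2) * c * (c'::real)"

text \<open>Green's identity in differential form. The momentum equations remove the second
  derivatives, and what is left of the pressure is a multiple of the left-hand side of
  \<open>tdiv\<close>.\<close>

lemma flux_deriv:
  assumes r: "\<epsilon> < r"
    and tp: "(tp has_real_derivative tp1) (at r)" and tm: "(tm has_real_derivative tm1) (at r)"
    and tw: "(tw has_real_derivative tw1) (at r)"
    and tdiv: "tp1 + (m+1) * tp r / r + tm1 - (m-1) * tm r / r + 2 * \<kappa> * tw r = 0"
  shows "(flux tp tm tw has_real_derivative
    r * form r (Up1 r) (Up r) (Um1 r) (Um r) (W1 r) (W r) tp1 (tp r) tm1 (tm r) tw1 (tw r)) (at r)"
proof -
  have r0: "r \<noteq> 0" using r eps by simp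
  have p2: "r * Up2 r = - Up1 r + r * ((m+1)\<^sup>2 / r\<^sup>2 + \<kappa>\<^sup>2) * Up r + r * P1 r - m * P r"
    using arg_cong[OF eqp[OF r], of "\<lambda>x. r * x"] r0 by (simp add: algebra_simps)
  have m2: "r * Um2 r = - Um1 r + r * ((m-1)\<^sup>2 / r\<^sup>2 + \<kappa>\<^sup>2) * Um r + r * P1 r + m * P r"
    using arg_cong[OF eqm[OF r], of "\<lambda>x. r * x"] r0 by (simp add: algebra_simps)
  have w2: "r * W2 r = - W1 r + r * (m\<^sup>2 / r\<^sup>2 + \<kappa>\<^sup>2) * W r - r * \<kappa> * P r"
    using arg_cong[OF eqw[OF r], of "\<lambda>x. r * x"] r0 by (simp add: algebra_simps)
  define A where "A x = x / r\<^sup>2 + \<kappa>\<^sup>2" for x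
  have td: "r * tp1 + (m+1) * tp r + r * tm1 - (m-1) * tm r + 2 * r * \<kappa> * tw r = 0"
    using arg_cong[OF tdiv, of "\<lambda>x. r * x"] r0 by (simp add: algebra_simps add_divide_distrib diff_divide_distrib)
  have d: "(flux tp tm tw has_real_derivative
     ((Up1 r - P r) * tp r / 2 + (Um1 r - P r) * tm r / 2 + W1 r * tw r)
     + r * ((Up2 r - P1 r) * tp r / 2 + (Up1 r - P r) * tp1 / 2
        + (Um2 r - P1 r) * tm r / 2 + (Um1 r - P r) * tm1 / 2 + W2 r * tw r + W1 r * tw1)) (at r)"
    unfolding flux_def
    by (auto intro!: derivative_eq_intros dUp1[OF r] dUm1[OF r] dW1[OF r] dP[OF r] tp tm tw
      simp: field_simps)
  have e: "r * (Up2 r * x) = (- Up1 r + r * ((m+1)\<^sup>2 / r\<^sup>2 + \<kappa>\<^sup>2) * Up r + r * P1 r - m * P r) * x"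
    "r * (Um2 r * x) = (- Um1 r + r * ((m-1)\<^sup>2 / r\<^sup>2 + \<kappa>\<^sup>2) * Um r + r * P1 r + m * P r) * x"
    "r * (W2 r * x) = (- W1 r + r * (m\<^sup>2 / r\<^sup>2 + \<kappa>\<^sup>2) * W r - r * \<kappa> * P r) * x" for x
    by (simp_all only: p2[symmetric] m2[symmetric] w2[symmetric] mult.assoc[of r "Up2 r"] mult.assoc[of r "Um2 r"] mult.assoc[of r "W2 r"])
  have "((Up1 r - P r) * tp r / 2 + (Um1 r - P r) * tm r / 2 + W1 r * tw r)
     + r * ((Up2 r - P1 r) * tp r / 2 + (Up1 r - P r) * tp1 / 2
        + (Um2 r - P1 r) * tm r / 2 + (Um1 r - P r) * tm1 / 2 + W2 r * tw r + W1 r * tw1)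
    = ((Up1 r - P r) * tp r / 2 + (Um1 r - P r) * tm r / 2 + W1 r * tw r)
     + (r * (Up2 r * tp r) - r * P1 r * tp r) / 2 + r * (Up1 r - P r) * tp1 / 2
        + (r * (Um2 r * tm r) - r * P1 r * tm r) / 2 + r * (Um1 r - P r) * tm1 / 2
        + r * (W2 r * tw r) + r * W1 r * tw1"
    by (simp add: algebra_simps add_divide_distrib diff_divide_distrib)
  also have "\<dots> = r * form r (Up1 r) (Up r) (Um1 r) (Um r) (W1 r) (W r) tp1 (tp r) tm1 (tm r) tw1 (tw r)
     - P r / 2 * (r * tp1 + (m+1) * tp r + r * tm1 - (m-1) * tm r + 2 * r * \<kappa> * tw r)"
    unfolding e form_def A_def[symmetric]
    by (simp add: algebra_simps add_divide_distrib diff_divide_distrib)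
  finally show ?thesis using d unfolding td by simp
qed

section \<open>The energy identity and the sign of the flux\<close>

lemma flux_self_deriv:
  assumes "\<epsilon> < r"
  shows "(flux Up Um W has_real_derivative
    r * form r (Up1 r) (Up r) (Um1 r) (Um r) (W1 r) (W r) (Up1 r) (Up r) (Um1 r) (Um r) (W1 r) (W r)) (at r)"
  by (rule flux_deriv[OF assms dUp[OF assms] dUm[OF assms] dW[OF assms] div0[OF assms]])

lemma form_ge:
  "form r a1 a b1 b c1 c a1 a b1 b c1 c \<ge> \<kappa>\<^sup>2 * (a\<^sup>2 / 2 + b\<^sup>2 / 2 + c\<^sup>2)"
proof -
  have "form r a1 a b1 b c1 c a1 a b1 b c1 c = \<kappa>\<^sup>2 * (a\<^sup>2 / 2 + b\<^sup>2 / 2 + c\<^sup>2) +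
    (a1\<^sup>2 / 2 + b1\<^sup>2 / 2 + c1\<^sup>2 + (m+1)\<^sup>2 / r\<^sup>2 * a\<^sup>2 / 2 + (m-1)\<^sup>2 / r\<^sup>2 * b\<^sup>2 / 2 + m\<^sup>2 / r\<^sup>2 * c\<^sup>2)"
    by (simp add: form_def algebra_simps power2_eq_square add_divide_distrib)
  moreover have "0 \<le> a1\<^sup>2 / 2 + b1\<^sup>2 / 2 + c1\<^sup>2 + (m+1)\<^sup>2 / r\<^sup>2 * a\<^sup>2 / 2 + (m-1)\<^sup>2 / r\<^sup>2 * b\<^sup>2 / 2 + m\<^sup>2 / r\<^sup>2 * c\<^sup>2"
    by (intro add_nonneg_nonneg mult_nonneg_nonneg divide_nonneg_nonneg) auto
  ultimately show ?thesis by simp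
qed

lemma flux_self_mono:
  assumes "\<epsilon> < r" "r \<le> s"
  shows "flux Up Um W r \<le> flux Up Um W s"
proof (rule DERIV_nonneg_imp_nondecreasing[OF assms(2)])
  fix x assume "r \<le> x" "x \<le> s"
  then have x: "\<epsilon> < x" using assms by simp
  have "0 \<le> \<kappa>\<^sup>2 * ((Up x)\<^sup>2 / 2 + (Um x)\<^sup>2 / 2 + (W x)\<^sup>2)" by simp
  from order_trans[OF this form_ge] have "0 \<le> x * form x (Up1 x) (Up x) (Um1 x) (Um x) (W1 x) (W x) (Up1 x) (Up x) (Um1 x) (Um x) (W1 x) (W x)"
    using x eps by (intro mult_nonneg_nonneg) simp_all
  with flux_self_deriv[OF x] show "\<exists>y. (flux Up Um W has_real_derivative y) (at x) \<and> 0 \<le> y" by blast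
qed

lemma N_deriv:
  assumes r: "\<epsilon> < r"
  shows "(N has_real_derivative 2 * flux Up Um W r / r + P r * (Up r + Um r)) (at r)"
proof -
  have "r \<noteq> 0" using r eps by simp
  then show ?thesis
    unfolding N_def flux_def
    by (auto intro!: derivative_eq_intros dUp[OF r] dUm[OF r] dW[OF r] simp: field_simps)
qed

text \<open>A positive flux \<open>X\<close> would grow at least like \<open>r\<^sup>2\<close>, because \<open>N' = 2 X / r + o(\<surd>N)\<close> and
  \<open>X' \<ge> \<kappa>\<^sup>2 r N\<close>, and then \<open>N\<close> could not tend to \<open>0\<close>. This replaces any decay estimate for the
  derivatives and the pressure.\<close>

lemma flux_self_nonpos:
  assumes kp: "0 < \<kappa>" and r0: "\<epsilon> < r0"
  shows "flux Up Um W r0 \<le> 0"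
proof (rule ccontr)
  assume "\<not> flux Up Um W r0 \<le> 0"
  define X where "X = flux Up Um W"
  define \<delta> where "\<delta> = X r0"
  have \<delta>: "0 < \<delta>" using \<open>\<not> flux Up Um W r0 \<le> 0\<close> by (simp add: \<delta>_def X_def)
  have Xge: "\<delta> \<le> X r" if "r0 \<le> r" for r
    using flux_self_mono[OF r0 that] by (simp add: \<delta>_def X_def)
  have "(N \<longlongrightarrow> 0\<^sup>2 / 2 + 0\<^sup>2 / 2 + 0\<^sup>2) at_top"
    unfolding N_def by (intro tendsto_intros Up_inf Um_inf W_inf) auto
  then have Nlim: "(N \<longlongrightarrow> 0) at_top" by simp
  \<comment> \<open>Chosen so that \<open>4 * \<eta> / \<kappa>\<^sup>2 = 2 * \<delta>\<close> in
    the completed square below.\<close>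
  define \<eta> where "\<eta> = \<delta> * \<kappa>\<^sup>2 / 2"
  have \<eta>: "0 < \<eta>" using \<delta> kp by (simp add: \<eta>_def)
  have "\<forall>\<^sub>F r in at_top. N r < \<delta> / 4" "\<forall>\<^sub>F r in at_top. \<bar>P r\<bar> < sqrt \<eta>" "\<forall>\<^sub>F r in at_top. \<bar>P r\<bar> < 1"
     "\<forall>\<^sub>F r in at_top. \<bar>Up r\<bar> < 1" "\<forall>\<^sub>F r in at_top. \<bar>Um r\<bar> < 1" "\<forall>\<^sub>F r in at_top. r \<ge> max r0 1"
    using order_tendstoD(2)[OF Nlim, of "\<delta>/4"] \<delta> \<eta>
      order_tendstoD(2)[OF tendsto_rabs_zero[OF P_inf], of "sqrt \<eta>"]
      order_tendstoD(2)[OF tendsto_rabs_zero[OF P_inf], of 1]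
      order_tendstoD(2)[OF tendsto_rabs_zero[OF Up_inf], of 1]
      order_tendstoD(2)[OF tendsto_rabs_zero[OF Um_inf], of 1]
      eventually_ge_at_top[of "max r0 1"]
    by auto
  then have "\<forall>\<^sub>F r in at_top. N r < \<delta> / 4 \<and> \<bar>P r\<bar> < sqrt \<eta> \<and> \<bar>P r\<bar> < 1 \<and> \<bar>Up r\<bar> < 1 \<and> \<bar>Um r\<bar> < 1 \<and> r \<ge> max r0 1"
    by (intro eventually_conj)
  then obtain R where R: "\<And>r. r \<ge> R \<Longrightarrow> N r < \<delta> / 4 \<and> \<bar>P r\<bar> < sqrt \<eta> \<and> \<bar>P r\<bar> < 1 \<and> \<bar>Up r\<bar> < 1 \<and> \<bar>Um r\<bar> < 1 \<and> r \<ge> max r0 1"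
    by (auto simp: eventually_at_top_linorder)
  have RR: "1 \<le> R" "r0 \<le> R" using R[of R] by auto
  \<comment> \<open>Monotonicity of \<open>G\<close> expresses quadratic growth of
    \<open>N + X / 2\<close>. Subtracting \<open>\<delta> / 4\<close> compensates \<open>N\<close>,
    which is below \<open>\<delta> / 4\<close> from \<open>R\<close> on, so that twice the numerator
    is at most \<open>X\<close>.\<close>
  define G where "G r = (N r + X r / 2 - \<delta> / 4) / r\<^sup>2" for r
  have Gmono: "G R \<le> G r" if "R \<le> r" for r
  proof (rule DERIV_nonneg_imp_nondecreasing[OF that])
    fix x assume "R \<le> x" "x \<le> r"
    then have x1: "1 \<le> x" and xe: "\<epsilon> < x" and xr0: "r0 \<le> x" using RR r0 by auto
    note Rx = R[OF \<open>R \<le> x\<close>]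
    define F where "F = form x (Up1 x) (Up x) (Um1 x) (Um x) (W1 x) (W x) (Up1 x) (Up x) (Um1 x) (Um x) (W1 x) (W x)"
    define N' where "N' = 2 * X x / x + P x * (Up x + Um x)"
    have dG: "(G has_real_derivative ((N' + x * F / 2) * x\<^sup>2 - (N x + X x / 2 - \<delta> / 4) * (2 * x)) / (x\<^sup>2 * x\<^sup>2)) (at x)"
      unfolding G_def N'_def X_def F_def using x1
      by (auto intro!: derivative_eq_intros N_deriv[OF xe] flux_self_deriv[OF xe] simp: power2_eq_square)
    have F: "\<kappa>\<^sup>2 * N x \<le> F" unfolding F_def N_def by (rule form_ge)
    have P2: "(P x)\<^sup>2 \<le> \<eta>" using Rx \<eta> by (metis abs_le_square_iff abs_of_nonneg less_eq_real_def real_sqrt_pow2 real_sqrt_ge_zero)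
    \<comment> \<open>This square absorbs the indefinite pressure term
      \<open>P x * (Up x + Um x)\<close> into the part \<open>\<kappa>\<^sup>2 * N x\<close> of the
      energy density; the remainder \<open>4 * (P x)\<^sup>2 / \<kappa>\<^sup>2\<close> is at most
      \<open>2 * \<delta>\<close>.\<close>
    have sq: "0 \<le> (\<kappa> * x * (Up x + Um x) / 2 + 2 * P x / \<kappa>)\<^sup>2" by simp
    have uu: "(Up x + Um x)\<^sup>2 \<le> 4 * N x"
    proof -
      have "(Up x + Um x)\<^sup>2 + (Up x - Um x)\<^sup>2 + 4 * (W x)\<^sup>2 = 4 * N x" by (simp add: N_def power2_eq_square algebra_simps)
      moreover have "0 \<le> (Up x - Um x)\<^sup>2" "0 \<le> (W x)\<^sup>2" by auto
      ultimately show ?thesis by linarith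
    qed
    have "0 \<le> \<kappa>\<^sup>2 * x\<^sup>2 * (Up x + Um x)\<^sup>2 / 4 + 2 * x * P x * (Up x + Um x) + 4 * (P x)\<^sup>2 / \<kappa>\<^sup>2"
      using sq kp by (simp add: power2_eq_square field_simps)
    also have "\<dots> \<le> \<kappa>\<^sup>2 * x\<^sup>2 * (4 * N x) / 4 + 2 * x * P x * (Up x + Um x) + 4 * \<eta> / \<kappa>\<^sup>2"
      using uu P2 by (intro add_mono order_refl divide_right_mono mult_left_mono) auto
    also have "\<dots> = \<kappa>\<^sup>2 * x\<^sup>2 * N x + 2 * x * P x * (Up x + Um x) + 2 * \<delta>"
      using kp by (simp add: \<eta>_def)
    finally have am: "0 \<le> \<kappa>\<^sup>2 * x\<^sup>2 * N x + 2 * x * P x * (Up x + Um x) + 2 * \<delta>" .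
    have xF: "x\<^sup>2 * (\<kappa>\<^sup>2 * N x) \<le> x\<^sup>2 * F" using F by (intro mult_left_mono) auto
    have "(N' + x * F / 2) * x = 2 * X x + x * P x * (Up x + Um x) + x\<^sup>2 * F / 2"
      using x1 by (simp add: N'_def power2_eq_square field_simps)
    also have "\<dots> \<ge> 2 * X x - \<delta>" using am xF by (simp add: algebra_simps)
    finally have h1: "(N' + x * F / 2) * x \<ge> X x" using Xge[OF xr0] by linarith
    have h2: "2 * (N x + X x / 2 - \<delta> / 4) \<le> X x" using conjunct1[OF Rx] by (simp add: field_simps)
    have "0 \<le> ((N' + x * F / 2) * x - 2 * (N x + X x / 2 - \<delta> / 4)) * x"
      using h1 h2 x1 by (intro mult_nonneg_nonneg) auto
    then have "0 \<le> (N' + x * F / 2) * x\<^sup>2 - (N x + X x / 2 - \<delta> / 4) * (2 * x)"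
      by (simp add: algebra_simps power2_eq_square)
    then have "0 \<le> ((N' + x * F / 2) * x\<^sup>2 - (N x + X x / 2 - \<delta> / 4) * (2 * x)) / (x\<^sup>2 * x\<^sup>2)"
      by (rule divide_nonneg_nonneg) simp
    with dG show "\<exists>y. (G has_real_derivative y) (at x) \<and> 0 \<le> y" by blast
  qed
  define c where "c = G R"
  have N0: "0 \<le> N r" for r by (simp add: N_def)
  have c: "0 < c" unfolding c_def G_def using RR Xge[of R] N0[of R] \<delta> by (intro divide_pos_pos) auto
  have Xq: "X r \<ge> 2 * c * r\<^sup>2" if "R \<le> r" for r
  proof -
    have "c * r\<^sup>2 \<le> N r + X r / 2 - \<delta> / 4"
      using Gmono[OF that] that RR by (simp add: c_def G_def pos_le_divide_eq)
    then show ?thesis using conjunct1[OF R[OF that]] by linarith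
  qed
  \<comment> \<open>Beyond \<open>1 / c\<close> the flux term of the derivative of \<open>N\<close>
    is at least 4 and the pressure term at most 2 in modulus. So \<open>N\<close> has slope at least
    1 and leaves the range below \<open>\<delta> / 4\<close> within distance
    \<open>\<delta>\<close>.\<close>
  define R1 where "R1 = max R (1 / c)"
  have N1: "N r - N R1 \<ge> (r - R1) * 1" if "R1 < r" for r
  proof -
    have "\<exists>z>R1. z < r \<and> N r - N R1 = (r - R1) * (2 * flux Up Um W z / z + P z * (Up z + Um z))"
      by (rule MVT2[OF that]) (use N_deriv RR r0 in \<open>auto simp: R1_def\<close>)
    then obtain z where z: "z > R1" "z < r" "N r - N R1 = (r - R1) * (2 * X z / z + P z * (Up z + Um z))"
      by (auto simp: X_def)
    have zR: "R \<le> z" "1 / c \<le> z" using z by (auto simp: R1_def)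
    note Rz = R[OF zR(1)]
    have "1 \<le> c * z" using zR c by (simp add: pos_divide_le_eq mult.commute)
    have "2 * (2 * c * z\<^sup>2) / z \<le> 2 * X z / z" using Xq[OF zR(1)] Rz by (intro divide_right_mono) auto
    then have "4 * (c * z) \<le> 2 * X z / z" using Rz by (simp add: power2_eq_square)
    moreover have "\<bar>P z * (Up z + Um z)\<bar> \<le> 1 * 2" unfolding abs_mult using Rz by (intro mult_mono) auto
    ultimately have "1 \<le> 2 * X z / z + P z * (Up z + Um z)" using \<open>1 \<le> c * z\<close> by linarith
    then show ?thesis unfolding z(3) using that by (intro mult_left_mono) auto
  qed
  have "N (R1 + \<delta>) - N R1 \<ge> \<delta>" using N1[of "R1 + \<delta>"] \<delta> by simp
  moreover have "N (R1 + \<delta>) < \<delta> / 4" using R[of "R1 + \<delta>"] \<delta> by (auto simp: R1_def)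
  ultimately show False using N0[of R1] \<delta> by linarith
qed

text \<open>The Cauchy-Schwarz inequality for the energy form, without integrals: the flux of \<open>u + l w\<close> paired
  with itself is increasing in \<open>r\<close> for every \<open>l\<close>, which bounds the discriminant of a quadratic in \<open>l\<close>.
  The function \<open>\<Psi>\<close> is an antiderivative of an upper bound for the energy density of the test field.\<close>

lemma flux_test_bound:
  assumes kp: "0 < \<kappa>" and \<rho>: "\<epsilon> < \<rho>" "\<rho> \<le> R"
    and tp: "\<And>r. \<rho> \<le> r \<Longrightarrow> r \<le> R \<Longrightarrow> (tp has_real_derivative tp1 r) (at r)"
    and tm: "\<And>r. \<rho> \<le> r \<Longrightarrow> r \<le> R \<Longrightarrow> (tm has_real_derivative tm1 r) (at r)"
    and tw: "\<And>r. \<rho> \<le> r \<Longrightarrow> r \<le> R \<Longrightarrow> (tw has_real_derivative tw1 r) (at r)"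
    and \<Psi>: "\<And>r. \<rho> \<le> r \<Longrightarrow> r \<le> R \<Longrightarrow> (\<Psi> has_real_derivative \<psi> r) (at r)"
    and tdiv: "\<And>r. \<rho> \<le> r \<Longrightarrow> r \<le> R \<Longrightarrow> tp1 r + (m+1) * tp r / r + tm1 r - (m-1) * tm r / r + 2 * \<kappa> * tw r = 0"
    and maj: "\<And>r. \<rho> \<le> r \<Longrightarrow> r \<le> R \<Longrightarrow>
       r * form r (tp1 r) (tp r) (tm1 r) (tm r) (tw1 r) (tw r) (tp1 r) (tp r) (tm1 r) (tm r) (tw1 r) (tw r) \<le> \<psi> r"
    and tR: "tp R = 0" "tm R = 0" "tw R = 0"
    and e: "\<Psi> R - \<Psi> \<rho> \<le> e"
  shows "(flux tp tm tw \<rho>)\<^sup>2 \<le> - flux Up Um W \<rho> * e"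
proof -
  define A B where "A = - flux Up Um W \<rho>" and "B = flux tp tm tw \<rho>"
  have quad: "0 \<le> A - 2 * l * B + l\<^sup>2 * e" for l
  proof -
    let ?H = "\<lambda>r. flux Up Um W r + 2 * l * flux tp tm tw r + l\<^sup>2 * \<Psi> r"
    have "?H \<rho> \<le> ?H R"
    proof (rule DERIV_nonneg_imp_nondecreasing[OF \<rho>(2)])
      fix r assume r: "\<rho> \<le> r" "r \<le> R"
      then have re: "\<epsilon> < r" using \<rho> by simp
      let ?u = "form r (Up1 r) (Up r) (Um1 r) (Um r) (W1 r) (W r) (Up1 r) (Up r) (Um1 r) (Um r) (W1 r) (W r)"
      let ?v = "form r (Up1 r) (Up r) (Um1 r) (Um r) (W1 r) (W r) (tp1 r) (tp r) (tm1 r) (tm r) (tw1 r) (tw r)"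
      let ?t = "form r (tp1 r) (tp r) (tm1 r) (tm r) (tw1 r) (tw r) (tp1 r) (tp r) (tm1 r) (tm r) (tw1 r) (tw r)"
      have d: "(?H has_real_derivative r * ?u + 2 * l * (r * ?v) + l\<^sup>2 * \<psi> r) (at r)"
        by (intro DERIV_add DERIV_cmult flux_self_deriv flux_deriv re tp tm tw tdiv r \<Psi>)
      define A where "A x = x / r\<^sup>2 + \<kappa>\<^sup>2" for x
      have "l\<^sup>2 * (r * ?t) \<le> l\<^sup>2 * \<psi> r" using maj[OF r] by (intro mult_left_mono) auto
      moreover have "0 \<le> r * form r (Up1 r + l * tp1 r) (Up r + l * tp r) (Um1 r + l * tm1 r) (Um r + l * tm r)
         (W1 r + l * tw1 r) (W r + l * tw r) (Up1 r + l * tp1 r) (Up r + l * tp r) (Um1 r + l * tm1 r) (Um r + l * tm r)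
         (W1 r + l * tw1 r) (W r + l * tw r)" (is "0 \<le> r * ?s")
      proof (intro mult_nonneg_nonneg)
        show "0 \<le> ?s" by (rule order_trans[OF _ form_ge]) auto
      qed (use re eps in auto)
      moreover have "r * ?s = r * ?u + 2 * l * (r * ?v) + l\<^sup>2 * (r * ?t)"
        unfolding form_def A_def[symmetric]
        by (simp add: algebra_simps power2_eq_square add_divide_distrib)
      ultimately have "0 \<le> r * ?u + 2 * l * (r * ?v) + l\<^sup>2 * \<psi> r" by linarith
      with d show "\<exists>y. (?H has_real_derivative y) (at r) \<and> 0 \<le> y" by blast
    qed
    moreover have "flux tp tm tw R = 0" by (simp add: flux_def tR)
    \<comment> \<open>The decay at infinity enters through this sign, which allows everything
      outside the circle of radius \<open>R\<close> to be dropped.\<close>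
    moreover have "flux Up Um W R \<le> 0" using flux_self_nonpos[OF kp] \<rho> by simp
    moreover have "l\<^sup>2 * (\<Psi> R - \<Psi> \<rho>) \<le> l\<^sup>2 * e" using e by (intro mult_left_mono) auto
    ultimately show ?thesis by (simp add: A_def B_def algebra_simps)
  qed
  have A0: "0 \<le> A" using quad[of 0] by simp
  show ?thesis
  proof (cases "e > 0")
    case True
    \<comment> \<open>\<open>l = B / e\<close> minimises the quadratic.\<close>
    have "0 \<le> (A - 2 * (B / e) * B + (B / e)\<^sup>2 * e) * e" using quad[of "B / e"] True by (intro mult_nonneg_nonneg) auto
    also have "\<dots> = A * e - B\<^sup>2" using True by (simp add: field_simps power2_eq_square)
    finally show ?thesis by (simp add: A_def B_def)
  next
    case False
    have "B = 0"
    proof (rule ccontr)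
      assume "B \<noteq> 0"
      have "((A + 1) / (2 * B))\<^sup>2 * e \<le> 0" using False by (intro mult_nonneg_nonpos) auto
      then have "0 \<le> A - 2 * ((A + 1) / (2 * B)) * B" using quad[of "(A + 1) / (2 * B)"] by linarith
      also have "\<dots> = - 1" using \<open>B \<noteq> 0\<close> by (simp add: field_simps)
      finally show False by simp
    qed
    have "e = 0 \<or> A = 0"
    proof (rule ccontr)
      assume "\<not> ?thesis"
      then have "e < 0" "0 < A" using False A0 by auto
      have "0 \<le> A + (sqrt (2 * A / - e))\<^sup>2 * e" using quad[of "sqrt (2 * A / - e)"] \<open>B = 0\<close> by simp
      also have "\<dots> = - A" using \<open>e < 0\<close> \<open>0 < A\<close> by (simp add: divide_nonneg_neg)
      finally show False using \<open>0 < A\<close> by simp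
    qed
    then show ?thesis using \<open>B = 0\<close> by (auto simp: A_def B_def)
  qed
qed

end

section \<open>Test fields and the traction of a mode\<close>

text \<open>Properties of the cutoff \<open>ln (R / r) / L\<close>, which falls from 1 at
  \<open>\<rho>\<close> to 0 at \<open>R\<close>. The last one spends one factor of the squared
  logarithm through \<open>ln y \<le> y - 1\<close>; the linear factor \<open>R - r\<close> that
  replaces it has an elementary antiderivative, and only one power of \<open>1 / L\<close>
  remains.\<close>

lemma log_layer:
  fixes \<rho> \<kappa> :: real
  assumes "0 < \<rho>" "\<rho> < 1" "1 \<le> \<kappa>"
  defines "R \<equiv> \<rho> + 1 / \<kappa>"
  defines "L \<equiv> ln (R / \<rho>)"
  shows "0 < L" "\<rho> \<le> R" "1 / L \<le> \<kappa> / ln (1 / \<rho>)"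
    and "\<And>r. \<rho> \<le> r \<Longrightarrow> r \<le> R \<Longrightarrow> 0 \<le> ln (R / r)"
    and "\<And>r. \<rho> \<le> r \<Longrightarrow> r \<le> R \<Longrightarrow> ln (R / r) \<le> L"
    and "\<And>r. \<rho> \<le> r \<Longrightarrow> r \<le> R \<Longrightarrow> \<kappa>\<^sup>2 * r * (ln (R / r) / L)\<^sup>2 \<le> \<kappa>\<^sup>2 * (R - r) / L"
proof -
  have R: "\<rho> < R" using assms by (simp add: R_def)
  then show "\<rho> \<le> R" by simp
  show L: "0 < L" using R assms(1) unfolding L_def by (intro ln_gt_zero) simp
  show pos: "0 \<le> ln (R / r)" if "\<rho> \<le> r" "r \<le> R" for r
    using that assms by simp
  show le: "ln (R / r) \<le> L" if "\<rho> \<le> r" "r \<le> R" for r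
    using that assms R unfolding L_def by (intro ln_mono divide_left_mono divide_pos_pos) auto
  show "\<kappa>\<^sup>2 * r * (ln (R / r) / L)\<^sup>2 \<le> \<kappa>\<^sup>2 * (R - r) / L" if r: "\<rho> \<le> r" "r \<le> R" for r
  proof -
    have r0: "0 < r" using r assms by simp
    have "ln (R / r) \<le> R / r - 1" using r0 R r by (intro ln_le_minus_one) simp
    then have "r * ln (R / r) \<le> r * (R / r - 1)" using r0 by (intro mult_left_mono) auto
    then have 1: "r * ln (R / r) \<le> R - r" using r0 by (simp add: right_diff_distrib)
    have "r * (ln (R / r))\<^sup>2 = (r * ln (R / r)) * ln (R / r)" by (simp add: power2_eq_square)
    also have "\<dots> \<le> (R - r) * L" using 1 pos[OF r] le[OF r] r r0 by (intro mult_mono) auto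
    finally have "r * (ln (R / r))\<^sup>2 / L\<^sup>2 \<le> (R - r) * L / L\<^sup>2" by (intro divide_right_mono) auto
    also have "\<dots> = (R - r) / L" using L by (simp add: power2_eq_square)
    finally have "\<kappa>\<^sup>2 * (r * (ln (R / r))\<^sup>2 / L\<^sup>2) \<le> \<kappa>\<^sup>2 * ((R - r) / L)" by (intro mult_left_mono) auto
    then show ?thesis by (simp add: power_divide)
  qed
  show "1 / L \<le> \<kappa> / ln (1 / \<rho>)"
  proof -
    have lp: "0 < ln (1 / \<rho>)" using assms by simp
    define x where "x = 1 / \<rho>"
    have x: "1 < x" using assms by (simp add: x_def)
    have k: "0 \<le> 1 / \<kappa>" "1 / \<kappa> \<le> 1" using assms by auto
    \<comment> \<open>\<open>R / \<rho> = 1 + x / \<kappa>\<close> is the convex combination of 1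
      and \<open>1 + x\<close> with weights \<open>1 - 1 / \<kappa>\<close> and
      \<open>1 / \<kappa>\<close>. Concavity of \<open>ln\<close> costs the factor
      \<open>\<kappa>\<close>, which is the origin of the derivative in the final norm.\<close>
    have "- ln ((1 - 1 / \<kappa>) *\<^sub>R 1 + (1 / \<kappa>) *\<^sub>R (1 + x)) \<le> (1 - 1 / \<kappa>) * (- ln 1) + (1 / \<kappa>) * (- ln (1 + x))"
      using minus_log_convex[of "exp 1"] k x
      by (intro convex_onD[where A="{0<..}"]) (auto simp: log_def)
    then have "ln (1 + x) / \<kappa> \<le> ln ((1 - 1 / \<kappa>) + (1 + x) / \<kappa>)" by simp
    also have "(1 - 1 / \<kappa>) + (1 + x) / \<kappa> = R / \<rho>" using assms by (simp add: R_def x_def field_simps)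
    finally have "ln (1 + x) \<le> \<kappa> * L" using assms by (simp add: L_def pos_divide_le_eq mult.commute)
    moreover have "ln (1 / \<rho>) \<le> ln (1 + x)" using x unfolding x_def[symmetric] by (intro ln_mono) auto
    ultimately have "ln (1 / \<rho>) \<le> \<kappa> * L" by linarith
    then show ?thesis using lp L by (simp add: pos_divide_le_eq pos_le_divide_eq mult.commute)
  qed
qed

lemma square_le_of_abs: "\<bar>x\<bar> \<le> y \<Longrightarrow> x\<^sup>2 \<le> (y::real)\<^sup>2"
  by (metis abs_ge_zero power2_abs power_mono)

context radial_stokes
begin

text \<open>The shared end of both logarithmic cutoffs. The two terms of the majorant integrate over
  \<open>[\<rho>, R]\<close> to \<open>60 / L\<close> and \<open>30 / L\<close>; the coefficient 60
  is large enough for both test fields below.\<close>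

lemma traction_energy_log:
  assumes kp: "1 \<le> \<kappa>" and \<rho>: "\<epsilon> < \<rho>" "\<rho> < 1"
  defines "R \<equiv> \<rho> + 1 / \<kappa>"
  defines "L \<equiv> ln (R / \<rho>)"
  assumes tp: "\<And>r. \<rho> \<le> r \<Longrightarrow> r \<le> R \<Longrightarrow> (tp has_real_derivative tp1 r) (at r)"
    and tm: "\<And>r. \<rho> \<le> r \<Longrightarrow> r \<le> R \<Longrightarrow> (tm has_real_derivative tm1 r) (at r)"
    and tw: "\<And>r. \<rho> \<le> r \<Longrightarrow> r \<le> R \<Longrightarrow> (tw has_real_derivative tw1 r) (at r)"
    and tdiv: "\<And>r. \<rho> \<le> r \<Longrightarrow> r \<le> R \<Longrightarrow> tp1 r + (m+1) * tp r / r + tm1 r - (m-1) * tm r / r + 2 * \<kappa> * tw r = 0"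
    and maj: "\<And>r. \<rho> \<le> r \<Longrightarrow> r \<le> R \<Longrightarrow>
       r * form r (tp1 r) (tp r) (tm1 r) (tm r) (tw1 r) (tw r) (tp1 r) (tp r) (tm1 r) (tm r) (tw1 r) (tw r)
         \<le> 60 / (L\<^sup>2 * r) + 60 * (\<kappa>\<^sup>2 * (R - r) / L)"
    and tR: "tp R = 0" "tm R = 0" "tw R = 0"
  shows "(flux tp tm tw \<rho>)\<^sup>2 \<le> - flux Up Um W \<rho> * (100 * \<kappa> / ln (1 / \<rho>))"
proof -
  have \<rho>0: "0 < \<rho>" using eps \<rho> by simp
  note ll = log_layer[OF \<rho>0 \<rho>(2) kp, folded R_def, folded L_def]
  define \<Psi> where "\<Psi> r = 60 / L\<^sup>2 * ln r - 60 * \<kappa>\<^sup>2 / (2 * L) * (R - r)\<^sup>2" for r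
  have L0: "L \<noteq> 0" using ll(1) by simp
  have R0: "0 < R" using ll(2) \<rho>0 by linarith
  have k0: "\<kappa> \<noteq> 0" using kp by simp
  show ?thesis
  proof (rule flux_test_bound[where \<Psi>=\<Psi> and \<psi>="\<lambda>r. 60 / (L\<^sup>2 * r) + 60 * (\<kappa>\<^sup>2 * (R - r) / L)",
        OF _ \<rho>(1) ll(2) tp tm tw _ tdiv maj tR])
    show "0 < \<kappa>" using kp by simp
    show "(\<Psi> has_real_derivative 60 / (L\<^sup>2 * r) + 60 * (\<kappa>\<^sup>2 * (R - r) / L)) (at r)"
      if "\<rho> \<le> r" "r \<le> R" for r
    proof -
      have "0 < r" using that \<rho>0 by simp
      then show ?thesis unfolding \<Psi>_def
        by (auto intro!: derivative_eq_intros simp: L0 power2_eq_square field_simps)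
    qed
    have "\<Psi> R - \<Psi> \<rho> = 60 / L\<^sup>2 * (ln R - ln \<rho>) + 60 * \<kappa>\<^sup>2 / (2 * L) * (R - \<rho>)\<^sup>2"
      by (simp add: \<Psi>_def algebra_simps diff_divide_distrib)
    also have "ln R - ln \<rho> = L" using R0 \<rho>0 by (simp add: L_def ln_div)
    also have "60 / L\<^sup>2 * L + 60 * \<kappa>\<^sup>2 / (2 * L) * (R - \<rho>)\<^sup>2 = 90 * (1 / L)"
      using L0 k0 by (simp add: R_def power2_eq_square field_simps)
    also have "\<dots> \<le> 100 * (\<kappa> / ln (1 / \<rho>))" using ll(3) ll(1) kp \<rho> \<rho>0
      by (intro mult_mono) auto
    finally show "\<Psi> R - \<Psi> \<rho> \<le> 100 * \<kappa> / ln (1 / \<rho>)" by simp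
  qed
qed

text \<open>The test field has stream function \<open>- (\<kappa> / 2) (r\<^sup>2 - \<rho>\<^sup>2) (l / L)\<^sup>2\<close>.\<close>

lemma traction_energy_axial:
  assumes m: "m = 0" and kp: "1 \<le> \<kappa>" and \<rho>: "\<epsilon> < \<rho>" "\<rho> < 1"
  shows "(\<rho> * W1 \<rho>)\<^sup>2 \<le> - flux Up Um W \<rho> * (100 * \<kappa> / ln (1 / \<rho>))"
proof -
  define R where "R = \<rho> + 1 / \<kappa>"
  define L where "L = ln (R / \<rho>)"
  have \<rho>0: "0 < \<rho>" using eps \<rho> by simp
  note ll = log_layer[OF \<rho>0 \<rho>(2) kp, folded R_def, folded L_def]
  have L: "L > 0" by (rule ll(1))
  have R0: "0 < R" using ll(2) \<rho>0 by linarith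
  define l where "l r = ln (R / r)" for r
  \<comment> \<open>\<open>t\<close> is the stream function divided by \<open>r\<close>, and
    \<open>tw\<close> is minus its derivative divided by \<open>\<kappa> r\<close>. The factor
    \<open>r\<^sup>2 - \<rho>\<^sup>2\<close> gives \<open>t = 0\<close> and \<open>tw = 1\<close>
    at \<open>\<rho>\<close>; the squared logarithm makes both vanish at \<open>R\<close>. The
    derivative \<open>t1\<close> is read off from the divergence equation.\<close>
  define tw where "tw r = ((l r)\<^sup>2 - (1 - \<rho>\<^sup>2 / r\<^sup>2) * l r) / L\<^sup>2" for r
  define tw1 where "tw1 r = (- 2 * l r / r - 2 * \<rho>\<^sup>2 / r^3 * l r + (1 - \<rho>\<^sup>2 / r\<^sup>2) / r) / L\<^sup>2" for r
  define t where "t r = - \<kappa> / 2 * (r - \<rho>\<^sup>2 / r) * (l r)\<^sup>2 / L\<^sup>2" for r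
  define t1 where "t1 r = - t r / r - \<kappa> * tw r" for r
  have dl: "(l has_real_derivative - 1 / r) (at r)" if "0 < r" for r
    unfolding l_def using that R0 by (auto intro!: derivative_eq_intros simp: field_simps)
  have "(flux t t tw \<rho>)\<^sup>2 \<le> - flux Up Um W \<rho> * (100 * \<kappa> / ln (1 / \<rho>))"
  proof (rule traction_energy_log[OF kp \<rho>, folded R_def, folded L_def])
    fix r assume r: "\<rho> \<le> r" "r \<le> R"
    have r0: "0 < r" using r \<rho>0 by simp
    show "(t has_real_derivative t1 r) (at r)" "(t has_real_derivative t1 r) (at r)"
      unfolding t_def t1_def tw_def using r0 L
      by (auto intro!: derivative_eq_intros dl[OF r0] simp: field_simps power2_eq_square power3_eq_cube)
    show "(tw has_real_derivative tw1 r) (at r)"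
      unfolding tw_def tw1_def using r0 L
      by (auto intro!: derivative_eq_intros dl[OF r0] simp: field_simps power2_eq_square power3_eq_cube)
    show "t1 r + (m+1) * t r / r + t1 r - (m-1) * t r / r + 2 * \<kappa> * tw r = 0"
      using r0 by (simp add: t1_def m)
    define s where "s = l r / L"
    have l: "0 \<le> l r" "l r \<le> L" using ll(4,5)[OF r] by (auto simp: l_def)
    have s: "0 \<le> s" "s \<le> 1" using l L by (auto simp: s_def)
    define q where "q = 1 - \<rho>\<^sup>2 / r\<^sup>2"
    have "\<rho>\<^sup>2 \<le> r\<^sup>2" using r \<rho>0 by (intro power_mono) auto
    then have q: "0 \<le> q" "q \<le> 1" using r0 by (auto simp: q_def)
    \<comment> \<open>When \<open>\<kappa> \<rho>\<close> is large, \<open>L\<close> is small, and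
      the term \<open>q / L\<close> of \<open>tw\<close> is bounded only because \<open>q\<close> is
      small of the same order across the layer.\<close>
    have q2: "q \<le> 2 * L"
    proof -
      have "ln ((\<rho> / r)\<^sup>2) \<le> (\<rho> / r)\<^sup>2 - 1" using r0 \<rho>0 by (intro ln_le_minus_one) auto
      then have "q \<le> - ln ((\<rho> / r)\<^sup>2)" by (simp add: q_def power_divide)
      also have "\<dots> = 2 * (ln r - ln \<rho>)" using r0 \<rho>0 by (simp add: ln_realpow ln_div)
      also have "\<dots> \<le> 2 * (ln R - ln \<rho>)" using r r0 R0 by simp
      also have "\<dots> = 2 * L" using R0 \<rho>0 by (simp add: L_def ln_div)
      finally show ?thesis .
    qed
    define S2 where "S2 = \<kappa>\<^sup>2 * (R - r) / L"
    have S2: "\<kappa>\<^sup>2 * r * s\<^sup>2 \<le> S2" unfolding s_def S2_def l_def by (rule ll(6)[OF r])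
    have "tw r = ((l r)\<^sup>2 - q * l r) / L\<^sup>2" by (simp add: tw_def q_def)
    then have tws: "tw r = s * (s - q / L)" using L by (simp add: s_def field_simps power2_eq_square)
    have qL: "0 \<le> q / L" "q / L \<le> 2" using q q2 L by (auto simp: pos_divide_le_eq)
    have "\<bar>tw r\<bar> \<le> 3 * s"
      unfolding tws abs_mult using s qL by (simp add: mult.commute[of 3] mult_left_mono abs_le_iff)
    then have "(tw r)\<^sup>2 \<le> (3 * s)\<^sup>2" by (rule square_le_of_abs)
    then have tw2: "(tw r)\<^sup>2 \<le> 9 * s\<^sup>2" by (simp add: power_mult_distrib)
    have ts: "t r / r = - \<kappa> / 2 * q * s\<^sup>2" using r0 L by (simp add: t_def q_def s_def field_simps power2_eq_square)
    have "\<bar>t r / r\<bar> = \<kappa> / 2 * (q * (s * s))" using kp q s by (simp add: ts abs_mult power2_eq_square)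
    also have "\<dots> \<le> \<kappa> / 2 * (1 * (1 * s))" using kp q s by (intro mult_left_mono mult_mono) auto
    finally have "(t r / r)\<^sup>2 \<le> (\<kappa> / 2 * s)\<^sup>2" by (intro square_le_of_abs) simp
    then have tr2: "(t r / r)\<^sup>2 \<le> \<kappa>\<^sup>2 * s\<^sup>2 / 4" by (simp add: power_mult_distrib power_divide)
    \<comment> \<open>\<open>q\<close> vanishes at \<open>\<rho>\<close> and the layer has width
      \<open>1 / \<kappa>\<close>; this cancels the factor \<open>\<kappa>\<close> in
      \<open>t\<close>.\<close>
    have rq: "r * q \<le> 2 / \<kappa>"
    proof -
      have "r * q = (r - \<rho>) * ((r + \<rho>) / r)" using r0 by (simp add: q_def field_simps power2_eq_square)
      also have "\<dots> \<le> (R - \<rho>) * 2" using r r0 \<rho>0 by (intro mult_mono) (auto simp: pos_divide_le_eq)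
      finally show ?thesis by (simp add: R_def)
    qed
    have tq: "t r = - \<kappa> / 2 * (r * q) * (s * s)" using ts r0 by (simp add: field_simps power2_eq_square)
    have "\<bar>t r\<bar> = \<kappa> / 2 * ((r * q) * (s * s))" using kp q s r0 by (simp add: tq abs_mult)
    also have "\<dots> \<le> \<kappa> / 2 * ((2 / \<kappa>) * (1 * s))" using kp q s rq r0 by (intro mult_left_mono mult_mono) auto
    also have "\<dots> = s" using kp by simp
    finally have tt: "(t r)\<^sup>2 \<le> s\<^sup>2" by (rule square_le_of_abs)
    have "(t1 r)\<^sup>2 \<le> 2 * (t r / r)\<^sup>2 + 2 * (\<kappa> * tw r)\<^sup>2"
    proof -
      have "(- x - y)\<^sup>2 \<le> 2 * x\<^sup>2 + 2 * y\<^sup>2" for x y :: real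
        using zero_le_power2[of "x - y"] by (simp add: power2_eq_square algebra_simps)
      then show ?thesis by (simp add: t1_def)
    qed
    then have t12: "(t1 r)\<^sup>2 \<le> 2 * (t r / r)\<^sup>2 + 2 * \<kappa>\<^sup>2 * (tw r)\<^sup>2" by (simp add: power_mult_distrib)
    have k9: "\<kappa>\<^sup>2 * (tw r)\<^sup>2 \<le> \<kappa>\<^sup>2 * (9 * s\<^sup>2)" "\<kappa>\<^sup>2 * (t r)\<^sup>2 \<le> \<kappa>\<^sup>2 * s\<^sup>2" using tw2 tt by (auto intro: mult_left_mono)
    have tw1s: "tw1 r = (- 2 * s - 2 * (\<rho>\<^sup>2 / r\<^sup>2) * s + q / L) / (L * r)"
      using r0 L by (simp add: tw1_def s_def q_def field_simps power2_eq_square power3_eq_cube)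
    have "\<rho>\<^sup>2 / r\<^sup>2 = 1 - q" by (simp add: q_def)
    then have "0 \<le> (\<rho>\<^sup>2 / r\<^sup>2) * s" "(\<rho>\<^sup>2 / r\<^sup>2) * s \<le> 1 * 1" using q s by (simp, intro mult_mono) auto
    then have "\<bar>- 2 * s - 2 * (\<rho>\<^sup>2 / r\<^sup>2) * s + q / L\<bar> \<le> 6" using s qL unfolding abs_le_iff by linarith
    then have "\<bar>tw1 r\<bar> \<le> 6 / (L * r)" unfolding tw1s abs_divide using L r0 by (simp add: divide_right_mono)
    then have "(tw1 r)\<^sup>2 \<le> (6 / (L * r))\<^sup>2" by (rule square_le_of_abs)
    then have "r * (tw1 r)\<^sup>2 \<le> r * (6 / (L * r))\<^sup>2" using r0 by (intro mult_left_mono) auto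
    also have "\<dots> = 36 / (L\<^sup>2 * r)" using r0 L by (simp add: power2_eq_square field_simps)
    finally have tw12: "r * (tw1 r)\<^sup>2 \<le> 36 / (L\<^sup>2 * r)" .
    have "form r (t1 r) (t r) (t1 r) (t r) (tw1 r) (tw r) (t1 r) (t r) (t1 r) (t r) (tw1 r) (tw r)
       = (t1 r)\<^sup>2 + (t r / r)\<^sup>2 + \<kappa>\<^sup>2 * (t r)\<^sup>2 + (tw1 r)\<^sup>2 + \<kappa>\<^sup>2 * (tw r)\<^sup>2"
      unfolding form_def by (simp add: m power2_eq_square algebra_simps)
    also have "\<dots> \<le> (tw1 r)\<^sup>2 + 30 * (\<kappa>\<^sup>2 * s\<^sup>2)"
      using k9 t12 tr2 zero_le_power2[of "\<kappa> * s"] unfolding power_mult_distrib by linarith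
    finally have "r * form r (t1 r) (t r) (t1 r) (t r) (tw1 r) (tw r) (t1 r) (t r) (t1 r) (t r) (tw1 r) (tw r)
      \<le> r * ((tw1 r)\<^sup>2 + 30 * (\<kappa>\<^sup>2 * s\<^sup>2))" using r0 by (intro mult_left_mono) auto
    also have "\<dots> = r * (tw1 r)\<^sup>2 + 30 * (\<kappa>\<^sup>2 * r * s\<^sup>2)" by (simp add: algebra_simps)
    also have "\<dots> \<le> 36 / (L\<^sup>2 * r) + 30 * S2" using tw12 S2 by (intro add_mono) auto
    also have "\<dots> \<le> 60 / (L\<^sup>2 * r) + 60 * S2"
      using r0 r L by (intro add_mono mult_right_mono divide_right_mono) (auto simp: S2_def)
    finally show "r * form r (t1 r) (t r) (t1 r) (t r) (tw1 r) (tw r) (t1 r) (t r) (t1 r) (t r) (tw1 r) (tw r)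
      \<le> 60 / (L\<^sup>2 * r) + 60 * (\<kappa>\<^sup>2 * (R - r) / L)" by (simp add: S2_def)
  next
    show "t R = 0" "t R = 0" "tw R = 0" using R0 by (auto simp: t_def tw_def l_def)
  qed
  moreover have "tw \<rho> = 1" "t \<rho> = 0" using \<rho>0 L by (auto simp: tw_def t_def l_def L_def[symmetric] power2_eq_square)
  ultimately show ?thesis by (simp add: flux_def)
qed

text \<open>The test field is planar, with stream function \<open>r \<chi> sin \<theta>\<close>, where \<open>\<chi> = l\<^sup>2 (3 - 2 l)\<close> is a smooth step in
  the normalised logarithm \<open>l\<close>.\<close>

lemma traction_energy_transverse_log:
  assumes m: "m = 1" and kp: "1 \<le> \<kappa>" and \<rho>: "\<epsilon> < \<rho>" "\<rho> < 1" and small: "\<kappa> * \<rho> \<le> 1"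
  shows "(\<rho> * (Um1 \<rho> - P \<rho>) / 2)\<^sup>2 \<le> - flux Up Um W \<rho> * (100 * \<kappa> / ln (1 / \<rho>))"
proof -
  define R where "R = \<rho> + 1 / \<kappa>"
  define L where "L = ln (R / \<rho>)"
  have \<rho>0: "0 < \<rho>" using eps \<rho> by simp
  note ll = log_layer[OF \<rho>0 \<rho>(2) kp, folded R_def, folded L_def]
  have L: "L > 0" by (rule ll(1))
  have R0: "0 < R" using ll(2) \<rho>0 by linarith
  \<comment> \<open>Differentiating the step costs additional factors \<open>1 / L\<close>, so
    \<open>L\<close> must be bounded below; \<open>small\<close> gives
    \<open>R \<ge> 2 \<rho>\<close>.\<close>
  have "2 \<le> R / \<rho>" using small kp \<rho>0 by (simp add: R_def field_simps)
  then have "ln 2 \<le> L" unfolding L_def using R0 \<rho>0 by (subst ln_le_cancel_iff) auto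
  then have L2: "1 / L \<le> 2" using ln2_ge_two_thirds L by (simp add: pos_divide_le_eq)
  define l where "l r = ln (R / r) / L" for r
  \<comment> \<open>With \<open>\<chi>\<close> the smooth step, \<open>tp = - r \<chi>' / 2\<close>
    is the part of angular order two and \<open>tm = \<chi> + r \<chi>' / 2\<close> that of order
    zero. As \<open>\<chi>'\<close> vanishes at both ends, \<open>tp\<close> is zero there and
    \<open>tm\<close> equals \<open>\<chi>\<close>.\<close>
  define tp where "tp r = 3 * l r * (1 - l r) / L" for r
  define tm where "tm r = (l r)\<^sup>2 * (3 - 2 * l r) - 3 * l r * (1 - l r) / L" for r
  define tp1 where "tp1 r = - 3 * (1 - 2 * l r) / (r * L\<^sup>2)" for r
  define tm1 where "tm1 r = - 6 * l r * (1 - l r) / (r * L) + 3 * (1 - 2 * l r) / (r * L\<^sup>2)" for r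
  define tz where "tz r = (0::real)" for r :: real
  have dl: "(l has_real_derivative - 1 / (r * L)) (at r)" if "0 < r" for r
    unfolding l_def using that R0 L by (auto intro!: derivative_eq_intros simp: field_simps)
  have "(flux tp tm tz \<rho>)\<^sup>2 \<le> - flux Up Um W \<rho> * (100 * \<kappa> / ln (1 / \<rho>))"
  proof (rule traction_energy_log[OF kp \<rho>, folded R_def, folded L_def])
    fix r assume r: "\<rho> \<le> r" "r \<le> R"
    have r0: "0 < r" using r \<rho>0 by simp
    show "(tp has_real_derivative tp1 r) (at r)"
      unfolding tp_def tp1_def using r0 L
      by (auto intro!: derivative_eq_intros dl[OF r0] simp: field_simps power2_eq_square)
    show "(tm has_real_derivative tm1 r) (at r)"
      unfolding tm_def tm1_def using r0 L
      by (auto intro!: derivative_eq_intros dl[OF r0] simp: field_simps power2_eq_square)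
    show "(tz has_real_derivative tz r) (at r)"
      by (simp add: tz_def[abs_def])
    show "tp1 r + (m+1) * tp r / r + tm1 r - (m-1) * tm r / r + 2 * \<kappa> * tz r = 0"
      using r0 L by (simp add: tp1_def tm1_def tp_def tz_def m field_simps)
    define s where "s = l r"
    have s: "0 \<le> s" "s \<le> 1" using ll(4,5)[OF r] L by (auto simp: s_def l_def)
    define S2 where "S2 = \<kappa>\<^sup>2 * (R - r) / L"
    have S2: "\<kappa>\<^sup>2 * r * s\<^sup>2 \<le> S2" unfolding s_def S2_def l_def by (rule ll(6)[OF r])
    have ss: "0 \<le> s * (1 - s)" "s * (1 - s) \<le> s * 1" "s * (1 - s) \<le> 1 / 4"
      using s zero_le_power2[of "s - 1 / 2"]
      by (auto intro: mult_left_mono mult_left_le simp: power2_eq_square algebra_simps)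
    define d where "d = 1 / (r * L)"
    have d0: "0 \<le> d" using r0 L by (simp add: d_def)
    have "tp1 r = - (3 * (1 - 2 * s) * (1 / L) * d)"
      by (simp add: tp1_def s_def d_def power2_eq_square minus_divide_left mult_ac)
    then have "\<bar>tp1 r\<bar> = 3 * \<bar>1 - 2 * s\<bar> * (1 / L) * d"
      using d0 L by (simp only: abs_minus_cancel abs_mult) simp
    also have "\<dots> \<le> 3 * 1 * 2 * d" using s L2 L d0 by (intro mult_mono) (auto simp: abs_le_iff)
    finally have tp1b: "\<bar>tp1 r\<bar> \<le> 6 * d" by simp
    have "tm1 r = - (6 * (s * (1 - s)) * d) - tp1 r"
      using r0 L by (simp add: tm1_def tp1_def s_def d_def field_simps)
    moreover have "0 \<le> s * (1 - s) * d" "s * (1 - s) * d \<le> 1 / 4 * d"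
      using ss d0 by (simp_all only: mult_nonneg_nonneg mult_right_mono)
    ultimately have tm1b: "\<bar>tm1 r\<bar> \<le> 8 * d" using tp1b by (simp add: abs_le_iff)
    have "tp r / r = 3 * (s * (1 - s)) * d" by (simp add: tp_def s_def d_def mult_ac)
    then have "\<bar>tp r / r\<bar> = 3 * (s * (1 - s)) * d" using ss d0 by (simp only: abs_of_nonneg mult_nonneg_nonneg zero_le_numeral)
    also have "\<dots> \<le> 1 * d" using ss d0 by (intro mult_right_mono) auto
    finally have tpr: "\<bar>tp r / r\<bar> \<le> d" by simp
    have "tp r = 3 * (s * (1 - s)) * (1 / L)" by (simp add: tp_def s_def)
    moreover have "0 \<le> 3 * (s * (1 - s)) * (1 / L)" using ss s L by (intro mult_nonneg_nonneg) auto
    ultimately have "\<bar>tp r\<bar> = 3 * (s * (1 - s)) * (1 / L)" by (simp only: abs_of_nonneg)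
    also have "\<dots> \<le> 3 * s * 2" using ss s L2 L by (intro mult_mono) auto
    finally have tpb: "\<bar>tp r\<bar> \<le> 6 * s" by simp
    have tp0: "0 \<le> tp r" using ss L by (simp add: tp_def s_def)
    have "tm r = s * (s * (3 - 2 * s)) - tp r" by (simp add: tm_def tp_def s_def power2_eq_square)
    moreover have "s * (s * (3 - 2 * s)) \<le> s * (1 * 3)" "0 \<le> s * (s * (3 - 2 * s))"
      using s by (intro mult_left_mono mult_mono mult_nonneg_nonneg; simp)+
    ultimately have tmb: "\<bar>tm r\<bar> \<le> 6 * s" using tpb tp0 s unfolding abs_le_iff by linarith
    have sq: "(tp1 r)\<^sup>2 \<le> 36 * d\<^sup>2" "(tm1 r)\<^sup>2 \<le> 64 * d\<^sup>2" "(tp r / r)\<^sup>2 \<le> d\<^sup>2" "(tp r)\<^sup>2 \<le> 36 * s\<^sup>2" "(tm r)\<^sup>2 \<le> 36 * s\<^sup>2"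
      using square_le_of_abs[OF tp1b] square_le_of_abs[OF tm1b] square_le_of_abs[OF tpr] square_le_of_abs[OF tpb]
        square_le_of_abs[OF tmb] by (auto simp: power_mult_distrib)
    have sqk: "\<kappa>\<^sup>2 * (tp r)\<^sup>2 \<le> \<kappa>\<^sup>2 * (36 * s\<^sup>2)" "\<kappa>\<^sup>2 * (tm r)\<^sup>2 \<le> \<kappa>\<^sup>2 * (36 * s\<^sup>2)" using sq(4,5) by (auto intro: mult_left_mono)
    have "form r (tp1 r) (tp r) (tm1 r) (tm r) (tz r) (tz r) (tp1 r) (tp r) (tm1 r) (tm r) (tz r) (tz r)
       = ((tp1 r)\<^sup>2 + 4 * (tp r / r)\<^sup>2 + \<kappa>\<^sup>2 * (tp r)\<^sup>2) / 2 + ((tm1 r)\<^sup>2 + \<kappa>\<^sup>2 * (tm r)\<^sup>2) / 2"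
      using r0 unfolding form_def by (simp add: m tz_def power2_eq_square field_simps)
    also have "\<dots> \<le> 60 * d\<^sup>2 + 60 * (\<kappa>\<^sup>2 * s\<^sup>2)"
    proof -
      have "((tp1 r)\<^sup>2 + 4 * (tp r / r)\<^sup>2 + \<kappa>\<^sup>2 * (tp r)\<^sup>2) / 2 + ((tm1 r)\<^sup>2 + \<kappa>\<^sup>2 * (tm r)\<^sup>2) / 2
        \<le> (36 * d\<^sup>2 + 4 * d\<^sup>2 + \<kappa>\<^sup>2 * (36 * s\<^sup>2)) / 2 + (64 * d\<^sup>2 + \<kappa>\<^sup>2 * (36 * s\<^sup>2)) / 2"
        using sq sqk by (intro add_mono divide_right_mono) auto
      also have "\<dots> = 52 * d\<^sup>2 + 36 * (\<kappa>\<^sup>2 * s\<^sup>2)" by (simp add: field_simps)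
      also have "\<dots> \<le> 60 * d\<^sup>2 + 60 * (\<kappa>\<^sup>2 * s\<^sup>2)" by (intro add_mono mult_right_mono) auto
      finally show ?thesis .
    qed
    finally have "r * form r (tp1 r) (tp r) (tm1 r) (tm r) (tz r) (tz r) (tp1 r) (tp r) (tm1 r) (tm r) (tz r) (tz r)
      \<le> r * (60 * d\<^sup>2 + 60 * (\<kappa>\<^sup>2 * s\<^sup>2))" using r0 by (intro mult_left_mono) auto
    also have "\<dots> = 60 / (L\<^sup>2 * r) + 60 * (\<kappa>\<^sup>2 * r * s\<^sup>2)" using r0 L by (simp add: d_def power2_eq_square field_simps)
    also have "\<dots> \<le> 60 / (L\<^sup>2 * r) + 60 * S2" using S2 by simp
    finally show "r * form r (tp1 r) (tp r) (tm1 r) (tm r) (tz r) (tz r) (tp1 r) (tp r) (tm1 r) (tm r) (tz r) (tz r)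
      \<le> 60 / (L\<^sup>2 * r) + 60 * (\<kappa>\<^sup>2 * (R - r) / L)" by (simp add: S2_def)
  next
    show "tp R = 0" "tm R = 0" "tz R = 0" using R0 by (auto simp: tp_def tm_def tz_def l_def)
  qed
  moreover have "l \<rho> = 1" using L by (simp add: l_def L_def)
  then have "tm \<rho> = 1" "tp \<rho> = 0" "tz \<rho> = 0" by (auto simp: tm_def tp_def tz_def)
  ultimately show ?thesis by (simp add: flux_def)
qed

text \<open>When \<open>\<kappa> \<rho>\<close> is large the planar field of the previous lemma has too much energy in a layer of width
  \<open>1 / \<kappa>\<close>. Here the axial component balances the divergence instead.\<close>

lemma traction_energy_transverse_layer:
  assumes m: "m = 1" and kp: "1 \<le> \<kappa>" and \<rho>: "\<epsilon> < \<rho>" "\<rho> < 1" and large: "1 \<le> \<kappa> * \<rho>"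
  shows "(\<rho> * (Um1 \<rho> - P \<rho>) / 2)\<^sup>2 \<le> - flux Up Um W \<rho> * (100 * \<kappa> / ln (1 / \<rho>))"
proof -
  define R where "R = \<rho> + 1 / \<kappa>"
  have \<rho>0: "0 < \<rho>" using eps \<rho> by simp
  have R: "\<rho> \<le> R" using kp by (simp add: R_def)
  have R2: "R \<le> 2 * \<rho>" using large kp by (simp add: R_def pos_divide_le_eq mult.commute)
  \<comment> \<open>The layer is now no wider than \<open>\<rho>\<close>, so the curvature of the
    circle is harmless and a cutoff linear in the distance replaces the logarithmic one.\<close>
  define l where "l r = \<kappa> * (R - r)" for r
  define tm where "tm r = (l r)\<^sup>2 * (3 - 2 * l r)" for r
  define tm1 where "tm1 r = - \<kappa> * (6 * (l r * (1 - l r)))" for r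
  \<comment> \<open>Forced by the divergence condition \<open>tm1 + 2 * \<kappa> * tw = 0\<close>.
    It vanishes at both ends because the step \<open>tm\<close> has zero slope there.\<close>
  define tw where "tw r = 3 * (l r * (1 - l r))" for r
  define tw1 where "tw1 r = - \<kappa> * (3 * (1 - 2 * l r))" for r
  define tz where "tz r = (0::real)" for r :: real
  have dl: "(l has_real_derivative - \<kappa>) (at r)" for r
    unfolding l_def by (auto intro!: derivative_eq_intros)
  have "(flux tz tm tw \<rho>)\<^sup>2 \<le> - flux Up Um W \<rho> * (100 * \<kappa> / ln (1 / \<rho>))"
  proof (rule flux_test_bound[where \<Psi>="\<lambda>r. 20 * \<kappa>\<^sup>2 * R * r" and \<psi>="\<lambda>r. 20 * \<kappa>\<^sup>2 * R", OF _ \<rho>(1) R])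
    fix r assume r: "\<rho> \<le> r" "r \<le> R"
    have r0: "0 < r" using r \<rho>0 by simp
    show "(tm has_real_derivative tm1 r) (at r)"
      unfolding tm_def tm1_def
      by (auto intro!: derivative_eq_intros dl simp: field_simps power2_eq_square)
    show "(tw has_real_derivative tw1 r) (at r)"
      unfolding tw_def tw1_def
      by (auto intro!: derivative_eq_intros dl simp: field_simps power2_eq_square)
    show "(tz has_real_derivative tz r) (at r)"
      by (simp add: tz_def[abs_def])
    show "((\<lambda>r. 20 * \<kappa>\<^sup>2 * R * r) has_real_derivative 20 * \<kappa>\<^sup>2 * R) (at r)"
      by (auto intro!: derivative_eq_intros)
    show "tz r + (m+1) * tz r / r + tm1 r - (m-1) * tm r / r + 2 * \<kappa> * tw r = 0"
      by (simp add: tm1_def tw_def tz_def m)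
    define s where "s = l r"
    have "\<kappa> * (R - r) \<le> \<kappa> * (1 / \<kappa>)" using r kp unfolding R_def by (intro mult_left_mono) auto
    then have s: "0 \<le> s" "s \<le> 1" using r kp by (auto simp: s_def l_def)
    have ss: "0 \<le> s * (1 - s)" "s * (1 - s) \<le> 1 / 4"
      using s zero_le_power2[of "s - 1 / 2"]
      by (auto intro: mult_left_mono mult_left_le simp: power2_eq_square algebra_simps)
    have "\<bar>tm1 r\<bar> = \<kappa> * (6 * (s * (1 - s)))" using kp ss by (simp only: tm1_def s_def abs_mult abs_minus_cancel) (simp add: abs_of_nonneg flip: abs_mult)
    also have "\<dots> \<le> \<kappa> * (6 * (1 / 4))" using kp ss by (intro mult_left_mono) auto
    finally have tm1b: "\<bar>tm1 r\<bar> \<le> 2 * \<kappa>" using kp by simp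
    have "\<bar>tw1 r\<bar> = \<kappa> * (3 * \<bar>1 - 2 * s\<bar>)" using kp by (simp only: tw1_def s_def abs_mult abs_minus_cancel abs_of_nonneg abs_numeral)
    also have "\<dots> \<le> \<kappa> * (3 * 1)" using kp s by (intro mult_left_mono) (auto simp: abs_le_iff)
    finally have tw1b: "\<bar>tw1 r\<bar> \<le> 3 * \<kappa>" by simp
    have twb: "\<bar>tw r\<bar> \<le> 1" using ss by (simp add: tw_def s_def)
    have "s * (s * (3 - 2 * s)) \<le> 1 * (1 * 3)" "0 \<le> s * (s * (3 - 2 * s))"
      using s by (intro mult_mono mult_nonneg_nonneg; simp)+
    then have tmb: "\<bar>tm r\<bar> \<le> 3" by (simp add: tm_def s_def power2_eq_square)
    have sq: "(tm1 r)\<^sup>2 \<le> 4 * \<kappa>\<^sup>2" "(tw1 r)\<^sup>2 \<le> 9 * \<kappa>\<^sup>2" "(tw r)\<^sup>2 \<le> 1" "(tm r)\<^sup>2 \<le> 9"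
      using square_le_of_abs[OF tm1b] square_le_of_abs[OF tw1b] square_le_of_abs[OF twb] square_le_of_abs[OF tmb]
       by (auto simp: power_mult_distrib)
    have "1 / r \<le> 1 / \<rho>" using r \<rho>0 by (intro divide_left_mono) auto
    also have "\<dots> \<le> \<kappa>" using large \<rho>0 by (simp add: pos_divide_le_eq)
    finally have "(1 / r)\<^sup>2 \<le> \<kappa>\<^sup>2" using r0 by (intro power_mono) auto
    then have "1 / r\<^sup>2 + \<kappa>\<^sup>2 \<le> 2 * \<kappa>\<^sup>2" by (simp add: power_divide)
    then have a: "(1 / r\<^sup>2 + \<kappa>\<^sup>2) * (tw r)\<^sup>2 \<le> 2 * \<kappa>\<^sup>2 * 1" using sq(3) by (intro mult_mono) auto
    have b: "\<kappa>\<^sup>2 * (tm r)\<^sup>2 \<le> \<kappa>\<^sup>2 * 9" using sq(4) by (intro mult_left_mono) auto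
    have "form r (tz r) (tz r) (tm1 r) (tm r) (tw1 r) (tw r) (tz r) (tz r) (tm1 r) (tm r) (tw1 r) (tw r)
       = ((tm1 r)\<^sup>2 + \<kappa>\<^sup>2 * (tm r)\<^sup>2) / 2 + (tw1 r)\<^sup>2 + (1 / r\<^sup>2 + \<kappa>\<^sup>2) * (tw r)\<^sup>2"
      unfolding form_def by (simp add: m tz_def power2_eq_square algebra_simps)
    also have "\<dots> \<le> 20 * \<kappa>\<^sup>2"
    proof -
      have "((tm1 r)\<^sup>2 + \<kappa>\<^sup>2 * (tm r)\<^sup>2) / 2 + (tw1 r)\<^sup>2 + (1 / r\<^sup>2 + \<kappa>\<^sup>2) * (tw r)\<^sup>2
        \<le> (4 * \<kappa>\<^sup>2 + \<kappa>\<^sup>2 * 9) / 2 + 9 * \<kappa>\<^sup>2 + 2 * \<kappa>\<^sup>2 * 1"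
        using a b sq by (intro add_mono divide_right_mono) auto
      also have "\<dots> \<le> 20 * \<kappa>\<^sup>2" by (simp add: field_simps)
      finally show ?thesis .
    qed
    finally have "r * form r (tz r) (tz r) (tm1 r) (tm r) (tw1 r) (tw r) (tz r) (tz r) (tm1 r) (tm r) (tw1 r) (tw r)
      \<le> r * (20 * \<kappa>\<^sup>2)" using r0 by (intro mult_left_mono) auto
    also have "\<dots> \<le> R * (20 * \<kappa>\<^sup>2)" using r by (intro mult_right_mono) auto
    finally show "r * form r (tz r) (tz r) (tm1 r) (tm r) (tw1 r) (tw r) (tz r) (tz r) (tm1 r) (tm r) (tw1 r) (tw r)
      \<le> 20 * \<kappa>\<^sup>2 * R" by (simp add: mult.commute mult.left_commute)
  next
    show "0 < \<kappa>" using kp by simp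
    show "tz R = 0" "tm R = 0" "tw R = 0" by (auto simp: tm_def tw_def tz_def l_def)
    have lp: "0 < ln (1 / \<rho>)" using \<rho> \<rho>0 by simp
    \<comment> \<open>The energy found is \<open>20 \<kappa> R \<le> 40 \<kappa> \<rho>\<close>. It
      fits the logarithmic bound because \<open>\<rho> \<le> 1 / ln (1 / \<rho>)\<close>.\<close>
    have "ln (1 / \<rho>) \<le> 1 / \<rho> - 1" using \<rho>0 by (intro ln_le_minus_one) simp
    then have "\<rho> * ln (1 / \<rho>) \<le> \<rho> * (1 / \<rho>)" using \<rho>0 by (intro mult_left_mono) auto
    then have r1: "\<rho> \<le> 1 / ln (1 / \<rho>)" using lp \<rho>0 by (simp add: pos_le_divide_eq)
    have "20 * \<kappa>\<^sup>2 * R * R - 20 * \<kappa>\<^sup>2 * R * \<rho> = 20 * \<kappa> * R"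
      using kp by (simp add: R_def power2_eq_square field_simps)
    also have "\<dots> \<le> 20 * \<kappa> * (2 * (1 / ln (1 / \<rho>)))" using R2 r1 kp by (intro mult_left_mono) auto
    also have "\<dots> \<le> 100 * \<kappa> / ln (1 / \<rho>)" using kp lp by (simp add: divide_right_mono)
    finally show "20 * \<kappa>\<^sup>2 * R * R - 20 * \<kappa>\<^sup>2 * R * \<rho> \<le> 100 * \<kappa> / ln (1 / \<rho>)" .
  qed
  moreover have "l \<rho> = 1" using kp by (simp add: l_def R_def)
  then have "tm \<rho> = 1" "tw \<rho> = 0" "tz \<rho> = 0" by (auto simp: tm_def tw_def tz_def)
  ultimately show ?thesis by (simp add: flux_def)
qed

text \<open>The value of \<open>flux\<close> on a test field whose boundary value is 1 in the
  component of angular order zero that carries the total force (\<open>W\<close> for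
  \<open>m = 0\<close>, \<open>Um\<close> for \<open>m = 1\<close>) and 0 in the other two; hence
  the factor 1/2 in the second case.\<close>

definition traction where
  "traction r = (if m = 0 then r * W1 r else r * (Um1 r - P r) / 2)"

section \<open>From the energies of the test fields to a bound by the datum\<close>

lemma traction_energy:
  assumes "1 \<le> \<kappa>" "\<epsilon> < \<rho>" "\<rho> < 1"
  shows "(traction \<rho>)\<^sup>2 \<le> - flux Up Um W \<rho> * (100 * \<kappa> / ln (1 / \<rho>))"
  using m01 traction_energy_axial[OF _ assms] traction_energy_transverse_log[OF _ assms]
    traction_energy_transverse_layer[OF _ assms] linear[of "\<kappa> * \<rho>" 1]
  by (auto simp: traction_def)

text \<open>At \<open>\<epsilon>\<close> only one component of the trace survives, so the flux of
  the flow tends to \<open>\<tau> * v\<close>. In the limit \<open>traction_energy\<close> reads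
  \<open>\<tau>\<^sup>2 \<le> - (\<tau> * v) * e\<close>, and one factor
  \<open>\<bar>\<tau>\<bar>\<close> cancels.\<close>

lemma traction_estimate:
  assumes kp: "1 \<le> \<kappa>" and e1: "\<epsilon> < 1"
    and Up: "(Up \<longlongrightarrow> 0) (at_right \<epsilon>)"
    and Um: "(Um \<longlongrightarrow> (if m = 0 then 0 else v)) (at_right \<epsilon>)"
    and W: "(W \<longlongrightarrow> (if m = 0 then v else 0)) (at_right \<epsilon>)"
  obtains \<tau> where "(traction \<longlongrightarrow> \<tau>) (at_right \<epsilon>)" "\<bar>\<tau>\<bar> \<le> 100 * \<kappa> / ln (1 / \<epsilon>) * \<bar>v\<bar>"
    "\<And>\<rho>. \<epsilon> < \<rho> \<Longrightarrow> \<rho> < 1 \<Longrightarrow> \<bar>traction \<rho>\<bar> \<le> 100 * \<kappa> / ln (1 / \<rho>) * \<bar>v\<bar>"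
proof -
  define e where "e \<rho> = 100 * \<kappa> / ln (1 / \<rho>)" for \<rho>
  have e0: "0 < e \<rho>" if "\<epsilon> \<le> \<rho>" "\<rho> < 1" for \<rho> using that kp eps by (simp add: e_def)
  obtain up up1 um um1 w w1 p where l:
    "(Up \<longlongrightarrow> up) (at_right \<epsilon>)" "(Up1 \<longlongrightarrow> up1) (at_right \<epsilon>)"
    "(Um \<longlongrightarrow> um) (at_right \<epsilon>)" "(Um1 \<longlongrightarrow> um1) (at_right \<epsilon>)"
    "(W \<longlongrightarrow> w) (at_right \<epsilon>)" "(W1 \<longlongrightarrow> w1) (at_right \<epsilon>)" "(P \<longlongrightarrow> p) (at_right \<epsilon>)"
    by (rule state_limits)
  have u: "up = 0" "um = (if m = 0 then 0 else v)" "w = (if m = 0 then v else 0)"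
    using tendsto_unique[OF _ l(1) Up] tendsto_unique[OF _ l(3) Um] tendsto_unique[OF _ l(5) W] by auto
  define \<tau> where "\<tau> = (if m = 0 then \<epsilon> * w1 else \<epsilon> * (um1 - p) / 2)"
  have T: "(traction \<longlongrightarrow> \<tau>) (at_right \<epsilon>)"
    unfolding traction_def[abs_def] \<tau>_def by (auto intro!: tendsto_intros l)
  have "(flux Up Um W \<longlongrightarrow> \<epsilon> * ((up1 - p) * up / 2 + (um1 - p) * um / 2 + w1 * w)) (at_right \<epsilon>)"
    unfolding flux_def[abs_def] by (intro tendsto_intros l) auto
  then have F: "(flux Up Um W \<longlongrightarrow> \<tau> * v) (at_right \<epsilon>)" using m01 by (auto simp: u \<tau>_def mult_ac)
  \<comment> \<open>By monotonicity the flux on any larger circle is controlled by its boundary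
    value; this is how the datum \<open>v\<close> enters a bound at radius \<open>\<rho>\<close>,
    where the velocity is unknown.\<close>
  have Fge: "- flux Up Um W \<rho> \<le> - (\<tau> * v)" if "\<epsilon> < \<rho>" for \<rho>
  proof -
    have "\<forall>\<^sub>F s in at_right \<epsilon>. flux Up Um W s \<le> flux Up Um W \<rho>"
      using that unfolding eventually_at_right_field by (intro exI[of _ \<rho>]) (auto intro: flux_self_mono)
    then show ?thesis using tendsto_upperbound[OF F] by simp
  qed
  have "((\<lambda>\<rho>. e \<rho>) \<longlongrightarrow> e \<epsilon>) (at_right \<epsilon>)"
    unfolding e_def using eps e1 by (intro tendsto_intros) auto
  then have "((\<lambda>\<rho>. - flux Up Um W \<rho> * e \<rho>) \<longlongrightarrow> - (\<tau> * v) * e \<epsilon>) (at_right \<epsilon>)"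
    by (intro tendsto_intros F)
  moreover have "((\<lambda>\<rho>. (traction \<rho>)\<^sup>2) \<longlongrightarrow> \<tau>\<^sup>2) (at_right \<epsilon>)" by (intro tendsto_intros T)
  moreover have "\<forall>\<^sub>F \<rho> in at_right \<epsilon>. (traction \<rho>)\<^sup>2 \<le> - flux Up Um W \<rho> * e \<rho>"
    unfolding eventually_at_right_field e_def using traction_energy[OF kp] e1 by blast
  ultimately have "\<tau>\<^sup>2 \<le> - (\<tau> * v) * e \<epsilon>" by (intro tendsto_le) auto
  also have "\<dots> \<le> \<bar>\<tau>\<bar> * (e \<epsilon> * \<bar>v\<bar>)"
  proof -
    have "- (\<tau> * v) * e \<epsilon> \<le> \<bar>\<tau> * v\<bar> * e \<epsilon>" using e0[of \<epsilon>] e1 by (intro mult_right_mono) auto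
    then show ?thesis by (simp add: abs_mult mult_ac)
  qed
  finally have t: "\<bar>\<tau>\<bar> * \<bar>\<tau>\<bar> \<le> \<bar>\<tau>\<bar> * (e \<epsilon> * \<bar>v\<bar>)" by (simp add: power2_eq_square)
  have tb: "\<bar>\<tau>\<bar> \<le> e \<epsilon> * \<bar>v\<bar>"
  proof (cases "\<tau> = 0")
    case True then show ?thesis using e0[of \<epsilon>] e1 by simp
  next
    case False then show ?thesis using t by (intro mult_left_le_imp_le[OF t]) auto
  qed
  show ?thesis
  proof (rule that[OF T])
    show "\<bar>\<tau>\<bar> \<le> 100 * \<kappa> / ln (1 / \<epsilon>) * \<bar>v\<bar>" using tb by (simp add: e_def)
    show "\<bar>traction \<rho>\<bar> \<le> 100 * \<kappa> / ln (1 / \<rho>) * \<bar>v\<bar>" if r: "\<epsilon> < \<rho>" "\<rho> < 1" for \<rho>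
    proof -
      have r0: "0 < e \<rho>" using e0[of \<rho>] r by simp
      have "ln (1 / \<rho>) \<le> ln (1 / \<epsilon>)" using r eps by (intro ln_mono divide_left_mono) auto
      then have ee: "e \<epsilon> \<le> e \<rho>" unfolding e_def using r eps kp by (intro divide_left_mono) auto
      have "(traction \<rho>)\<^sup>2 \<le> - flux Up Um W \<rho> * e \<rho>" using traction_energy[OF kp r] by (simp add: e_def)
      also have "\<dots> \<le> - (\<tau> * v) * e \<rho>" using Fge[OF r(1)] r0 by (intro mult_right_mono) auto
      also have "\<dots> \<le> (\<bar>\<tau>\<bar> * \<bar>v\<bar>) * e \<rho>" using r0 by (intro mult_right_mono) (auto simp: abs_mult[symmetric] abs_ge_minus_self)
      also have "\<dots> \<le> ((e \<rho> * \<bar>v\<bar>) * \<bar>v\<bar>) * e \<rho>"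
      proof (intro mult_right_mono)
        show "\<bar>\<tau>\<bar> \<le> e \<rho> * \<bar>v\<bar>" by (rule order_trans[OF tb]) (intro mult_right_mono ee, simp)
      qed (use r0 in auto)
      also have "\<dots> = (e \<rho> * \<bar>v\<bar>)\<^sup>2" by (simp add: power2_eq_square)
      finally show ?thesis using r0 by (simp add: e_def[symmetric] abs_le_square_iff[symmetric] abs_mult)
    qed
  qed
qed

text \<open>Without a positive \<open>\<kappa>\<close> the energy does not control the field. The equations are integrated
  explicitly, and a nonzero traction would produce logarithmic growth (the Stokes paradox).\<close>

lemma traction_zero_mode:
  assumes k: "\<kappa> = 0" and \<rho>: "\<epsilon> < \<rho>"
  shows "traction \<rho> = 0"
proof -
  have c: "\<exists>c. \<forall>r>\<epsilon>. f r = c" if "\<And>r. \<epsilon> < r \<Longrightarrow> (f has_real_derivative 0) (at r)" for f :: "real \<Rightarrow> real"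
    using has_field_derivative_zero_constant[of "{\<epsilon><..}" f] that
    by (auto intro: has_field_derivative_at_within)
  from m01 show ?thesis
  proof
    assume m: "m = 0"
    have "((\<lambda>r. r * W1 r) has_real_derivative 0) (at r)" if r: "\<epsilon> < r" for r
    proof -
      have "r * (W2 r + W1 r / r) = 0" using eqw[OF r] k m by simp
      then show ?thesis using r eps by (auto intro!: derivative_eq_intros dW1[OF r] simp: algebra_simps)
    qed
    then obtain a where a: "\<And>r. \<epsilon> < r \<Longrightarrow> r * W1 r = a" using c by blast
    have "((\<lambda>r. W r - a * ln r) has_real_derivative 0) (at r)" if r: "\<epsilon> < r" for r
      using a[OF r] r eps by (auto intro!: derivative_eq_intros dW[OF r] simp: field_simps)
    then obtain b where b: "\<And>r. \<epsilon> < r \<Longrightarrow> W r - a * ln r = b" using c by blast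
    \<comment> \<open>Comparing the radii \<open>2 * r\<close> and \<open>r\<close> removes the
      constant of integration and leaves \<open>a * ln 2\<close>, which must equal the limit
      0.\<close>
    have "((\<lambda>r. W (2 * r) - W r) \<longlongrightarrow> 0 - 0) at_top"
      by (intro tendsto_diff W_inf filterlim_compose[OF W_inf] filterlim_tendsto_pos_mult_at_top[OF tendsto_const] filterlim_ident) auto
    moreover have "\<forall>\<^sub>F r in at_top. W (2 * r) - W r = a * ln 2"
    proof (rule eventually_mono[OF eventually_gt_at_top[of \<epsilon>]])
      fix r assume r: "\<epsilon> < r"
      then show "W (2 * r) - W r = a * ln 2" using b[of "2 * r"] b[of r] eps
        by (simp add: ln_mult algebra_simps)
    qed
    ultimately have "((\<lambda>r::real. a * ln 2) \<longlongrightarrow> 0) at_top" by (simp add: tendsto_cong)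
    then have "a = 0" by (simp add: tendsto_const_iff)
    then show ?thesis using a[OF \<rho>] m unfolding traction_def by simp
  next
    assume m: "m = 1"
    have "((\<lambda>r. r * (Um1 r - P r)) has_real_derivative 0) (at r)" if r: "\<epsilon> < r" for r
    proof -
      have "r * (Um2 r + Um1 r / r) = r * (P1 r + P r / r)" using eqm[OF r] k m by simp
      then show ?thesis using r eps by (auto intro!: derivative_eq_intros dUm1[OF r] dP[OF r] simp: algebra_simps)
    qed
    then obtain a where a: "\<And>r. \<epsilon> < r \<Longrightarrow> r * (Um1 r - P r) = a" using c by blast
    \<comment> \<open>A second first integral, \<open>P r + Um1 r = b * r\<close>. It combines the
      momentum equation of the order-two component with the divergence condition and its derivative;
      together with the previous one it determines \<open>Um1\<close>.\<close>
    have "((\<lambda>r. (P r + Um1 r) / r) has_real_derivative 0) (at r)" if r: "\<epsilon> < r" for r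
    proof -
      have r0: "0 < r" using r eps by simp
      have "Um2 r + Up1 r / r + 2 * Up r / r\<^sup>2 = - P1 r + P r / r"
      proof -
        have "Um2 r + Up2 r + 2 * (Up1 r / r) = 2 * (Up r / r\<^sup>2)" using div1[OF r] k m by (simp add: algebra_simps)
        moreover have "Up2 r + P r / r + Up1 r / r = P1 r + 4 * (Up r / r\<^sup>2)" using eqp[OF r] k m by simp
        ultimately show ?thesis by simp
      qed
      moreover have "(Up1 r + 2 * Up r / r + Um1 r) / r = 0" using div0[OF r] k m by simp
      then have "Up1 r / r + 2 * Up r / r\<^sup>2 = - (Um1 r / r)"
        by (simp add: add_divide_distrib power2_eq_square)
      ultimately have "r * (P1 r + Um2 r) = r * ((P r + Um1 r) / r)" by (simp add: add_divide_distrib)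
      then have "r * (P1 r + Um2 r) = P r + Um1 r" using r0 by simp
      then show ?thesis using r0 by (auto intro!: derivative_eq_intros dUm1[OF r] dP[OF r] simp: algebra_simps)
    qed
    then obtain b where "\<And>r. \<epsilon> < r \<Longrightarrow> (P r + Um1 r) / r = b" using c by blast
    then have b: "P r + Um1 r = b * r" if "\<epsilon> < r" for r
      using that eps by (auto simp: divide_eq_eq)
    have "((\<lambda>r. Um r - b * r\<^sup>2 / 4 - a / 2 * ln r) has_real_derivative 0) (at r)" if r: "\<epsilon> < r" for r
    proof -
      have "2 * Um1 r * r = (P r + Um1 r) * r + r * (Um1 r - P r)" by (simp add: algebra_simps)
      then have "2 * Um1 r * r = b * r * r + a" unfolding a[OF r] b[OF r] .
      then show ?thesis using r eps by (auto intro!: derivative_eq_intros dUm[OF r] simp: field_simps)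
    qed
    then obtain d where d: "\<And>r. \<epsilon> < r \<Longrightarrow> Um r - b * r\<^sup>2 / 4 - a / 2 * ln r = d" using c by blast
    have U2: "((\<lambda>r. Um (2 * r)) \<longlongrightarrow> 0) at_top" "((\<lambda>r. Um (4 * r)) \<longlongrightarrow> 0) at_top"
      by (intro filterlim_compose[OF Um_inf] filterlim_tendsto_pos_mult_at_top[OF tendsto_const] filterlim_ident; simp)+
    \<comment> \<open>Along \<open>r\<close>, \<open>2 * r\<close>, \<open>4 * r\<close> this second
      difference kills both the constant and the logarithm, so it isolates the quadratic term. Once
      \<open>b = 0\<close>, a first difference isolates the logarithm.\<close>
    have "((\<lambda>r. Um (4 * r) - 2 * Um (2 * r) + Um r) \<longlongrightarrow> 0 - 2 * 0 + 0) at_top"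
      by (intro tendsto_intros U2 Um_inf)
    moreover have e1: "\<forall>\<^sub>F r in at_top. Um (4 * r) - 2 * Um (2 * r) + Um r = b * (9 / 4) * r\<^sup>2"
    proof (rule eventually_mono[OF eventually_gt_at_top[of \<epsilon>]])
      fix r assume r: "\<epsilon> < r"
      have "ln 4 = 2 * ln (2::real)" using ln_realpow[of 2 2] by simp
      then show "Um (4 * r) - 2 * Um (2 * r) + Um r = b * (9 / 4) * r\<^sup>2" using d[of "2 * r"] d[of r] d[of "4 * r"] eps r
        by (simp add: ln_mult power_mult_distrib algebra_simps)
    qed
    ultimately have "((\<lambda>r. b * (9 / 4) * r\<^sup>2) \<longlongrightarrow> 0) at_top" by (simp add: tendsto_cong)
    then have t1: "((\<lambda>r. b * (9 / 4) * r\<^sup>2 * inverse (r\<^sup>2)) \<longlongrightarrow> 0 * 0) at_top"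
      by (intro tendsto_mult tendsto_inverse_0_at_top filterlim_pow_at_top filterlim_ident) auto
    have t2: "\<forall>\<^sub>F r::real in at_top. b * (9 / 4) * r\<^sup>2 * inverse (r\<^sup>2) = b * (9 / 4)"
      by (rule eventually_mono[OF eventually_gt_at_top[of 0]]) auto
    have "((\<lambda>r::real. b * (9 / 4)) \<longlongrightarrow> 0 * 0) at_top" by (rule Lim_transform_eventually[OF t1 t2])
    then have b0: "b = 0" by (simp add: tendsto_const_iff)
    have "((\<lambda>r. Um (2 * r) - Um r) \<longlongrightarrow> 0 - 0) at_top" by (intro tendsto_intros U2 Um_inf)
    moreover have "\<forall>\<^sub>F r in at_top. Um (2 * r) - Um r = a / 2 * ln 2"
    proof (rule eventually_mono[OF eventually_gt_at_top[of \<epsilon>]])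
      fix r assume r: "\<epsilon> < r"
      then show "Um (2 * r) - Um r = a / 2 * ln 2" using d[of "2 * r"] d[of r] eps b0
        by (simp add: ln_mult algebra_simps)
    qed
    ultimately have "((\<lambda>r::real. a / 2 * ln 2) \<longlongrightarrow> 0) at_top" by (simp add: tendsto_cong)
    then have "a = 0" by (simp add: tendsto_const_iff)
    then show ?thesis using a[OF \<rho>] m unfolding traction_def by simp
  qed
qed

end

section \<open>Integrals over cylinders\<close>

lemma cyl_eq: "cyl r \<theta> z = (r * cos \<theta>) *\<^sub>R axis 1 1 + (r * sin \<theta>) *\<^sub>R axis 2 1 + z *\<^sub>R axis 3 1"
  by (simp add: cyl_def vec_eq_iff forall_3 vector_3 axis_def)

lemma cyl_nth [simp]: "cyl r \<theta> z $ 1 = r * cos \<theta>" "cyl r \<theta> z $ 2 = r * sin \<theta>" "cyl r \<theta> z $ 3 = z"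
  by (simp_all add: cyl_def vector_3)

lemma cyl_radius_cyl [simp]: "cyl_radius (cyl r \<theta> z) = \<bar>r\<bar>"
proof -
  have "(r * cos \<theta>)\<^sup>2 + (r * sin \<theta>)\<^sup>2 = r\<^sup>2 * ((sin \<theta>)\<^sup>2 + (cos \<theta>)\<^sup>2)"
    by (simp only: power_mult_distrib) (simp only: algebra_simps)
  then show ?thesis by (simp add: cyl_radius_def)
qed

lemma cyl_in_exterior: "0 < \<epsilon> \<Longrightarrow> \<epsilon> < r \<Longrightarrow> cyl r \<theta> z \<in> exterior_domain \<epsilon>"
  by (simp add: exterior_domain_def)

lemma continuous_on_cyl [continuous_intros]:
  fixes A :: "'a::t2_space set"
  assumes "continuous_on A f" "continuous_on A g" "continuous_on A h"
  shows "continuous_on A (\<lambda>x. cyl (f x) (g x) (h x))"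
  unfolding cyl_eq by (intro continuous_intros assms)

lemma open_exterior_domain: "open (exterior_domain \<epsilon>)"
  unfolding exterior_domain_def cyl_radius_def
  by (intro open_Collect_less continuous_intros)

lemma cyl_shift: "cyl r \<theta> (z + 2) = cyl r \<theta> z + axis 3 2"
  by (simp add: vec_eq_iff forall_3 axis_def)

lemma cyl_rotate: "cyl r (\<theta> + 2 * pi) z = cyl r \<theta> z"
  by (simp add: vec_eq_iff forall_3)

text \<open>Second partial derivatives are derivatives of \<open>partial_deriv i f\<close>, a
  function that is identified only on \<open>S\<close>. On an open set that suffices: both functions
  have the same derivatives there, so the choice inside \<open>frechet_derivative\<close> gives the
  same map.\<close>

lemma C1_on_cong:
  fixes f g :: "real^3 \<Rightarrow> 'b::real_normed_vector"
  assumes S: "open S" and eq: "\<And>x. x \<in> S \<Longrightarrow> f x = g x"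
  shows "\<And>x i. x \<in> S \<Longrightarrow> partial_deriv i f x = partial_deriv i g x" and "C1_on S f \<longleftrightarrow> C1_on S g"
proof -
  have ev: "\<forall>\<^sub>F y in at x. f y = g y" if "x \<in> S" for x
    using eventually_at_topological S eq that by blast
  have d: "(f has_derivative D) (at x) \<longleftrightarrow> (g has_derivative D) (at x)" if "x \<in> S" for x D
    using has_derivative_transform_within_open[OF _ S that] eq by metis
  show p: "partial_deriv i f x = partial_deriv i g x" if "x \<in> S" for x i
    using d[OF that] unfolding partial_deriv_def frechet_derivative_def by simp
  show "C1_on S f \<longleftrightarrow> C1_on S g"
    unfolding C1_on_def using d by (simp add: differentiable_def p cong: continuous_on_cong)
qed

lemma C1_on_component:
  fixes u :: "real^3 \<Rightarrow> real^3"
  assumes "C1_on S u"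
  shows "\<And>x i. x \<in> S \<Longrightarrow> partial_deriv i (\<lambda>x. u x $ j) x = partial_deriv i u x $ j" and "C1_on S (\<lambda>x. u x $ j)"
proof -
  have d: "((\<lambda>x. u x $ j) has_derivative (\<lambda>h. frechet_derivative u (at x) h $ j)) (at x)" if "x \<in> S" for x
    using assms that unfolding C1_on_def
    by (intro bounded_linear.has_derivative[OF bounded_linear_vec_nth]) (auto simp: frechet_derivative_works[symmetric])
  show p: "partial_deriv i (\<lambda>x. u x $ j) x = partial_deriv i u x $ j" if "x \<in> S" for x i
    using frechet_derivative_at[OF d[OF that], symmetric] by (simp add: partial_deriv_def)
  show "C1_on S (\<lambda>x. u x $ j)"
    using assms d unfolding C1_on_def
    by (auto simp: differentiable_def p cong: continuous_on_cong intro!: continuous_intros)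
qed

lemma C2_on_component:
  fixes u :: "real^3 \<Rightarrow> real^3"
  assumes u: "C2_on S u" and S: "open S"
  shows "\<And>x i k. x \<in> S \<Longrightarrow> partial_deriv i (partial_deriv k (\<lambda>x. u x $ j)) x = partial_deriv i (partial_deriv k u) x $ j"
    and "C2_on S (\<lambda>x. u x $ j)"
proof -
  have 1: "C1_on S u" "\<And>k. C1_on S (partial_deriv k u)" using u by (auto simp: C2_on_def)
  note e = C1_on_component(1)[OF 1(1)]
  show "partial_deriv i (partial_deriv k (\<lambda>x. u x $ j)) x = partial_deriv i (partial_deriv k u) x $ j"
    if "x \<in> S" for x i k
    using C1_on_cong(1)[OF S e that] C1_on_component(1)[OF 1(2) that] by simp
  show "C2_on S (\<lambda>x. u x $ j)"
    unfolding C2_on_def using C1_on_component(2)[OF 1(1)] C1_on_cong(2)[OF S e] C1_on_component(2)[OF 1(2)] by simp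
qed

lemma C1_on_imp_continuous_on: "C1_on S g \<Longrightarrow> continuous_on S g"
  unfolding C1_on_def
  by (intro differentiable_imp_continuous_on) (auto simp: differentiable_on_def intro: differentiable_at_withinI)

lemma partial_deriv_shift:
  fixes g :: "real^3 \<Rightarrow> 'b::real_normed_vector"
  assumes S: "open S" and v: "\<And>x. x \<in> S \<Longrightarrow> x + v \<in> S" and per: "\<And>x. x \<in> S \<Longrightarrow> g (x + v) = g x"
    and d: "\<And>x. x \<in> S \<Longrightarrow> g differentiable (at x)" and x: "x \<in> S"
  shows "partial_deriv i g (x + v) = partial_deriv i g x"
proof -
  have "(g has_derivative frechet_derivative g (at (x + v))) (at (x + v))"
    using d v x frechet_derivative_works by blast
  then have "((\<lambda>y. g (y + v)) has_derivative (\<lambda>h. frechet_derivative g (at (x + v)) h)) (at x)"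
    by (rule has_derivative_compose[rotated]) (auto intro!: derivative_eq_intros)
  then have "(g has_derivative frechet_derivative g (at (x + v))) (at x)"
    by (rule has_derivative_transform_within_open[OF _ S x]) (use per in auto)
  then show ?thesis by (simp add: partial_deriv_def frechet_derivative_at[symmetric])
qed

section \<open>Calculus of weighted integrals over a cylinder\<close>

lemma cyl_has_derivs:
  fixes g :: "real^3 \<Rightarrow> real"
  assumes "g differentiable (at (cyl r \<theta> z))"
  shows "((\<lambda>r. g (cyl r \<theta> z)) has_real_derivative
      partial_deriv 1 g (cyl r \<theta> z) * cos \<theta> + partial_deriv 2 g (cyl r \<theta> z) * sin \<theta>) (at r)"
    and "((\<lambda>\<theta>. g (cyl r \<theta> z)) has_real_derivative
      r * (partial_deriv 2 g (cyl r \<theta> z) * cos \<theta> - partial_deriv 1 g (cyl r \<theta> z) * sin \<theta>)) (at \<theta>)"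
    and "((\<lambda>z. g (cyl r \<theta> z)) has_real_derivative partial_deriv 3 g (cyl r \<theta> z)) (at z)"
proof -
  let ?D = "frechet_derivative g (at (cyl r \<theta> z))"
  have D: "(g has_derivative ?D) (at (cyl r \<theta> z))" using assms frechet_derivative_works by blast
  then have lin: "linear ?D" using has_derivative_linear by blast
  have e: "?D (a *\<^sub>R axis 1 1 + b *\<^sub>R axis 2 1 + c *\<^sub>R axis 3 1) = a * partial_deriv 1 g (cyl r \<theta> z)
      + b * partial_deriv 2 g (cyl r \<theta> z) + c * partial_deriv 3 g (cyl r \<theta> z)" for a b c
    using lin by (simp add: linear_add linear_cmul partial_deriv_def)
  have 1: "((\<lambda>r. cyl r \<theta> z) has_derivative (\<lambda>h. (h * cos \<theta>) *\<^sub>R axis 1 1 + (h * sin \<theta>) *\<^sub>R axis 2 1 + 0 *\<^sub>R axis 3 1)) (at r)"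
    unfolding cyl_eq by (auto intro!: derivative_eq_intros)
  have 2: "((\<lambda>\<theta>. cyl r \<theta> z) has_derivative (\<lambda>h. (- h * r * sin \<theta>) *\<^sub>R axis 1 1 + (h * r * cos \<theta>) *\<^sub>R axis 2 1 + 0 *\<^sub>R axis 3 1)) (at \<theta>)"
    unfolding cyl_eq by (auto intro!: derivative_eq_intros simp: mult_ac)
  have 3: "((\<lambda>z. cyl r \<theta> z) has_derivative (\<lambda>h. 0 *\<^sub>R axis 1 1 + 0 *\<^sub>R axis 2 1 + h *\<^sub>R axis 3 1)) (at z)"
    unfolding cyl_eq by (auto intro!: derivative_eq_intros)
  show "((\<lambda>r. g (cyl r \<theta> z)) has_real_derivative
      partial_deriv 1 g (cyl r \<theta> z) * cos \<theta> + partial_deriv 2 g (cyl r \<theta> z) * sin \<theta>) (at r)"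
    using has_derivative_compose[OF 1 D] unfolding e has_field_derivative_def
    by (rule has_derivative_eq_rhs) (auto simp: algebra_simps)
  show "((\<lambda>\<theta>. g (cyl r \<theta> z)) has_real_derivative
      r * (partial_deriv 2 g (cyl r \<theta> z) * cos \<theta> - partial_deriv 1 g (cyl r \<theta> z) * sin \<theta>)) (at \<theta>)"
    using has_derivative_compose[OF 2 D] unfolding e has_field_derivative_def
    by (rule has_derivative_eq_rhs) (auto simp: algebra_simps)
  show "((\<lambda>z. g (cyl r \<theta> z)) has_real_derivative partial_deriv 3 g (cyl r \<theta> z)) (at z)"
    using has_derivative_compose[OF 3 D] unfolding e has_field_derivative_def
    by (rule has_derivative_eq_rhs) (auto simp: algebra_simps)
qed

text \<open>Product weights cover the Fourier coefficients in both variables as well as arbitrary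
  axial test functions. A gauge integral over the parameter rectangle serves differentiation under
  the integral and exchange of order for continuous integrands; the surface factor \<open>r\<close>
  is left out.\<close>

definition cint :: "(real^3 \<Rightarrow> real) \<Rightarrow> (real \<Rightarrow> real) \<Rightarrow> (real \<Rightarrow> real) \<Rightarrow> real \<Rightarrow> real" where
  "cint g \<alpha> \<gamma> r = integral (cbox (0, 0) (2 * pi, 2)) (\<lambda>p. g (cyl r (fst p) (snd p)) * \<alpha> (fst p) * \<gamma> (snd p))"

lemma integral_periodic_deriv_zero:
  fixes F F' :: "real \<Rightarrow> real"
  assumes "a \<le> b" "\<And>x. (F has_real_derivative F' x) (at x)" "F b = F a"
  shows "integral {a..b} F' = 0"
proof -
  have "(F' has_integral (F b - F a)) {a..b}"
    using assms by (intro fundamental_theorem_of_calculus)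
      (auto intro: has_field_derivative_at_within simp: has_real_derivative_iff_has_vector_derivative[symmetric])
  then show ?thesis using assms by (simp add: integral_unique)
qed

lemma continuous_on_deriv_UNIV:
  assumes "\<And>x::real. (f has_real_derivative f' x) (at x)"
  shows "continuous_on UNIV f"
  using assms by (intro continuous_at_imp_continuous_on ballI DERIV_isCont) auto

context
  fixes \<epsilon> :: real
  assumes eps: "0 < \<epsilon>"
begin

lemma cint_continuous:
  fixes g :: "real^3 \<Rightarrow> real"
  assumes g: "continuous_on (exterior_domain \<epsilon>) g" and a: "continuous_on UNIV \<alpha>" "continuous_on UNIV \<gamma>" and r: "\<epsilon> < r"
  shows "continuous_on A (\<lambda>p. g (cyl r (fst p) (snd p)) * \<alpha> (fst p) * \<gamma> (snd p))"
proof -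
  have "continuous_on A (\<lambda>p. g (cyl r (fst p) (snd p)))"
    by (rule continuous_on_compose2[OF g]) (use r eps in \<open>auto intro!: continuous_intros cyl_in_exterior\<close>)
  moreover have "continuous_on A (\<lambda>p. \<alpha> (fst p))" "continuous_on A (\<lambda>p. \<gamma> (snd p))"
    by (rule continuous_on_compose2[OF a(1)] continuous_on_compose2[OF a(2)]; auto intro!: continuous_intros)+
  ultimately show ?thesis by (intro continuous_on_mult)
qed

lemma cint_integrable:
  fixes g :: "real^3 \<Rightarrow> real"
  assumes g: "continuous_on (exterior_domain \<epsilon>) g" and a: "continuous_on UNIV \<alpha>" "continuous_on UNIV \<gamma>" and r: "\<epsilon> < r"
  shows "(\<lambda>p. g (cyl r (fst p) (snd p)) * \<alpha> (fst p) * \<gamma> (snd p)) integrable_on cbox (0, 0) (2 * pi, 2)"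
  by (intro integrable_continuous cint_continuous assms)

lemma cint_cong:
  assumes r: "\<epsilon> < r" and "\<And>x. x \<in> exterior_domain \<epsilon> \<Longrightarrow> g x = h x"
  shows "cint g \<alpha> \<gamma> r = cint h \<alpha> \<gamma> r"
  unfolding cint_def using assms eps by (intro integral_cong) (auto simp: cyl_in_exterior)

lemma cint_add:
  assumes "continuous_on (exterior_domain \<epsilon>) g" "continuous_on (exterior_domain \<epsilon>) h"
    and "continuous_on UNIV \<alpha>" "continuous_on UNIV \<gamma>" and r: "\<epsilon> < r"
  shows "cint (\<lambda>x. g x + h x) \<alpha> \<gamma> r = cint g \<alpha> \<gamma> r + cint h \<alpha> \<gamma> r"
  unfolding cint_def
  unfolding integral_add[OF cint_integrable[OF assms(1,3-5)] cint_integrable[OF assms(2,3-5)], symmetric]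
  by (simp add: algebra_simps)

lemma cint_weight:
  assumes g: "continuous_on (exterior_domain \<epsilon>) g"
    and "continuous_on UNIV \<alpha>" "continuous_on UNIV \<beta>" "continuous_on UNIV \<gamma>" and r: "\<epsilon> < r"
  shows "cint g (\<lambda>\<theta>. a * \<alpha> \<theta> + b * \<beta> \<theta>) \<gamma> r = a * cint g \<alpha> \<gamma> r + b * cint g \<beta> \<gamma> r"
proof -
  note i = integrable_on_cmult_left[OF cint_integrable[OF g assms(2,4) r], of a]
    integrable_on_cmult_left[OF cint_integrable[OF g assms(3,4) r], of b]
  have "cint g (\<lambda>\<theta>. a * \<alpha> \<theta> + b * \<beta> \<theta>) \<gamma> r = integral (cbox (0, 0) (2 * pi, 2))
     (\<lambda>p. a * (g (cyl r (fst p) (snd p)) * \<alpha> (fst p) * \<gamma> (snd p)) + b * (g (cyl r (fst p) (snd p)) * \<beta> (fst p) * \<gamma> (snd p)))"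
    unfolding cint_def by (simp add: algebra_simps)
  also have "\<dots> = a * cint g \<alpha> \<gamma> r + b * cint g \<beta> \<gamma> r"
    using integral_add[OF i] by (simp add: cint_def)
  finally show ?thesis .
qed

lemma cint_zscale: "cint g \<alpha> (\<lambda>z. c * \<gamma> z) r = c * cint g \<alpha> \<gamma> r"
proof -
  have "cint g \<alpha> (\<lambda>z. c * \<gamma> z) r = integral (cbox (0, 0) (2 * pi, 2))
     (\<lambda>p. c * (g (cyl r (fst p) (snd p)) * \<alpha> (fst p) * \<gamma> (snd p)))"
    by (simp add: cint_def mult_ac)
  then show ?thesis by (simp add: cint_def)
qed

lemma cint_deriv:
  assumes g: "C1_on (exterior_domain \<epsilon>) g" and a: "continuous_on UNIV \<alpha>" "continuous_on UNIV \<gamma>" and r: "\<epsilon> < r"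
  shows "(cint g \<alpha> \<gamma> has_real_derivative
     cint (partial_deriv 1 g) (\<lambda>\<theta>. \<alpha> \<theta> * cos \<theta>) \<gamma> r + cint (partial_deriv 2 g) (\<lambda>\<theta>. \<alpha> \<theta> * sin \<theta>) \<gamma> r) (at r)"
proof -
  let ?B = "cbox (0, 0) (2 * pi, 2) :: (real \<times> real) set"
  let ?d = "\<lambda>r p. (partial_deriv 1 g (cyl r (fst p) (snd p)) * cos (fst p) + partial_deriv 2 g (cyl r (fst p) (snd p)) * sin (fst p))
    * \<alpha> (fst p) * \<gamma> (snd p)"
  have gd: "\<And>x. x \<in> exterior_domain \<epsilon> \<Longrightarrow> g differentiable (at x)"
    and gc: "\<And>i. continuous_on (exterior_domain \<epsilon>) (partial_deriv i g)" using g by (auto simp: C1_on_def)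
  have "((\<lambda>r. integral ?B (\<lambda>p. g (cyl r (fst p) (snd p)) * \<alpha> (fst p) * \<gamma> (snd p))) has_real_derivative integral ?B (?d r)) (at r within {\<epsilon><..})"
  proof (rule leibniz_rule_field_derivative)
    show "((\<lambda>r. g (cyl r (fst p) (snd p)) * \<alpha> (fst p) * \<gamma> (snd p)) has_real_derivative ?d x p) (at x within {\<epsilon><..})"
      if "x \<in> {\<epsilon><..}" for x p
      using that eps by (intro DERIV_cmult_right DERIV_subset[OF cyl_has_derivs(1)] gd cyl_in_exterior) auto
    show "(\<lambda>p. g (cyl x (fst p) (snd p)) * \<alpha> (fst p) * \<gamma> (snd p)) integrable_on ?B" if "x \<in> {\<epsilon><..}" for x
      by (rule cint_integrable[OF C1_on_imp_continuous_on[OF g] a]) (use that in auto)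
    show "continuous_on ({\<epsilon><..} \<times> ?B) (\<lambda>(x, t). ?d x t)"
      unfolding split_beta
      by (intro continuous_intros continuous_on_compose2[OF gc] continuous_on_compose2[OF a(1)] continuous_on_compose2[OF a(2)])
        (use eps in \<open>auto intro: cyl_in_exterior\<close>)
  qed (use r in auto)
  moreover have "integral ?B (?d r) = cint (partial_deriv 1 g) (\<lambda>\<theta>. \<alpha> \<theta> * cos \<theta>) \<gamma> r + cint (partial_deriv 2 g) (\<lambda>\<theta>. \<alpha> \<theta> * sin \<theta>) \<gamma> r"
  proof -
    have c: "continuous_on UNIV (\<lambda>\<theta>. \<alpha> \<theta> * cos \<theta>)" "continuous_on UNIV (\<lambda>\<theta>. \<alpha> \<theta> * sin \<theta>)"
      by (intro continuous_intros a)+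
    show ?thesis
      unfolding cint_def integral_add[OF cint_integrable[OF gc c(1) a(2) r] cint_integrable[OF gc c(2) a(2) r], symmetric]
      by (simp add: algebra_simps)
  qed
  moreover have "at r within {\<epsilon><..} = at r" using r by (intro at_within_open) auto
  ultimately show ?thesis unfolding cint_def[abs_def] by simp
qed

text \<open>The left-hand side is the weighted tangential derivative, that is \<open>1 / r\<close>
  times the derivative of \<open>g\<close> along \<open>\<theta>\<close>. The
  \<open>\<theta>\<close>-derivative of \<open>g\<close> times \<open>\<alpha>\<close> integrates to
  zero over a full turn.\<close>

lemma cint_angular_parts:
  assumes g: "C1_on (exterior_domain \<epsilon>) g" and \<alpha>: "\<And>\<theta>. (\<alpha> has_real_derivative \<alpha>' \<theta>) (at \<theta>)"
    and \<alpha>': "continuous_on UNIV \<alpha>'" and per: "\<alpha> (2 * pi) = \<alpha> 0" and \<gamma>: "continuous_on UNIV \<gamma>" and r: "\<epsilon> < r"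
  shows "cint (partial_deriv 2 g) (\<lambda>\<theta>. \<alpha> \<theta> * cos \<theta>) \<gamma> r - cint (partial_deriv 1 g) (\<lambda>\<theta>. \<alpha> \<theta> * sin \<theta>) \<gamma> r
     = - cint g \<alpha>' \<gamma> r / r"
proof -
  let ?B = "cbox (0, 0) (2 * pi, 2) :: (real \<times> real) set"
  have \<alpha>c: "continuous_on UNIV \<alpha>" by (rule continuous_on_deriv_UNIV[OF \<alpha>])
  have gd: "\<And>x. x \<in> exterior_domain \<epsilon> \<Longrightarrow> g differentiable (at x)"
    and gc: "\<And>i. continuous_on (exterior_domain \<epsilon>) (partial_deriv i g)" using g by (auto simp: C1_on_def)
  have g0: "continuous_on (exterior_domain \<epsilon>) g" by (rule C1_on_imp_continuous_on[OF g])
  have c: "continuous_on UNIV (\<lambda>\<theta>. \<alpha> \<theta> * cos \<theta>)" "continuous_on UNIV (\<lambda>\<theta>. \<alpha> \<theta> * sin \<theta>)"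
    by (intro continuous_intros \<alpha>c)+
  define D2 where "D2 p = partial_deriv 2 g (cyl r (fst p) (snd p)) * (\<alpha> (fst p) * cos (fst p)) * \<gamma> (snd p)" for p
  define D1 where "D1 p = partial_deriv 1 g (cyl r (fst p) (snd p)) * (\<alpha> (fst p) * sin (fst p)) * \<gamma> (snd p)" for p
  define D0 where "D0 p = g (cyl r (fst p) (snd p)) * \<alpha>' (fst p) * \<gamma> (snd p)" for p
  define d where "d p = r * (D2 p - D1 p) + D0 p" for p
  have Dc: "continuous_on ?B D2" "continuous_on ?B D1" "continuous_on ?B D0"
    unfolding D2_def[abs_def] D1_def[abs_def] D0_def[abs_def]
    by (rule cint_continuous[OF gc c(1) \<gamma> r] cint_continuous[OF gc c(2) \<gamma> r] cint_continuous[OF g0 \<alpha>' \<gamma> r])+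
  have dc: "continuous_on ?B d"
    unfolding d_def[abs_def] by (intro continuous_intros Dc)
  have "integral ?B d = integral {0..2 * pi} (\<lambda>\<theta>. integral {0..2} (\<lambda>z. d (\<theta>, z)))"
    using integral_prod_continuous[OF dc] by simp
  also have "\<dots> = integral {0..2} (\<lambda>z. integral {0..2 * pi} (\<lambda>\<theta>. d (\<theta>, z)))"
    using integral_swap_continuous[of 0 0 "2 * pi" 2 "\<lambda>\<theta> z. d (\<theta>, z)"] dc by (simp add: case_prod_unfold)
  also have "\<dots> = integral {0..2::real} (\<lambda>z. 0)"
  proof (rule integral_cong)
    fix z :: real
    show "integral {0..2 * pi} (\<lambda>\<theta>. d (\<theta>, z)) = 0"
    proof (rule integral_periodic_deriv_zero[where F="\<lambda>\<theta>. g (cyl r \<theta> z) * \<alpha> \<theta> * \<gamma> z"])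
      show "((\<lambda>\<theta>. g (cyl r \<theta> z) * \<alpha> \<theta> * \<gamma> z) has_real_derivative d (x, z)) (at x)" for x
      proof -
        have "((\<lambda>\<theta>. g (cyl r \<theta> z) * \<alpha> \<theta> * \<gamma> z) has_real_derivative
          (r * (partial_deriv 2 g (cyl r x z) * cos x - partial_deriv 1 g (cyl r x z) * sin x) * \<alpha> x + \<alpha>' x * g (cyl r x z)) * \<gamma> z) (at x)"
          by (intro DERIV_cmult_right DERIV_mult cyl_has_derivs(2) gd cyl_in_exterior eps r \<alpha>)
        then show ?thesis by (simp add: d_def D2_def D1_def D0_def algebra_simps)
      qed
      show "g (cyl r (2 * pi) z) * \<alpha> (2 * pi) * \<gamma> z = g (cyl r 0 z) * \<alpha> 0 * \<gamma> z"
        using cyl_rotate[of r 0 z] per by simp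
    qed auto
  qed
  finally have z: "integral ?B d = 0" by simp
  note i = integrable_continuous[OF Dc(1)] integrable_continuous[OF Dc(2)] integrable_continuous[OF Dc(3)]
  have "integral ?B d = integral ?B (\<lambda>p. r * (D2 p - D1 p)) + integral ?B D0"
    unfolding d_def[abs_def]
    by (rule integral_add[OF integrable_cmul[OF integrable_diff[OF i(1,2)], unfolded real_scaleR_def] i(3)])
  also have "integral ?B (\<lambda>p. r * (D2 p - D1 p)) = r * (integral ?B D2 - integral ?B D1)"

    by (simp add: integral_diff i)
  finally have "integral ?B d = r * (cint (partial_deriv 2 g) (\<lambda>\<theta>. \<alpha> \<theta> * cos \<theta>) \<gamma> r - cint (partial_deriv 1 g) (\<lambda>\<theta>. \<alpha> \<theta> * sin \<theta>) \<gamma> r)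
      + cint g \<alpha>' \<gamma> r"
    unfolding cint_def D2_def[abs_def] D1_def[abs_def] D0_def[abs_def] .
  then show ?thesis using z r eps by (simp add: field_simps)
qed

lemma cint_axial_parts:
  assumes g: "C1_on (exterior_domain \<epsilon>) g" and per_g: "\<And>x. x \<in> exterior_domain \<epsilon> \<Longrightarrow> g (x + axis 3 2) = g x"
    and \<alpha>: "continuous_on UNIV \<alpha>" and \<gamma>: "\<And>z. (\<gamma> has_real_derivative \<gamma>' z) (at z)"
    and \<gamma>': "continuous_on UNIV \<gamma>'" and per: "\<gamma> 2 = \<gamma> 0" and r: "\<epsilon> < r"
  shows "cint (partial_deriv 3 g) \<alpha> \<gamma> r = - cint g \<alpha> \<gamma>' r"
proof -
  let ?B = "cbox (0, 0) (2 * pi, 2) :: (real \<times> real) set"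
  have \<gamma>c: "continuous_on UNIV \<gamma>" by (rule continuous_on_deriv_UNIV[OF \<gamma>])
  have gd: "\<And>x. x \<in> exterior_domain \<epsilon> \<Longrightarrow> g differentiable (at x)"
    and gc: "\<And>i. continuous_on (exterior_domain \<epsilon>) (partial_deriv i g)" using g by (auto simp: C1_on_def)
  have g0: "continuous_on (exterior_domain \<epsilon>) g" by (rule C1_on_imp_continuous_on[OF g])
  define d where "d p = partial_deriv 3 g (cyl r (fst p) (snd p)) * \<alpha> (fst p) * \<gamma> (snd p)
     + g (cyl r (fst p) (snd p)) * \<alpha> (fst p) * \<gamma>' (snd p)" for p
  have dc: "continuous_on ?B d"
    unfolding d_def[abs_def] by (intro continuous_on_add cint_continuous[OF gc \<alpha> \<gamma>c r] cint_continuous[OF g0 \<alpha> \<gamma>' r])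
  have "integral ?B d = integral {0..2 * pi} (\<lambda>\<theta>. integral {0..2} (\<lambda>z. d (\<theta>, z)))"
    using integral_prod_continuous[OF dc] by simp
  also have "\<dots> = integral {0..2 * pi} (\<lambda>\<theta>::real. 0)"
  proof (rule integral_cong)
    fix \<theta> :: real
    show "integral {0..2} (\<lambda>z. d (\<theta>, z)) = 0"
    proof (rule integral_periodic_deriv_zero[where F="\<lambda>z. g (cyl r \<theta> z) * \<alpha> \<theta> * \<gamma> z"])
      show "((\<lambda>z. g (cyl r \<theta> z) * \<alpha> \<theta> * \<gamma> z) has_real_derivative d (\<theta>, x)) (at x)" for x
      proof -
        have "((\<lambda>z. g (cyl r \<theta> z) * \<alpha> \<theta> * \<gamma> z) has_real_derivative
          (partial_deriv 3 g (cyl r \<theta> x) * \<alpha> \<theta>) * \<gamma> x + \<gamma>' x * (g (cyl r \<theta> x) * \<alpha> \<theta>)) (at x)"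
          by (intro DERIV_cmult_right DERIV_mult cyl_has_derivs(3) gd cyl_in_exterior eps r \<gamma>)
        then show ?thesis by (simp add: d_def algebra_simps)
      qed
      show "g (cyl r \<theta> 2) * \<alpha> \<theta> * \<gamma> 2 = g (cyl r \<theta> 0) * \<alpha> \<theta> * \<gamma> 0"
        using cyl_shift[of r \<theta> 0] per per_g[OF cyl_in_exterior[OF eps r]] by simp
    qed auto
  qed
  finally have z: "integral ?B d = 0" by simp
  have "integral ?B d = cint (partial_deriv 3 g) \<alpha> \<gamma> r + cint g \<alpha> \<gamma>' r"
    unfolding cint_def d_def[abs_def]
    by (rule integral_add[OF cint_integrable[OF gc \<alpha> \<gamma>c r] cint_integrable[OF g0 \<alpha> \<gamma>' r]])
  then show ?thesis using z by simp
qed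

lemma cint_tendsto_0:
  assumes "(g \<longlongrightarrow> 0) (filtercomap cyl_radius at_top)" and g: "continuous_on (exterior_domain \<epsilon>) g"
    and a: "continuous_on UNIV \<alpha>" "continuous_on UNIV \<gamma>" and b: "\<And>\<theta>. \<bar>\<alpha> \<theta>\<bar> \<le> 1" "\<And>z. \<bar>\<gamma> z\<bar> \<le> 1"
  shows "(cint g \<alpha> \<gamma> \<longlongrightarrow> 0) at_top"
proof (rule tendstoI)
  fix e :: real assume e: "0 < e"
  \<comment> \<open>The rectangle has area \<open>4 * pi\<close>, so this leaves
    \<open>e / 2\<close>.\<close>
  define c where "c = e / (8 * pi)"
  have c: "0 < c" using e by (simp add: c_def)
  have "\<forall>\<^sub>F x in filtercomap cyl_radius at_top. dist (g x) 0 < c" using tendstoD[OF assms(1) c] .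
  then obtain R where R: "\<And>x. R \<le> cyl_radius x \<Longrightarrow> \<bar>g x\<bar> < c"
    by (auto simp: eventually_filtercomap eventually_at_top_linorder)
  show "\<forall>\<^sub>F r in at_top. dist (cint g \<alpha> \<gamma> r) 0 < e"
  proof (rule eventually_mono[OF eventually_gt_at_top[of "max R \<epsilon>"]])
    fix r assume r: "max R \<epsilon> < r"
    have "norm (cint g \<alpha> \<gamma> r) \<le> c * measure lborel (cbox (0, 0) (2 * pi, 2) :: (real \<times> real) set)"
      unfolding cint_def
    proof (rule integrable_bound[OF _ cint_integrable[OF g a]])
      fix p :: "real \<times> real"
      have "\<bar>g (cyl r (fst p) (snd p))\<bar> \<le> c" using R[of "cyl r (fst p) (snd p)"] r eps by simp
      then have "\<bar>g (cyl r (fst p) (snd p))\<bar> * \<bar>\<alpha> (fst p)\<bar> * \<bar>\<gamma> (snd p)\<bar> \<le> c * 1 * 1" using b c by (intro mult_mono) auto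
      then show "norm (g (cyl r (fst p) (snd p)) * \<alpha> (fst p) * \<gamma> (snd p)) \<le> c" by (simp add: abs_mult)
    qed (use c r in auto)
    also have "\<dots> = e / 2" by (simp add: c_def content_Pair)
    finally show "dist (cint g \<alpha> \<gamma> r) 0 < e" using e by simp
  qed
qed

end

section \<open>Modes of a Stokes flow\<close>

text \<open>Real Fourier coefficients: the phase \<open>b\<close> selects the cosine (\<open>b = 0\<close>) or the sine (\<open>b = \<pi> / 2\<close>).\<close>

definition cmode :: "(real^3 \<Rightarrow> real) \<Rightarrow> real \<Rightarrow> real \<Rightarrow> (real \<Rightarrow> real) \<Rightarrow> real \<Rightarrow> real" where
  "cmode g n b \<gamma> = cint g (\<lambda>\<theta>. cos (n * \<theta> - b)) \<gamma>"

text \<open>The radial derivative is \<open>cos \<theta> \<partial>\<^sub>1 + sin \<theta>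
  \<partial>\<^sub>2\<close>; multiplied by \<open>cos (n \<theta> - b)\<close>, the products split
  into orders \<open>n - 1\<close> and \<open>n + 1\<close>. Adding \<open>pi / 2\<close> to the
  phase turns the cosine into a sine.\<close>

definition cmode1 :: "(real^3 \<Rightarrow> real) \<Rightarrow> real \<Rightarrow> real \<Rightarrow> (real \<Rightarrow> real) \<Rightarrow> real \<Rightarrow> real" where
  "cmode1 g n b \<gamma> r =
    (cmode (partial_deriv 1 g) (n-1) b \<gamma> r - cmode (partial_deriv 2 g) (n-1) (b + pi/2) \<gamma> r
     + cmode (partial_deriv 1 g) (n+1) b \<gamma> r + cmode (partial_deriv 2 g) (n+1) (b + pi/2) \<gamma> r) / 2"

definition cmode2 :: "(real^3 \<Rightarrow> real) \<Rightarrow> real \<Rightarrow> real \<Rightarrow> (real \<Rightarrow> real) \<Rightarrow> real \<Rightarrow> real" where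
  "cmode2 g n b \<gamma> r =
    (cmode1 (partial_deriv 1 g) (n-1) b \<gamma> r - cmode1 (partial_deriv 2 g) (n-1) (b + pi/2) \<gamma> r
     + cmode1 (partial_deriv 1 g) (n+1) b \<gamma> r + cmode1 (partial_deriv 2 g) (n+1) (b + pi/2) \<gamma> r) / 2"

lemma cos_shift_pi_half: "cos (x - (b + pi/2)) = sin (x - b)"
  using cos_diff[of "x - b" "pi/2"] by (simp add: diff_diff_eq)

lemma cmode_shift_pi: "cmode g n (b + pi) \<gamma> r = - cmode g n b \<gamma> r"
proof -
  have "cos (x - (b + pi)) = - cos (x - b)" for x
    using cos_diff[of "x - b" pi] by (simp add: diff_diff_eq)
  then show ?thesis by (simp add: cmode_def cint_def)
qed

lemma cmode_shift_pi_half2: "cmode g n (b + pi/2 + pi/2) \<gamma> r = - cmode g n b \<gamma> r"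
  using cmode_shift_pi[of g n b \<gamma> r] by (simp add: add.assoc)

context
  fixes \<epsilon> :: real
  assumes eps: "0 < \<epsilon>"
begin

text \<open>The last two are ladder identities: \<open>\<partial>\<^sub>r + n / r\<close> and
  \<open>\<partial>\<^sub>r - n / r\<close> each retain one of the two neighbouring orders. They are
  the sum and the difference of the expanded radial derivative and the tangential identity
  \<open>cint_angular_parts\<close>.\<close>

lemma cmode_deriv:
  assumes g: "C1_on (exterior_domain \<epsilon>) g" and n: "n \<in> \<int>" and \<gamma>: "continuous_on UNIV \<gamma>" and r: "\<epsilon> < r"
  shows "(cmode g n b \<gamma> has_real_derivative cmode1 g n b \<gamma> r) (at r)"
    and "cmode1 g n b \<gamma> r + n * cmode g n b \<gamma> r / r =
      cmode (partial_deriv 1 g) (n-1) b \<gamma> r - cmode (partial_deriv 2 g) (n-1) (b + pi/2) \<gamma> r"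
    and "cmode1 g n b \<gamma> r - n * cmode g n b \<gamma> r / r =
      cmode (partial_deriv 1 g) (n+1) b \<gamma> r + cmode (partial_deriv 2 g) (n+1) (b + pi/2) \<gamma> r"
proof -
  have gc: "continuous_on (exterior_domain \<epsilon>) (partial_deriv i g)" for i using g by (auto simp: C1_on_def)
  have cc: "continuous_on UNIV (\<lambda>\<theta>::real. cos (k * \<theta> - c))" for k c by (intro continuous_intros)
  let ?c = "\<lambda>k \<theta>. cos (k * \<theta> - b)" and ?s = "\<lambda>k \<theta>. cos (k * \<theta> - (b + pi/2))"
  note w = cint_weight[OF eps gc cc cc \<gamma> r]
  have e: "n * \<theta> - b = x \<Longrightarrow> (n - 1) * \<theta> - b = x - \<theta>" "n * \<theta> - b = x \<Longrightarrow> (n + 1) * \<theta> - b = x + \<theta>" for \<theta> x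
    by (auto simp: algebra_simps)
  have t: "(\<lambda>\<theta>. cos (n * \<theta> - b) * cos \<theta>) = (\<lambda>\<theta>. 1/2 * ?c (n-1) \<theta> + 1/2 * ?c (n+1) \<theta>)"
    "(\<lambda>\<theta>. cos (n * \<theta> - b) * sin \<theta>) = (\<lambda>\<theta>. 1/2 * ?s (n+1) \<theta> + (-1/2) * ?s (n-1) \<theta>)"
    "(\<lambda>\<theta>. sin (n * \<theta> - b) * cos \<theta>) = (\<lambda>\<theta>. 1/2 * ?s (n+1) \<theta> + 1/2 * ?s (n-1) \<theta>)"
    "(\<lambda>\<theta>. sin (n * \<theta> - b) * sin \<theta>) = (\<lambda>\<theta>. 1/2 * ?c (n-1) \<theta> + (-1/2) * ?c (n+1) \<theta>)"
    unfolding cos_shift_pi_half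
    by (auto simp: fun_eq_iff e(1)[OF refl] e(2)[OF refl] cos_add cos_diff sin_add sin_diff field_simps)
  have d1: "cint (partial_deriv 1 g) (\<lambda>\<theta>. cos (n * \<theta> - b) * cos \<theta>) \<gamma> r + cint (partial_deriv 2 g) (\<lambda>\<theta>. cos (n * \<theta> - b) * sin \<theta>) \<gamma> r
     = cmode1 g n b \<gamma> r"
    unfolding t w cmode1_def cmode_def by (simp add: field_simps)
  show "(cmode g n b \<gamma> has_real_derivative cmode1 g n b \<gamma> r) (at r)"
    using cint_deriv[OF eps g cc[of n b] \<gamma> r] unfolding d1 by (simp add: cmode_def)
  have per: "sin (n * (2 * pi) - b) = sin (n * 0 - b)"
  proof -
    obtain k where "n = of_int k" using n by (auto elim: Ints_cases)
    then have "n * (2 * pi) = 2 * pi * of_int k" by simp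
    then show ?thesis by (simp only: sin_diff cos_int_2pin sin_int_2pin) simp
  qed
  have "cint (partial_deriv 2 g) (\<lambda>\<theta>. sin (n * \<theta> - b) * cos \<theta>) \<gamma> r - cint (partial_deriv 1 g) (\<lambda>\<theta>. sin (n * \<theta> - b) * sin \<theta>) \<gamma> r
     = - cint g (\<lambda>\<theta>. n * cos (n * \<theta> - b) + 0 * cos (n * \<theta> - b)) \<gamma> r / r"
    by (rule cint_angular_parts[OF eps g _ _ per \<gamma> r]) (auto intro!: derivative_eq_intros continuous_intros)
  also have "\<dots> = - (n * cmode g n b \<gamma> r / r)"
    unfolding cint_weight[OF eps C1_on_imp_continuous_on[OF g] cc cc \<gamma> r] by (simp add: cmode_def)
  finally have d2: "- (n * cmode g n b \<gamma> r / r) =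
     (cmode (partial_deriv 2 g) (n+1) (b + pi/2) \<gamma> r + cmode (partial_deriv 2 g) (n-1) (b + pi/2) \<gamma> r
      - (cmode (partial_deriv 1 g) (n-1) b \<gamma> r - cmode (partial_deriv 1 g) (n+1) b \<gamma> r)) / 2"
    unfolding t w cmode_def[symmetric] by (simp add: add_divide_distrib diff_divide_distrib)
  then show "cmode1 g n b \<gamma> r + n * cmode g n b \<gamma> r / r =
      cmode (partial_deriv 1 g) (n-1) b \<gamma> r - cmode (partial_deriv 2 g) (n-1) (b + pi/2) \<gamma> r"
    "cmode1 g n b \<gamma> r - n * cmode g n b \<gamma> r / r =
      cmode (partial_deriv 1 g) (n+1) b \<gamma> r + cmode (partial_deriv 2 g) (n+1) (b + pi/2) \<gamma> r"
    unfolding cmode1_def by (simp_all add: field_simps)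
qed

text \<open>Combining the four first-order identities produces the mixed derivatives twice with opposite signs,
  so their symmetry is not needed.\<close>

lemma cmode_second:
  assumes g: "C2_on (exterior_domain \<epsilon>) g" and n: "n \<in> \<int>" and \<gamma>: "continuous_on UNIV \<gamma>" and r: "\<epsilon> < r"
  shows "(cmode1 g n b \<gamma> has_real_derivative cmode2 g n b \<gamma> r) (at r)"
    and "cmode2 g n b \<gamma> r + cmode1 g n b \<gamma> r / r - n\<^sup>2 / r\<^sup>2 * cmode g n b \<gamma> r =
      cmode (partial_deriv 1 (partial_deriv 1 g)) n b \<gamma> r + cmode (partial_deriv 2 (partial_deriv 2 g)) n b \<gamma> r"
proof -
  have g1: "C1_on (exterior_domain \<epsilon>) g" "\<And>i. C1_on (exterior_domain \<epsilon>) (partial_deriv i g)" using g by (auto simp: C2_on_def)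
  have n': "n - 1 \<in> \<int>" "n + 1 \<in> \<int>" using n by auto
  show "(cmode1 g n b \<gamma> has_real_derivative cmode2 g n b \<gamma> r) (at r)"
  proof -
    have e: "cmode1 g n b \<gamma> = (\<lambda>r. (cmode (partial_deriv 1 g) (n-1) b \<gamma> r - cmode (partial_deriv 2 g) (n-1) (b + pi/2) \<gamma> r
     + cmode (partial_deriv 1 g) (n+1) b \<gamma> r + cmode (partial_deriv 2 g) (n+1) (b + pi/2) \<gamma> r) / 2)"
      by (simp add: fun_eq_iff cmode1_def)
    show ?thesis unfolding e cmode2_def
      by (intro DERIV_cdivide DERIV_add DERIV_diff cmode_deriv(1) g1 n' \<gamma> r)
  qed
  note a = cmode_deriv(3)[OF g1(2) n'(1) \<gamma> r] and c = cmode_deriv(2)[OF g1(2) n'(2) \<gamma> r]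
  note f = cmode_deriv(2,3)[OF g1(1) n \<gamma> r, of b]
  have m: "n - 1 + 1 = n" "n + 1 - 1 = n" by auto
  have r0: "r \<noteq> 0" using r eps by simp
  define i where "i = 1 / r"
  have ri: "x / r = i * x" "x / r\<^sup>2 = i * (i * x)" for x by (auto simp: i_def power2_eq_square)
  note sub1 = diff_eq_eq[THEN iffD1] and sub2 = eq_diff_eq[THEN iffD2]
  note A = sub1[OF a[of 1 b, unfolded m ri]] and B = sub1[OF a[of 2 "b + pi/2", unfolded m cmode_shift_pi_half2 ri]]
    and C = sub2[OF c[of 1 b, unfolded m ri]] and D = sub2[OF c[of 2 "b + pi/2", unfolded m cmode_shift_pi_half2 ri]]
    and F = sub1[OF f(1)[symmetric, unfolded ri]] and G = sub2[OF f(2)[symmetric, unfolded ri]]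
  have "2 * cmode2 g n b \<gamma> r = cmode1 (partial_deriv 1 g) (n-1) b \<gamma> r - cmode1 (partial_deriv 2 g) (n-1) (b + pi/2) \<gamma> r
     + cmode1 (partial_deriv 1 g) (n+1) b \<gamma> r + cmode1 (partial_deriv 2 g) (n+1) (b + pi/2) \<gamma> r"
    by (simp add: cmode2_def)
  then show "cmode2 g n b \<gamma> r + cmode1 g n b \<gamma> r / r - n\<^sup>2 / r\<^sup>2 * cmode g n b \<gamma> r =
      cmode (partial_deriv 1 (partial_deriv 1 g)) n b \<gamma> r + cmode (partial_deriv 2 (partial_deriv 2 g)) n b \<gamma> r"
    unfolding A B C D F G ri by (simp add: algebra_simps power2_eq_square)
qed

lemma cmode_add:
  assumes "continuous_on (exterior_domain \<epsilon>) g" "continuous_on (exterior_domain \<epsilon>) h"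
    and "continuous_on UNIV \<gamma>" and r: "\<epsilon> < r"
  shows "cmode (\<lambda>x. g x + h x) n b \<gamma> r = cmode g n b \<gamma> r + cmode h n b \<gamma> r"
  unfolding cmode_def by (rule cint_add[OF eps assms(1,2) _ assms(3) r]) (intro continuous_intros)

end

locale stokes_flow =
  fixes \<epsilon> :: real and ubar :: "real \<Rightarrow> real^3" and u :: "real^3 \<Rightarrow> real^3" and p :: "real^3 \<Rightarrow> real"
  assumes eps: "0 < \<epsilon>" and sol: "stokes_solution \<epsilon> ubar u p"
begin

abbreviation \<Omega> where "\<Omega> \<equiv> exterior_domain \<epsilon>"

lemma u_C2: "C2_on \<Omega> u" and p_C1: "C1_on \<Omega> p" and u_per: "x \<in> \<Omega> \<Longrightarrow> u (x + axis 3 2) = u x"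
  and p_per: "x \<in> \<Omega> \<Longrightarrow> p (x + axis 3 2) = p x"
  and momentum: "x \<in> \<Omega> \<Longrightarrow> laplacian u x = gradient p x"
  and incompressible: "x \<in> \<Omega> \<Longrightarrow> divergence u x = 0"
  and trace: "((\<lambda>r. LBINT \<theta>:{0..2*pi}. LBINT z:{0..2}. (norm (u (cyl r \<theta> z) - ubar z))\<^sup>2) \<longlongrightarrow> 0) (at_right \<epsilon>)"
  and u_inf: "(u \<longlongrightarrow> 0) (filtercomap cyl_radius at_top)"
  and p_inf: "(p \<longlongrightarrow> 0) (filtercomap cyl_radius at_top)"
  using sol by (auto simp: stokes_solution_def)

abbreviation uc where "uc j \<equiv> (\<lambda>x. u x $ j)"

lemma uc_C2: "C2_on \<Omega> (uc j)"
  by (rule C2_on_component(2)[OF u_C2 open_exterior_domain])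

lemma uc_C1: "C1_on \<Omega> (uc j)" "C1_on \<Omega> (partial_deriv i (uc j))"
  using uc_C2 by (auto simp: C2_on_def)

lemma uc_cont: "continuous_on \<Omega> (uc j)" "continuous_on \<Omega> (partial_deriv i (uc j))"
  "continuous_on \<Omega> (partial_deriv k (partial_deriv i (uc j)))"
  "continuous_on \<Omega> p" "continuous_on \<Omega> (partial_deriv i p)"
  using uc_C1 p_C1 by (auto simp: C1_on_def intro: C1_on_imp_continuous_on)

lemma exterior_shift: "x \<in> \<Omega> \<Longrightarrow> x + axis 3 2 \<in> \<Omega>"
  by (simp add: exterior_domain_def cyl_radius_def axis_def)

lemma uc_per: "x \<in> \<Omega> \<Longrightarrow> uc j (x + axis 3 2) = uc j x"
  by (simp add: u_per)

lemma duc_per: "x \<in> \<Omega> \<Longrightarrow> partial_deriv i (uc j) (x + axis 3 2) = partial_deriv i (uc j) x"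
  by (rule partial_deriv_shift[OF open_exterior_domain exterior_shift]) (use uc_per uc_C1 in \<open>auto simp: C1_on_def\<close>)

lemma momentum_component:
  assumes x: "x \<in> \<Omega>"
  shows "partial_deriv 1 (partial_deriv 1 (uc j)) x + partial_deriv 2 (partial_deriv 2 (uc j)) x
    + partial_deriv 3 (partial_deriv 3 (uc j)) x = partial_deriv j p x"
  using arg_cong[OF momentum[OF x], of "\<lambda>v. v $ j"]
  by (simp add: C2_on_component(1)[OF u_C2 open_exterior_domain x] laplacian_def gradient_def sum_3)

lemma incompressible_component:
  assumes x: "x \<in> \<Omega>"
  shows "partial_deriv 1 (uc 1) x + partial_deriv 2 (uc 2) x + partial_deriv 3 (uc 3) x = 0"
proof -
  have "C1_on \<Omega> u" using u_C2 by (simp add: C2_on_def)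
  then show ?thesis
    using incompressible[OF x] by (simp add: C1_on_component(1)[OF _ x] divergence_def sum_3)
qed

lemma cint_incompressible:
  assumes a: "continuous_on UNIV \<alpha>" "continuous_on UNIV \<gamma>" and r: "\<epsilon> < r"
  shows "cint (partial_deriv 1 (uc 1)) \<alpha> \<gamma> r + cint (partial_deriv 2 (uc 2)) \<alpha> \<gamma> r + cint (partial_deriv 3 (uc 3)) \<alpha> \<gamma> r = 0"
proof -
  have "cint (\<lambda>x. (partial_deriv 1 (uc 1) x + partial_deriv 2 (uc 2) x) + partial_deriv 3 (uc 3) x) \<alpha> \<gamma> r = cint (\<lambda>x. 0) \<alpha> \<gamma> r"
    by (rule cint_cong[OF eps r incompressible_component])
  moreover have "cint (\<lambda>x. 0) \<alpha> \<gamma> r = 0" by (simp add: cint_def)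
  moreover have "cint (\<lambda>x. (partial_deriv 1 (uc 1) x + partial_deriv 2 (uc 2) x) + partial_deriv 3 (uc 3) x) \<alpha> \<gamma> r
     = cint (partial_deriv 1 (uc 1)) \<alpha> \<gamma> r + cint (partial_deriv 2 (uc 2)) \<alpha> \<gamma> r + cint (partial_deriv 3 (uc 3)) \<alpha> \<gamma> r"
    by (simp only: cint_add[OF eps continuous_on_add[OF uc_cont(2) uc_cont(2)] uc_cont(2) a r] cint_add[OF eps uc_cont(2) uc_cont(2) a r])
  ultimately show ?thesis by simp
qed

text \<open>Two integrations by parts along the axis turn the second axial derivative into
  \<open>- \<kappa>\<^sup>2\<close>; \<open>cmode_second\<close> supplies the planar
  Laplacian.\<close>

lemma cmode_momentum:
  assumes n: "n \<in> \<int>" and \<gamma>: "\<And>z. (\<gamma> has_real_derivative \<gamma>' z) (at z)" "\<And>z. (\<gamma>' has_real_derivative - \<kappa>\<^sup>2 * \<gamma> z) (at z)"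
    and per: "\<gamma> 2 = \<gamma> 0" "\<gamma>' 2 = \<gamma>' 0" and r: "\<epsilon> < r"
  shows "cmode2 (uc j) n b \<gamma> r + cmode1 (uc j) n b \<gamma> r / r - (n\<^sup>2 / r\<^sup>2 + \<kappa>\<^sup>2) * cmode (uc j) n b \<gamma> r
    = cmode (partial_deriv j p) n b \<gamma> r"
proof -
  have \<gamma>c: "continuous_on UNIV \<gamma>" "continuous_on UNIV \<gamma>'"
    using continuous_on_deriv_UNIV[OF \<gamma>(1)] continuous_on_deriv_UNIV[OF \<gamma>(2)] .
  have cc: "continuous_on UNIV (\<lambda>\<theta>::real. cos (n * \<theta> - b))" by (intro continuous_intros)
  have "cmode (partial_deriv 3 (partial_deriv 3 (uc j))) n b \<gamma> r = - cmode (partial_deriv 3 (uc j)) n b \<gamma>' r"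
    unfolding cmode_def by (rule cint_axial_parts[OF eps uc_C1(2) duc_per cc \<gamma>(1) \<gamma>c(2) per(1) r])
  also have "cmode (partial_deriv 3 (uc j)) n b \<gamma>' r = - cmode (uc j) n b (\<lambda>z. - \<kappa>\<^sup>2 * \<gamma> z) r"
    unfolding cmode_def by (rule cint_axial_parts[OF eps uc_C1(1) uc_per cc \<gamma>(2) _ per(2) r]) (auto intro!: continuous_intros \<gamma>c)
  also have "cmode (uc j) n b (\<lambda>z. - \<kappa>\<^sup>2 * \<gamma> z) r = - \<kappa>\<^sup>2 * cmode (uc j) n b \<gamma> r"
    unfolding cmode_def by (rule cint_zscale[OF eps])
  finally have 3: "cmode (partial_deriv 3 (partial_deriv 3 (uc j))) n b \<gamma> r = - \<kappa>\<^sup>2 * cmode (uc j) n b \<gamma> r" by simp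
  have "cmode (partial_deriv j p) n b \<gamma> r = cmode (\<lambda>x. (partial_deriv 1 (partial_deriv 1 (uc j)) x + partial_deriv 2 (partial_deriv 2 (uc j)) x)
    + partial_deriv 3 (partial_deriv 3 (uc j)) x) n b \<gamma> r"
    unfolding cmode_def by (rule cint_cong[OF eps r momentum_component[symmetric]])
  also have "\<dots> = cmode (partial_deriv 1 (partial_deriv 1 (uc j))) n b \<gamma> r + cmode (partial_deriv 2 (partial_deriv 2 (uc j))) n b \<gamma> r
     + cmode (partial_deriv 3 (partial_deriv 3 (uc j))) n b \<gamma> r"
    by (simp only: cmode_add[OF eps continuous_on_add[OF uc_cont(3) uc_cont(3)] uc_cont(3) \<gamma>c(1) r] cmode_add[OF eps uc_cont(3) uc_cont(3) \<gamma>c(1) r])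
  finally show ?thesis
    using cmode_second(2)[OF eps uc_C2 n \<gamma>c(1) r, of j b] 3 by (simp add: algebra_simps)
qed

text \<open>An axial derivative exchanges cosine and sine, so \<open>\<gamma>c\<close> weighs the
  transverse components and the pressure while \<open>\<gamma>s\<close> weighs
  \<open>u\<^sub>3\<close>. The extra phase \<open>pi / 2\<close> on \<open>u\<^sub>2\<close> makes
  the sums and differences real coefficients of \<open>u\<^sub>1 + i u\<^sub>2\<close> and
  \<open>u\<^sub>1 - i u\<^sub>2\<close>.\<close>

lemma radial_system:
  assumes m: "m = 0 \<or> m = 1" and k: "0 \<le> \<kappa>"
    and \<gamma>c: "\<And>z. (\<gamma>c has_real_derivative - \<kappa> * \<gamma>s z) (at z)" and \<gamma>s: "\<And>z. (\<gamma>s has_real_derivative \<kappa> * \<gamma>c z) (at z)"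
    and per: "\<gamma>c 2 = \<gamma>c 0" "\<gamma>s 2 = \<gamma>s 0" and bd: "\<And>z. \<bar>\<gamma>c z\<bar> \<le> 1" "\<And>z. \<bar>\<gamma>s z\<bar> \<le> 1"
  shows "radial_stokes \<epsilon> \<kappa> m
     (\<lambda>r. cmode (uc 1) (m+1) b \<gamma>c r + cmode (uc 2) (m+1) (b + pi/2) \<gamma>c r)
     (\<lambda>r. cmode1 (uc 1) (m+1) b \<gamma>c r + cmode1 (uc 2) (m+1) (b + pi/2) \<gamma>c r)
     (\<lambda>r. cmode2 (uc 1) (m+1) b \<gamma>c r + cmode2 (uc 2) (m+1) (b + pi/2) \<gamma>c r)
     (\<lambda>r. cmode (uc 1) (m-1) b \<gamma>c r - cmode (uc 2) (m-1) (b + pi/2) \<gamma>c r)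
     (\<lambda>r. cmode1 (uc 1) (m-1) b \<gamma>c r - cmode1 (uc 2) (m-1) (b + pi/2) \<gamma>c r)
     (\<lambda>r. cmode2 (uc 1) (m-1) b \<gamma>c r - cmode2 (uc 2) (m-1) (b + pi/2) \<gamma>c r)
     (cmode (uc 3) m b \<gamma>s) (cmode1 (uc 3) m b \<gamma>s) (cmode2 (uc 3) m b \<gamma>s) (cmode p m b \<gamma>c) (cmode1 p m b \<gamma>c)"
proof
  have cont: "continuous_on UNIV \<gamma>c" "continuous_on UNIV \<gamma>s"
    using continuous_on_deriv_UNIV[OF \<gamma>c] continuous_on_deriv_UNIV[OF \<gamma>s] .
  have \<gamma>c2: "((\<lambda>z. - \<kappa> * \<gamma>s z) has_real_derivative - \<kappa>\<^sup>2 * \<gamma>c z) (at z)" for z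
    using DERIV_cmult[OF \<gamma>s[of z], of "- \<kappa>"] by (simp add: power2_eq_square mult.assoc)
  have \<gamma>s2: "((\<lambda>z. \<kappa> * \<gamma>c z) has_real_derivative - \<kappa>\<^sup>2 * \<gamma>s z) (at z)" for z
    using DERIV_cmult[OF \<gamma>c[of z], of "\<kappa>"] by (simp add: power2_eq_square mult.assoc)
  have mi: "m \<in> \<int>" "m + 1 \<in> \<int>" "m - 1 \<in> \<int>" using m by auto
  show "0 < \<epsilon>" "0 \<le> \<kappa>" "m = 0 \<or> m = 1" by (rule eps k m)+
  have mm: "m + 1 - 1 = m" "m - 1 + 1 = m" by auto
  note md = cmode_deriv(1)[OF eps uc_C1(1) _ cont(1)] cmode_deriv(1)[OF eps uc_C1(1) _ cont(2)]
  note md1 = cmode_second(1)[OF eps uc_C2 _ cont(1)] cmode_second(1)[OF eps uc_C2 _ cont(2)]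
  fix r assume r: "\<epsilon> < r"
  show "((\<lambda>r. cmode (uc 1) (m+1) b \<gamma>c r + cmode (uc 2) (m+1) (b + pi/2) \<gamma>c r) has_real_derivative
     cmode1 (uc 1) (m+1) b \<gamma>c r + cmode1 (uc 2) (m+1) (b + pi/2) \<gamma>c r) (at r)"
    "((\<lambda>r. cmode (uc 1) (m-1) b \<gamma>c r - cmode (uc 2) (m-1) (b + pi/2) \<gamma>c r) has_real_derivative
     cmode1 (uc 1) (m-1) b \<gamma>c r - cmode1 (uc 2) (m-1) (b + pi/2) \<gamma>c r) (at r)"
    "((\<lambda>r. cmode1 (uc 1) (m+1) b \<gamma>c r + cmode1 (uc 2) (m+1) (b + pi/2) \<gamma>c r) has_real_derivative
     cmode2 (uc 1) (m+1) b \<gamma>c r + cmode2 (uc 2) (m+1) (b + pi/2) \<gamma>c r) (at r)"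
    "((\<lambda>r. cmode1 (uc 1) (m-1) b \<gamma>c r - cmode1 (uc 2) (m-1) (b + pi/2) \<gamma>c r) has_real_derivative
     cmode2 (uc 1) (m-1) b \<gamma>c r - cmode2 (uc 2) (m-1) (b + pi/2) \<gamma>c r) (at r)"
    "(cmode (uc 3) m b \<gamma>s has_real_derivative cmode1 (uc 3) m b \<gamma>s r) (at r)"
    "(cmode1 (uc 3) m b \<gamma>s has_real_derivative cmode2 (uc 3) m b \<gamma>s r) (at r)"
    "(cmode p m b \<gamma>c has_real_derivative cmode1 p m b \<gamma>c r) (at r)"
    by (intro DERIV_add DERIV_diff md md1 cmode_deriv(1)[OF eps p_C1 _ cont(1)] mi r)+
  have per': "- \<kappa> * \<gamma>s 2 = - \<kappa> * \<gamma>s 0" "\<kappa> * \<gamma>c 2 = \<kappa> * \<gamma>c 0" using per by auto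
  note mom = cmode_momentum[OF _ \<gamma>c \<gamma>c2 per(1) per'(1) r]
  note pd = cmode_deriv(2,3)[OF eps p_C1 mi(1) cont(1) r, of b]
  show "cmode2 (uc 1) (m+1) b \<gamma>c r + cmode2 (uc 2) (m+1) (b + pi/2) \<gamma>c r
     + (cmode1 (uc 1) (m+1) b \<gamma>c r + cmode1 (uc 2) (m+1) (b + pi/2) \<gamma>c r) / r
     - ((m+1)\<^sup>2 / r\<^sup>2 + \<kappa>\<^sup>2) * (cmode (uc 1) (m+1) b \<gamma>c r + cmode (uc 2) (m+1) (b + pi/2) \<gamma>c r)
     = cmode1 p m b \<gamma>c r - m * cmode p m b \<gamma>c r / r"
    using mom[OF mi(2), of 1 b] mom[OF mi(2), of 2 "b + pi/2"] pd(2)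
    by (simp add: add_divide_distrib distrib_left)
  show "cmode2 (uc 1) (m-1) b \<gamma>c r - cmode2 (uc 2) (m-1) (b + pi/2) \<gamma>c r
     + (cmode1 (uc 1) (m-1) b \<gamma>c r - cmode1 (uc 2) (m-1) (b + pi/2) \<gamma>c r) / r
     - ((m-1)\<^sup>2 / r\<^sup>2 + \<kappa>\<^sup>2) * (cmode (uc 1) (m-1) b \<gamma>c r - cmode (uc 2) (m-1) (b + pi/2) \<gamma>c r)
     = cmode1 p m b \<gamma>c r + m * cmode p m b \<gamma>c r / r"
    using mom[OF mi(3), of 1 b] mom[OF mi(3), of 2 "b + pi/2"] pd(1)
    by (simp add: diff_divide_distrib right_diff_distrib)
  have "cmode (partial_deriv 3 p) m b \<gamma>s r = - cmode p m b (\<lambda>z. \<kappa> * \<gamma>c z) r"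
    unfolding cmode_def by (rule cint_axial_parts[OF eps p_C1 p_per _ \<gamma>s _ per(2) r]) (auto intro!: continuous_intros cont)
  also have "cmode p m b (\<lambda>z. \<kappa> * \<gamma>c z) r = \<kappa> * cmode p m b \<gamma>c r" unfolding cmode_def by (rule cint_zscale[OF eps])
  finally show "cmode2 (uc 3) m b \<gamma>s r + cmode1 (uc 3) m b \<gamma>s r / r - (m\<^sup>2 / r\<^sup>2 + \<kappa>\<^sup>2) * cmode (uc 3) m b \<gamma>s r = - \<kappa> * cmode p m b \<gamma>c r"
    using cmode_momentum[OF mi(1) \<gamma>s \<gamma>s2 per(2) per'(2) r, of 3 b] by simp
  \<comment> \<open>Lowering from \<open>m + 1\<close> and raising from \<open>m - 1\<close> both
    land on order \<open>m\<close>, where the mixed derivatives cancel and \<open>2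
    (\<partial>\<^sub>1 u\<^sub>1 + \<partial>\<^sub>2 u\<^sub>2)\<close> remains.\<close>
  note d1 = cmode_deriv(2)[OF eps uc_C1(1) mi(2) cont(1) r, unfolded mm] and d2 = cmode_deriv(3)[OF eps uc_C1(1) mi(3) cont(1) r, unfolded mm]
  have "cmode (partial_deriv 3 (uc 3)) m b \<gamma>c r = - cmode (uc 3) m b (\<lambda>z. - \<kappa> * \<gamma>s z) r"
    unfolding cmode_def by (rule cint_axial_parts[OF eps uc_C1(1) uc_per _ \<gamma>c _ per(1) r]) (auto intro!: continuous_intros cont)
  also have "cmode (uc 3) m b (\<lambda>z. - \<kappa> * \<gamma>s z) r = - \<kappa> * cmode (uc 3) m b \<gamma>s r" unfolding cmode_def by (rule cint_zscale[OF eps])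
  finally have u3: "cmode (partial_deriv 3 (uc 3)) m b \<gamma>c r = \<kappa> * cmode (uc 3) m b \<gamma>s r" by simp
  have inc: "cmode (partial_deriv 1 (uc 1)) m b \<gamma>c r + cmode (partial_deriv 2 (uc 2)) m b \<gamma>c r + cmode (partial_deriv 3 (uc 3)) m b \<gamma>c r = 0"
    unfolding cmode_def by (rule cint_incompressible) (intro continuous_intros cont r)+
  show "cmode1 (uc 1) (m+1) b \<gamma>c r + cmode1 (uc 2) (m+1) (b + pi/2) \<gamma>c r
     + (m+1) * (cmode (uc 1) (m+1) b \<gamma>c r + cmode (uc 2) (m+1) (b + pi/2) \<gamma>c r) / r
     + (cmode1 (uc 1) (m-1) b \<gamma>c r - cmode1 (uc 2) (m-1) (b + pi/2) \<gamma>c r)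
     - (m-1) * (cmode (uc 1) (m-1) b \<gamma>c r - cmode (uc 2) (m-1) (b + pi/2) \<gamma>c r) / r
     + 2 * \<kappa> * cmode (uc 3) m b \<gamma>s r = 0"
  proof -
    note sub1 = diff_eq_eq[THEN iffD1] and sub2 = eq_diff_eq[THEN iffD2]
    show ?thesis
      unfolding sub2[OF d1[of 1 b]] sub2[OF d1[of 2 "b + pi/2", unfolded cmode_shift_pi_half2]]
        sub1[OF d2[of 1 b]] sub1[OF d2[of 2 "b + pi/2", unfolded cmode_shift_pi_half2]]
      using inc u3 by (simp add: distrib_left right_diff_distrib add_divide_distrib diff_divide_distrib)
  qed
next
  have cont: "continuous_on UNIV \<gamma>c" "continuous_on UNIV \<gamma>s"
    using continuous_on_deriv_UNIV[OF \<gamma>c] continuous_on_deriv_UNIV[OF \<gamma>s] .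
  have ucinf: "(uc j \<longlongrightarrow> 0) (filtercomap cyl_radius at_top)" for j
    using tendsto_vec_nth[OF u_inf, of j] by simp
  have l: "(cmode (uc j) n c \<gamma>c \<longlongrightarrow> 0) at_top" "(cmode (uc j) n c \<gamma>s \<longlongrightarrow> 0) at_top" "(cmode p n c \<gamma>c \<longlongrightarrow> 0) at_top" for j n c
    unfolding cmode_def by (rule cint_tendsto_0[OF eps]; use ucinf p_inf uc_cont cont bd in \<open>auto intro!: continuous_intros\<close>)+
  show "((\<lambda>r. cmode (uc 1) (m+1) b \<gamma>c r + cmode (uc 2) (m+1) (b + pi/2) \<gamma>c r) \<longlongrightarrow> 0) at_top"
    using tendsto_add[OF l(1) l(1)] by simp
  show "((\<lambda>r. cmode (uc 1) (m-1) b \<gamma>c r - cmode (uc 2) (m-1) (b + pi/2) \<gamma>c r) \<longlongrightarrow> 0) at_top"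
    using tendsto_diff[OF l(1) l(1)] by simp
  show "(cmode (uc 3) m b \<gamma>s \<longlongrightarrow> 0) at_top" "(cmode p m b \<gamma>c \<longlongrightarrow> 0) at_top" by (rule l)+
qed

end

section \<open>Boundary values and the force\<close>

lemma set_integrable_dominated:
  fixes g :: "real \<Rightarrow> 'b::{banach, second_countable_topology}"
  assumes "set_integrable lborel A F" "g \<in> borel_measurable borel" "A \<in> sets borel" "\<And>z. z \<in> A \<Longrightarrow> norm (g z) \<le> F z"
  shows "set_integrable lborel A g"
proof (rule set_integrable_bound[OF assms(1)])
  show "set_borel_measurable lborel A g"
    using assms(2,3) unfolding set_borel_measurable_def by measurable
  show "AE x in lborel. x \<in> A \<longrightarrow> norm (g x) \<le> norm (F x)"
    using assms(4) by (intro AE_I2) (auto intro: order_trans abs_ge_self)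
qed

lemma continuous_on_Pair_right: "continuous_on A (Pair a)"
  using continuous_on_Pair[OF continuous_on_const continuous_on_id, of A a] by simp

text \<open>Takes the place of the Cauchy-Schwarz inequality: an L1 quantity is bounded by an L2
  quantity with a free parameter \<open>s\<close>, chosen to suit each use.\<close>

lemma abs_le_young: "0 < s \<Longrightarrow> \<bar>t::real\<bar> \<le> s + t\<^sup>2 / (4 * s)"
proof -
  assume s: "0 < s"
  have "0 \<le> (\<bar>t\<bar> - 2 * s)\<^sup>2 / (4 * s)" using s by simp
  also have "\<dots> = s + \<bar>t\<bar>\<^sup>2 / (4 * s) - \<bar>t\<bar>" using s by (simp only: power2_eq_square) (simp add: field_simps)
  finally show ?thesis by simp
qed

lemma L2_T_component_integrable:
  assumes f: "L2_T f" and \<gamma>: "continuous_on UNIV \<gamma>"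
  shows "set_integrable lborel {0..2} (\<lambda>z. f z $ j * \<gamma> z)"
proof -
  have [measurable]: "f \<in> borel_measurable borel" "\<gamma> \<in> borel_measurable borel"
    using f \<gamma> by (auto simp: L2_T_def intro: borel_measurable_continuous_onI)
  have "(\<lambda>v::real^3. v $ j) \<in> borel_measurable borel" by (intro borel_measurable_continuous_onI continuous_intros)
  then have [measurable]: "(\<lambda>z. f z $ j) \<in> borel_measurable borel" by measurable
  have "bounded (\<gamma> ` {0..2})" using \<gamma> by (intro compact_imp_bounded compact_continuous_image continuous_on_subset[OF \<gamma>]) auto
  then obtain B where "\<forall>z\<in>{0..2}. \<bar>\<gamma> z\<bar> \<le> B" by (auto simp: bounded_iff)
  then have B: "\<And>z. z \<in> {0..2} \<Longrightarrow> \<bar>\<gamma> z\<bar> \<le> B" by blast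
  have sq: "set_integrable lborel {0..2} (\<lambda>z. (norm (f z))\<^sup>2)" using f by (simp add: L2_T_def)
  have c: "set_integrable lborel {0..2::real} (\<lambda>z. 1::real)" by (intro borel_integrable_atLeastAtMost' continuous_intros)
  have "set_integrable lborel {0..2} (\<lambda>z. B * (1 + (norm (f z))\<^sup>2))"
    by (intro set_integrable_mult_right set_integral_add(1) sq c)
  then show ?thesis
  proof (rule set_integrable_dominated)
    fix z :: real assume z: "z \<in> {0..2}"
    have B0: "0 \<le> B" using B[OF z] by linarith
    have "norm (f z) \<le> 1 + (norm (f z))\<^sup>2 / (4 * 1)" using abs_le_young[of 1 "norm (f z)"] by simp
    then have "\<bar>f z $ j\<bar> \<le> 1 + (norm (f z))\<^sup>2" using component_le_norm_cart[of "f z" j] zero_le_power2[of "norm (f z)"] by linarith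
    then have "\<bar>\<gamma> z\<bar> * \<bar>f z $ j\<bar> \<le> B * (1 + (norm (f z))\<^sup>2)" using B[OF z] B0 by (intro mult_mono) auto
    then show "norm (f z $ j * \<gamma> z) \<le> B * (1 + (norm (f z))\<^sup>2)" by (simp add: abs_mult mult.commute)
  qed auto
qed

context stokes_flow
begin

lemma cyl_cont: "\<epsilon> < r \<Longrightarrow> continuous_on \<Omega> h \<Longrightarrow> continuous_on A (\<lambda>p. h (cyl r (fst p) (snd p)))"
  for h :: "real^3 \<Rightarrow> 'c::topological_space"
  by (rule continuous_on_compose2[of \<Omega> h]) (use eps in \<open>auto intro!: continuous_intros cyl_in_exterior\<close>)

lemma cint_iterated:
  assumes h: "continuous_on \<Omega> h" and a: "continuous_on UNIV \<alpha>" "continuous_on UNIV \<gamma>" and r: "\<epsilon> < r"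
  shows "continuous_on {0..2*pi} (\<lambda>\<theta>. LBINT z:{0..2}. h (cyl r \<theta> z) * \<gamma> z)"
    and "cint h \<alpha> \<gamma> r = (LBINT \<theta>:{0..2*pi}. \<alpha> \<theta> * (LBINT z:{0..2}. h (cyl r \<theta> z) * \<gamma> z))"
proof -
  let ?f = "\<lambda>p. h (cyl r (fst p) (snd p)) * \<alpha> (fst p) * \<gamma> (snd p)"
  have c1: "continuous_on UNIV (\<lambda>p. h (cyl r (fst p) (snd p)) * \<gamma> (snd p))"
    using cint_continuous[OF eps h continuous_on_const a(2) r, of UNIV 1] by simp
  have cz: "continuous_on {0..2} (\<lambda>z. h (cyl r \<theta> z) * \<gamma> z)" for \<theta>
    using continuous_on_compose2[OF c1, of "{0..2}" "\<lambda>z. (\<theta>, z)"] continuous_on_Pair_right by auto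
  have e: "(LBINT z:{0..2}. h (cyl r \<theta> z) * \<gamma> z) = integral {0..2} (\<lambda>z. h (cyl r \<theta> z) * \<gamma> z)" for \<theta>
    by (intro set_borel_integral_eq_integral borel_integrable_atLeastAtMost' cz)
  show I: "continuous_on {0..2*pi} (\<lambda>\<theta>. LBINT z:{0..2}. h (cyl r \<theta> z) * \<gamma> z)"
    unfolding e using integral_continuous_on_param[of "{0..2*pi}" 0 2 "\<lambda>\<theta> z. h (cyl r \<theta> z) * \<gamma> z"] continuous_on_subset[OF c1]
    by (simp add: case_prod_unfold)
  have "cint h \<alpha> \<gamma> r = integral {0..2*pi} (\<lambda>\<theta>. integral {0..2} (\<lambda>z. ?f (\<theta>, z)))"
    unfolding cint_def using integral_prod_continuous[OF cint_continuous[OF eps h a r], of 0 0 "2*pi" 2] by simp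
  also have "\<dots> = integral {0..2*pi} (\<lambda>\<theta>. \<alpha> \<theta> * (LBINT z:{0..2}. h (cyl r \<theta> z) * \<gamma> z))"
    unfolding e by (intro integral_cong) (simp add: mult_ac flip: integral_mult_right)
  also have "\<dots> = (LBINT \<theta>:{0..2*pi}. \<alpha> \<theta> * (LBINT z:{0..2}. h (cyl r \<theta> z) * \<gamma> z))"
    by (intro set_borel_integral_eq_integral(2)[symmetric] borel_integrable_atLeastAtMost' continuous_intros I continuous_on_subset[OF a(1)]) auto
  finally show "cint h \<alpha> \<gamma> r = (LBINT \<theta>:{0..2*pi}. \<alpha> \<theta> * (LBINT z:{0..2}. h (cyl r \<theta> z) * \<gamma> z))" .
qed

text \<open>Pointwise, \<open>abs_le_young\<close> bounds the deviation of a component by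
  \<open>\<eta>\<close> plus its squared norm over \<open>4 * \<eta>\<close>; integration over the
  rectangle of area \<open>4 * pi\<close> gives the two terms. The datum does not depend on
  \<open>\<theta>\<close>, so the limit value factors.\<close>

lemma trace_error:
  assumes ub: "L2_T ubar" and a: "continuous_on UNIV \<alpha>" "continuous_on UNIV \<gamma>" and bd: "\<And>\<theta>. \<bar>\<alpha> \<theta>\<bar> \<le> 1"
    and B: "\<And>z. z \<in> {0..2} \<Longrightarrow> \<bar>\<gamma> z\<bar> \<le> B" and r: "\<epsilon> < r" and \<eta>: "0 < \<eta>"
  shows "\<bar>cint (uc j) \<alpha> \<gamma> r - (LBINT \<theta>:{0..2*pi}. \<alpha> \<theta>) * (LBINT z:{0..2}. ubar z $ j * \<gamma> z)\<bar>
    \<le> B * (4 * pi * \<eta> + (LBINT \<theta>:{0..2*pi}. LBINT z:{0..2}. (norm (u (cyl r \<theta> z) - ubar z))\<^sup>2) / (4 * \<eta>))"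
proof -
  define v where "v \<theta> z = u (cyl r \<theta> z)" for \<theta> z
  define E where "E \<theta> = (LBINT z:{0..2}. (norm (v \<theta> z - ubar z))\<^sup>2)" for \<theta>
  define I where "I \<theta> = (LBINT z:{0..2}. v \<theta> z $ j * \<gamma> z)" for \<theta>
  define c where "c = (LBINT z:{0..2}. ubar z $ j * \<gamma> z)"
  have B0: "0 \<le> B" using B[of 0] by force
  have u_cont: "continuous_on \<Omega> u" using u_C2 by (auto simp: C2_on_def intro: C1_on_imp_continuous_on)
  have vc: "continuous_on A (\<lambda>p. v (fst p) (snd p))" for A unfolding v_def by (rule cyl_cont[OF r u_cont])
  have vz: "continuous_on A (\<lambda>z. v \<theta> z)" for A \<theta>
    using continuous_on_compose2[OF vc[of UNIV], of A "\<lambda>z. (\<theta>, z)"] continuous_on_Pair_right by auto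
  have ubm[measurable]: "ubar \<in> borel_measurable borel" using ub by (simp add: L2_T_def)
  have sq: "set_integrable lborel {0..2} (\<lambda>z. (norm (ubar z))\<^sup>2)" using ub by (simp add: L2_T_def)
  have cst: "set_integrable lborel {a..b::real} (\<lambda>z. k::real)" for k a b by (intro borel_integrable_atLeastAtMost' continuous_intros)
  have "bounded ((\<lambda>p. v (fst p) (snd p)) ` cbox (0, 0) (2*pi, 2))"
    by (intro compact_imp_bounded compact_continuous_image vc compact_cbox)
  then obtain U where "\<And>p. p \<in> cbox (0, 0) (2*pi, 2) \<Longrightarrow> norm (v (fst p) (snd p)) \<le> U" by (auto simp: bounded_iff)
  then have U: "norm (v \<theta> z) \<le> U" if "\<theta> \<in> {0..2*pi}" "z \<in> {0..2}" for \<theta> z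
    using that by (metis atLeastAtMost_iff cbox_Pair_iff fst_conv interval_cbox snd_conv)
  have vm[measurable]: "(\<lambda>z. v \<theta> z) \<in> borel_measurable borel" for \<theta> by (intro borel_measurable_continuous_onI vz)
  have le2: "(norm (x - y))\<^sup>2 \<le> 2 * (norm x)\<^sup>2 + 2 * (norm y)\<^sup>2" for x y :: "real^3"
  proof -
    have "(norm (x - y))\<^sup>2 \<le> (norm x + norm y)\<^sup>2" by (intro power_mono norm_triangle_ineq4) auto
    also have "\<dots> \<le> 2 * (norm x)\<^sup>2 + 2 * (norm y)\<^sup>2"
      using zero_le_power2[of "norm x - norm y"] by (simp add: power2_eq_square algebra_simps)
    finally show ?thesis .
  qed
  have dom: "set_integrable lborel {0..2} (\<lambda>z. 2 * U\<^sup>2 + 2 * (norm (ubar z))\<^sup>2)"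
    by (intro set_integral_add(1) set_integrable_mult_right sq cst)
  have hle: "(norm (v \<theta> z - ubar z))\<^sup>2 \<le> 2 * U\<^sup>2 + 2 * (norm (ubar z))\<^sup>2" if "\<theta> \<in> {0..2*pi}" "z \<in> {0..2}" for \<theta> z
    using le2[of "v \<theta> z" "ubar z"] power_mono[OF U[OF that], of 2] by simp
  have hi: "set_integrable lborel {0..2} (\<lambda>z. (norm (v \<theta> z - ubar z))\<^sup>2)" if "\<theta> \<in> {0..2*pi}" for \<theta>
    by (rule set_integrable_dominated[OF dom]) (use hle[OF that] in auto)
  \<comment> \<open>The datum is only measurable, so continuity gives nothing for \<open>E\<close>;
    its measurability comes from joint measurability of the integrand.\<close>
  have Em: "E \<in> borel_measurable borel"
  proof -
    have "(\<lambda>p. v (fst p) (snd p)) \<in> borel_measurable (borel \<Otimes>\<^sub>M borel)"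
      unfolding borel_prod by (intro borel_measurable_continuous_onI vc)
    then have [measurable]: "(\<lambda>p. v (fst p) (snd p)) \<in> borel_measurable (borel \<Otimes>\<^sub>M lborel)"
      by (subst measurable_cong_sets[OF sets_pair_measure_cong[OF refl sets_lborel] refl])
    have "(\<lambda>\<theta>. \<integral>z. indicator {0..2} z *\<^sub>R (norm (v \<theta> z - ubar z))\<^sup>2 \<partial>lborel) \<in> borel_measurable borel"
    proof (rule lborel.borel_measurable_lebesgue_integral)
      have "(\<lambda>p. indicator {0..2} (snd p) *\<^sub>R (norm (v (fst p) (snd p) - ubar (snd p)))\<^sup>2) \<in> borel_measurable (borel \<Otimes>\<^sub>M lborel)"
        by measurable
      then show "(\<lambda>(\<theta>, z). indicator {0..2} z *\<^sub>R (norm (v \<theta> z - ubar z))\<^sup>2) \<in> borel_measurable (borel \<Otimes>\<^sub>M lborel)"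
        by (simp add: case_prod_unfold)
    qed
    then show ?thesis by (simp add: E_def[abs_def] set_lebesgue_integral_def)
  qed
  have E0: "0 \<le> E \<theta>" for \<theta> unfolding E_def set_lebesgue_integral_def by (intro integral_nonneg_AE) auto
  have Ei: "set_integrable lborel {0..2*pi} E"
  proof (rule set_integrable_dominated[OF cst[of 0 "2*pi" "LBINT z:{0..2}. 2 * U\<^sup>2 + 2 * (norm (ubar z))\<^sup>2"] Em])
    fix \<theta> assume "\<theta> \<in> {0..2*pi}"
    then show "norm (E \<theta>) \<le> (LBINT z:{0..2}. 2 * U\<^sup>2 + 2 * (norm (ubar z))\<^sup>2)"
      using E0[of \<theta>] unfolding E_def by (auto intro!: set_integral_mono hi dom hle)
  qed auto
  have vi: "set_integrable lborel {0..2} (\<lambda>z. v \<theta> z $ j * \<gamma> z)" for \<theta>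
    by (intro borel_integrable_atLeastAtMost' continuous_intros vz continuous_on_subset[OF a(2)]) auto
  have ui: "set_integrable lborel {0..2} (\<lambda>z. ubar z $ j * \<gamma> z)" by (rule L2_T_component_integrable[OF ub a(2)])
  have Ic: "\<bar>I \<theta> - c\<bar> \<le> B * (2 * \<eta> + E \<theta> / (4 * \<eta>))" if \<theta>: "\<theta> \<in> {0..2*pi}" for \<theta>
  proof -
    have s: "I \<theta> - c = (LBINT z:{0..2}. v \<theta> z $ j * \<gamma> z - ubar z $ j * \<gamma> z)"
      unfolding I_def c_def by (rule set_integral_diff(2)[OF vi ui, symmetric])
    have i1: "set_integrable lborel {0..2} (\<lambda>z. (1 / (4 * \<eta>)) * (norm (v \<theta> z - ubar z))\<^sup>2)"
      by (intro set_integrable_mult_right hi \<theta>)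
    have dI: "set_integrable lborel {0..2} (\<lambda>z. B * (\<eta> + (1 / (4 * \<eta>)) * (norm (v \<theta> z - ubar z))\<^sup>2))"
      by (intro set_integrable_mult_right set_integral_add(1) cst hi \<theta>)
    have pt: "\<bar>v \<theta> z $ j * \<gamma> z - ubar z $ j * \<gamma> z\<bar> \<le> B * (\<eta> + (1 / (4 * \<eta>)) * (norm (v \<theta> z - ubar z))\<^sup>2)" if z: "z \<in> {0..2}" for z
    proof -
      have "\<bar>(v \<theta> z - ubar z) $ j\<bar> \<le> \<eta> + (1 / (4 * \<eta>)) * (norm (v \<theta> z - ubar z))\<^sup>2"
        using component_le_norm_cart[of "v \<theta> z - ubar z" j] abs_le_young[OF \<eta>, of "norm (v \<theta> z - ubar z)"] by simp
      then have "\<bar>\<gamma> z\<bar> * \<bar>(v \<theta> z - ubar z) $ j\<bar> \<le> B * (\<eta> + (1 / (4 * \<eta>)) * (norm (v \<theta> z - ubar z))\<^sup>2)"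
        using B[OF z] B0 by (intro mult_mono) auto
      then show ?thesis by (simp add: abs_mult[symmetric] algebra_simps)
    qed
    have di: "set_integrable lborel {0..2} (\<lambda>z. v \<theta> z $ j * \<gamma> z - ubar z $ j * \<gamma> z)" by (intro set_integral_diff(1) vi ui)
    have "\<bar>I \<theta> - c\<bar> \<le> (LBINT z:{0..2}. \<bar>v \<theta> z $ j * \<gamma> z - ubar z $ j * \<gamma> z\<bar>)"
      unfolding s using set_integral_norm_bound[OF di] by simp
    also have "\<dots> \<le> (LBINT z:{0..2}. B * (\<eta> + (1 / (4 * \<eta>)) * (norm (v \<theta> z - ubar z))\<^sup>2))"
      by (intro set_integral_mono dI pt set_integrable_abs di)
    also have "\<dots> = B * (2 * \<eta> + E \<theta> / (4 * \<eta>))"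
      using set_integral_add(2)[OF cst[of 0 2 \<eta>] i1] by (simp add: E_def) (simp add: set_lebesgue_integral_def)
    finally show ?thesis .
  qed
  have \<alpha>i: "set_integrable lborel {0..2*pi} \<alpha>"
    by (intro borel_integrable_atLeastAtMost' continuous_on_subset[OF a(1)]) auto
  have I_cont: "continuous_on {0..2*pi} I"
    unfolding I_def v_def by (rule cint_iterated(1)[OF uc_cont(1) a r])
  have \<alpha>Ii: "set_integrable lborel {0..2*pi} (\<lambda>\<theta>. \<alpha> \<theta> * I \<theta>)"
    by (intro borel_integrable_atLeastAtMost' continuous_intros I_cont continuous_on_subset[OF a(1)]) auto
  have "cint (uc j) \<alpha> \<gamma> r - (LBINT \<theta>:{0..2*pi}. \<alpha> \<theta>) * c = (LBINT \<theta>:{0..2*pi}. \<alpha> \<theta> * I \<theta> - \<alpha> \<theta> * c)"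
    unfolding cint_iterated(2)[OF uc_cont(1) a r] I_def v_def
    by (subst set_integral_diff(2)) (auto intro!: \<alpha>Ii[unfolded I_def v_def] \<alpha>i)
  also have "\<bar>\<dots>\<bar> \<le> (LBINT \<theta>:{0..2*pi}. \<bar>\<alpha> \<theta> * I \<theta> - \<alpha> \<theta> * c\<bar>)"
    using set_integral_norm_bound[OF set_integral_diff(1)[OF \<alpha>Ii]] \<alpha>i by (simp add: set_integrable_mult_left)
  also have "\<dots> \<le> (LBINT \<theta>:{0..2*pi}. B * (2 * \<eta> + (1 / (4 * \<eta>)) * E \<theta>))"
  proof (rule set_integral_mono)
    show "set_integrable lborel {0..2*pi} (\<lambda>\<theta>. \<bar>\<alpha> \<theta> * I \<theta> - \<alpha> \<theta> * c\<bar>)"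
      using \<alpha>Ii \<alpha>i by (intro set_integrable_abs set_integral_diff(1)) auto
    show "set_integrable lborel {0..2*pi} (\<lambda>\<theta>. B * (2 * \<eta> + (1 / (4 * \<eta>)) * E \<theta>))"
      by (intro set_integrable_mult_right set_integral_add(1) cst Ei)
    fix \<theta> assume \<theta>: "\<theta> \<in> {0..2*pi}"
    have "\<bar>\<alpha> \<theta>\<bar> * \<bar>I \<theta> - c\<bar> \<le> 1 * (B * (2 * \<eta> + (1 / (4 * \<eta>)) * E \<theta>))"
      using Ic[OF \<theta>] bd by (intro mult_mono) auto
    then show "\<bar>\<alpha> \<theta> * I \<theta> - \<alpha> \<theta> * c\<bar> \<le> B * (2 * \<eta> + (1 / (4 * \<eta>)) * E \<theta>)"
      by (simp add: right_diff_distrib[symmetric] abs_mult)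
  qed
  also have "\<dots> = B * ((LBINT \<theta>:{0..2*pi}. 2 * \<eta>) + (1 / (4 * \<eta>)) * (LBINT \<theta>:{0..2*pi}. E \<theta>))"
    using set_integral_add(2)[OF cst[of 0 "2*pi" "2 * \<eta>"] set_integrable_mult_right[of "1 / (4 * \<eta>)", OF Ei]] by simp
  also have "(LBINT \<theta>:{0..2*pi}. 2 * \<eta>) = 4 * pi * \<eta>"
    by (simp add: set_lebesgue_integral_def)
  finally show ?thesis by (simp add: E_def v_def c_def)
qed

lemma trace_limit:
  assumes ub: "L2_T ubar" and a: "continuous_on UNIV \<alpha>" "continuous_on UNIV \<gamma>" and bd: "\<And>\<theta>. \<bar>\<alpha> \<theta>\<bar> \<le> 1"
  shows "(cint (uc j) \<alpha> \<gamma> \<longlongrightarrow> (LBINT \<theta>:{0..2*pi}. \<alpha> \<theta>) * (LBINT z:{0..2}. ubar z $ j * \<gamma> z)) (at_right \<epsilon>)"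
proof (rule tendstoI)
  fix e :: real assume e: "0 < e"
  have "bounded (\<gamma> ` {0..2})" by (intro compact_imp_bounded compact_continuous_image continuous_on_subset[OF a(2)]) auto
  then obtain B' where "\<forall>z\<in>{0..2}. \<bar>\<gamma> z\<bar> \<le> B'" by (auto simp: bounded_iff)
  then have B': "\<And>z. z \<in> {0..2} \<Longrightarrow> \<bar>\<gamma> z\<bar> \<le> B'" by blast
  define B where "B = max B' 1"
  have B: "0 < B" "\<And>z. z \<in> {0..2} \<Longrightarrow> \<bar>\<gamma> z\<bar> \<le> B" using B' by (force simp: B_def)+
  \<comment> \<open>The two terms of \<open>trace_error\<close> are at most \<open>e / 4\<close>
    each once the L2 error is below \<open>\<eta> * e / B\<close>.\<close>
  define \<eta> where "\<eta> = e / (16 * pi * B)"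
  have \<eta>: "0 < \<eta>" using e B by (simp add: \<eta>_def)
  define D where "D r = (LBINT \<theta>:{0..2*pi}. LBINT z:{0..2}. (norm (u (cyl r \<theta> z) - ubar z))\<^sup>2)" for r
  have "0 < \<eta> * e / B" using \<eta> e B by simp
  then have "\<forall>\<^sub>F r in at_right \<epsilon>. D r < \<eta> * e / B" using order_tendstoD(2)[OF trace] by (simp add: D_def)
  moreover have "\<forall>\<^sub>F r in at_right \<epsilon>. \<epsilon> < r" by (simp add: eventually_at_right_less)
  ultimately show "\<forall>\<^sub>F r in at_right \<epsilon>. dist (cint (uc j) \<alpha> \<gamma> r) ((LBINT \<theta>:{0..2*pi}. \<alpha> \<theta>) * (LBINT z:{0..2}. ubar z $ j * \<gamma> z)) < e"
  proof eventually_elim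
    fix r assume D: "D r < \<eta> * e / B" and r: "\<epsilon> < r"
    have "dist (cint (uc j) \<alpha> \<gamma> r) ((LBINT \<theta>:{0..2*pi}. \<alpha> \<theta>) * (LBINT z:{0..2}. ubar z $ j * \<gamma> z))
      \<le> B * (4 * pi * \<eta> + D r / (4 * \<eta>))"
      unfolding dist_real_def D_def by (rule trace_error[OF ub a bd B(2) r \<eta>])
    also have "\<dots> \<le> B * (4 * pi * \<eta> + (\<eta> * e / B) / (4 * \<eta>))"
      using B D \<eta> by (intro mult_left_mono add_left_mono divide_right_mono) auto
    also have "\<dots> = e / 2" using B \<eta> by (simp add: \<eta>_def field_simps)
    finally show "dist (cint (uc j) \<alpha> \<gamma> r) ((LBINT \<theta>:{0..2*pi}. \<alpha> \<theta>) * (LBINT z:{0..2}. ubar z $ j * \<gamma> z)) < e" using e by simp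
  qed
qed

text \<open>The two parts of the total force against the weight \<open>\<gamma>\<close>, up to the factor \<open>- \<epsilon>\<close>.\<close>

definition transposed where
  "transposed j \<gamma> r = cint (partial_deriv j (uc 1)) cos \<gamma> r + cint (partial_deriv j (uc 2)) sin \<gamma> r"

text \<open>\<open>cyl 1 \<theta> 0\<close> is the outward radial unit vector, so its components
  \<open>cos \<theta>\<close>, \<open>sin \<theta>\<close>, 0 treat the three directions in one
  formula. This is the part of the force that \<open>traction\<close> measures.\<close>

definition pseudo where
  "pseudo j \<gamma> r = cint (partial_deriv 1 (uc j)) cos \<gamma> r + cint (partial_deriv 2 (uc j)) sin \<gamma> r
     - cint p (\<lambda>\<theta>. cyl 1 \<theta> 0 $ j) \<gamma> r"

lemma integral_cos_sin_zero: "(LBINT \<theta>:{0..2*pi}. cos \<theta>) = 0" "(LBINT \<theta>:{0..2*pi}. sin \<theta>) = 0"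
proof -
  have c: "continuous_on {0..2*pi} (cos :: real \<Rightarrow> real)" "continuous_on {0..2*pi} (sin :: real \<Rightarrow> real)"
    by (intro continuous_on_cos continuous_on_sin continuous_on_id)+
  have "integral {0..2*pi} (cos :: real \<Rightarrow> real) = 0"
    by (rule integral_periodic_deriv_zero[of _ _ sin]) (auto intro!: derivative_eq_intros)
  then show "(LBINT \<theta>:{0..2*pi}. cos \<theta>) = 0"
    using set_borel_integral_eq_integral(2)[OF borel_integrable_atLeastAtMost'[OF c(1)]] by simp
  have "integral {0..2*pi} (sin :: real \<Rightarrow> real) = 0"
    by (rule integral_periodic_deriv_zero[of _ _ "\<lambda>x. - cos x"]) (auto intro!: derivative_eq_intros)
  then show "(LBINT \<theta>:{0..2*pi}. sin \<theta>) = 0"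
    using set_borel_integral_eq_integral(2)[OF borel_integrable_atLeastAtMost'[OF c(2)]] by simp
qed

text \<open>By incompressibility \<open>\<partial>\<^sub>1 u\<^sub>1 cos \<theta> + \<partial>\<^sub>1 u\<^sub>2 sin \<theta>\<close> is an angular derivative minus \<open>\<partial>\<^sub>3 u\<^sub>3 cos \<theta>\<close>, so after
  integration by parts no derivative of \<open>u\<close> remains.\<close>

lemma transposed_tendsto_0:
  assumes ub: "L2_T ubar" and \<gamma>: "\<And>z. (\<gamma> has_real_derivative \<gamma>' z) (at z)" and \<gamma>': "continuous_on UNIV \<gamma>'" and per: "\<gamma> 2 = \<gamma> 0"
  shows "(transposed j \<gamma> \<longlongrightarrow> 0) (at_right \<epsilon>)"
proof -
  have \<gamma>c: "continuous_on UNIV \<gamma>" by (rule continuous_on_deriv_UNIV[OF \<gamma>])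
  have cs: "continuous_on UNIV (cos :: real \<Rightarrow> real)" "continuous_on UNIV (sin :: real \<Rightarrow> real)" by (intro continuous_intros)+
  have ax: "cint (partial_deriv 3 (uc i)) \<alpha> \<gamma> r = - cint (uc i) \<alpha> \<gamma>' r" if "continuous_on UNIV \<alpha>" "\<epsilon> < r" for i \<alpha> r
    by (rule cint_axial_parts[OF eps uc_C1(1) uc_per that(1) \<gamma> \<gamma>' per that(2)])
  have ang: "cint (partial_deriv 2 (uc i)) cos \<gamma> r = cint (partial_deriv 1 (uc i)) sin \<gamma> r" if "\<epsilon> < r" for i r
    using cint_angular_parts[OF eps uc_C1(1) DERIV_const[of 1] continuous_on_const _ \<gamma>c that, of i] by (simp add: cint_def)
  \<comment> \<open>The datum is independent of \<open>\<theta>\<close>, and \<open>cos\<close> and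
    \<open>sin\<close> have mean zero.\<close>
  have t: "((\<lambda>r. cint (uc i) cos \<gamma>' r) \<longlongrightarrow> 0) (at_right \<epsilon>)" "((\<lambda>r. cint (uc i) sin \<gamma>' r) \<longlongrightarrow> 0) (at_right \<epsilon>)" for i
    using trace_limit[OF ub cs(1) \<gamma>', of i] trace_limit[OF ub cs(2) \<gamma>', of i] by (simp_all add: integral_cos_sin_zero)
  \<comment> \<open>For \<open>j = 3\<close> the axial integration by parts alone removes the
    derivatives; for \<open>j = 1\<close> and \<open>j = 2\<close> incompressibility and
    \<open>ang\<close> reduce to the axial derivative of \<open>u\<^sub>3\<close>.\<close>
  define s where "s r = (if j = 1 then cint (uc 3) cos \<gamma>' r else if j = 2 then cint (uc 3) sin \<gamma>' r
     else - cint (uc 1) cos \<gamma>' r - cint (uc 2) sin \<gamma>' r)" for r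
  have "(s \<longlongrightarrow> 0) (at_right \<epsilon>)"
    using t tendsto_diff[OF tendsto_minus[OF t(1)[of 1]] t(2)[of 2]]
    by (cases "j = 1"; cases "j = 2") (simp_all add: s_def[abs_def])
  moreover have "\<forall>\<^sub>F r in at_right \<epsilon>. s r = transposed j \<gamma> r"
  proof (rule eventually_mono[OF eventually_at_right_less])
    fix r assume r: "\<epsilon> < r"
    have "j = 1 \<or> j = 2 \<or> j = 3" by (rule exhaust_3)
    then show "s r = transposed j \<gamma> r"
      using cint_incompressible[OF cs(1) \<gamma>c r] cint_incompressible[OF cs(2) \<gamma>c r] ang[OF r, of 1] ang[OF r, of 2]
        ax[OF cs(1) r] ax[OF cs(2) r]
      by (auto simp: s_def transposed_def)
  qed
  ultimately show ?thesis using Lim_transform_eventually by blast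
qed

text \<open>The inward normal gives the minus sign. The prefactor is \<open>\<epsilon>\<close> and
  not \<open>r\<close>, since \<open>angular_force\<close> keeps the weight of the limiting circle;
  the rest is an exchange of integrals of continuous functions.\<close>

lemma force_component:
  assumes \<phi>: "continuous_on UNIV \<phi>" and r: "\<epsilon> < r"
  shows "(LBINT z:{0..2}. \<phi> z *\<^sub>R angular_force \<epsilon> u p r z) $ j = - \<epsilon> * (pseudo j \<phi> r + transposed j \<phi> r)"
proof -
  have C1u: "C1_on \<Omega> u" using u_C2 by (simp add: C2_on_def)
  define h where "h j \<theta> z = partial_deriv 1 (uc j) (cyl r \<theta> z) * cos \<theta> + partial_deriv 2 (uc j) (cyl r \<theta> z) * sin \<theta>
     - p (cyl r \<theta> z) * cyl 1 \<theta> 0 $ j + (partial_deriv j (uc 1) (cyl r \<theta> z) * cos \<theta> + partial_deriv j (uc 2) (cyl r \<theta> z) * sin \<theta>)" for j \<theta> z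
  have S: "stress u p (cyl r \<theta> z) *v inward_normal \<theta> = (\<chi> j. - h j \<theta> z)" for \<theta> z
  proof -
    have x: "cyl r \<theta> z \<in> \<Omega>" using r eps by (intro cyl_in_exterior)
    have fr: "frechet_derivative (uc i) (at (cyl r \<theta> z)) (axis k 1) = frechet_derivative u (at (cyl r \<theta> z)) (axis k 1) $ i" for i k
      using C1_on_component(1)[OF C1u x] by (simp add: partial_deriv_def)
    show ?thesis
      by (simp add: fr vec_eq_iff forall_3 h_def stress_def matrix_vector_mult_def sum_3 inward_normal_def
          vector_3 jacobian_def matrix_def transpose_def mat_def partial_deriv_def algebra_simps)
  qed
  have cc: "continuous_on A (\<lambda>q. cyl 1 (fst q) 0 $ j)" for A :: "(real \<times> real) set" and j by (intro continuous_intros)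
  have hc: "continuous_on A (\<lambda>q. h j (fst q) (snd q))" for A j
    unfolding h_def by (intro continuous_intros cyl_cont[OF r] uc_cont cc)
  have hq: "continuous_on A (\<lambda>x. h j (f x) (g x))" if "continuous_on A f" "continuous_on A g" for A :: "real set" and f g j
    using continuous_on_compose2[OF hc[of UNIV], of A "\<lambda>x. (f x, g x)"] that by (auto intro!: continuous_intros)
  have cc1: "continuous_on UNIV (\<lambda>\<theta>::real. cyl 1 \<theta> 0 $ j)" for j by (intro continuous_intros)
  have Sc: "continuous_on A (\<lambda>\<theta>. \<epsilon> *\<^sub>R (\<chi> j. - h j \<theta> z))" for A z
    by (intro continuous_intros continuous_on_vec_lambda hq)
  have af: "angular_force \<epsilon> u p r z = integral {0..2*pi} (\<lambda>\<theta>. \<epsilon> *\<^sub>R (\<chi> j. - h j \<theta> z))" for z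
    unfolding angular_force_def S by (intro set_borel_integral_eq_integral(2) borel_integrable_atLeastAtMost' Sc)
  have afc: "continuous_on UNIV (angular_force \<epsilon> u p r)"
  proof -
    have "continuous_on (UNIV \<times> cbox 0 (2*pi)) (\<lambda>q. \<epsilon> *\<^sub>R (\<chi> j. - h j (snd q) (fst q)))"
    proof (intro continuous_intros continuous_on_vec_lambda)
      fix j show "continuous_on (UNIV \<times> cbox 0 (2*pi)) (\<lambda>q. h j (snd q) (fst q))"
        using continuous_on_compose2[OF hc[of UNIV j], of "UNIV \<times> cbox 0 (2*pi)" "\<lambda>q. (snd q, fst q)"]
          continuous_on_swap[of "UNIV \<times> cbox 0 (2*pi)"] by (simp add: prod.swap_def)
    qed
    then show ?thesis
      unfolding af[abs_def] using integral_continuous_on_param[of UNIV 0 "2*pi" "\<lambda>z \<theta>. \<epsilon> *\<^sub>R (\<chi> j. - h j \<theta> z)"]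
      by (simp add: case_prod_unfold)
  qed
  have afj: "angular_force \<epsilon> u p r z $ j = - \<epsilon> * integral {0..2*pi} (\<lambda>\<theta>. h j \<theta> z)" for z
    unfolding af by (subst integral_component_eq_cart[symmetric]) (auto intro!: integrable_continuous_real Sc)
  have vc: "continuous_on {0..2} (\<lambda>z. \<phi> z *\<^sub>R angular_force \<epsilon> u p r z)"
    by (intro continuous_intros continuous_on_subset[OF \<phi>] continuous_on_subset[OF afc]) auto
  have "(LBINT z:{0..2}. \<phi> z *\<^sub>R angular_force \<epsilon> u p r z) $ j = integral {0..2} (\<lambda>z. (\<phi> z *\<^sub>R angular_force \<epsilon> u p r z) $ j)"
    using integral_component_eq_cart[OF integrable_continuous_real[OF vc]]
    by (simp add: set_borel_integral_eq_integral(2)[OF borel_integrable_atLeastAtMost'[OF vc]])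
  also have "\<dots> = - \<epsilon> * integral {0..2} (\<lambda>z. integral {0..2*pi} (\<lambda>\<theta>. h j \<theta> z * \<phi> z))"
  proof -
    have "(\<phi> z *\<^sub>R angular_force \<epsilon> u p r z) $ j = - \<epsilon> * integral {0..2*pi} (\<lambda>\<theta>. h j \<theta> z * \<phi> z)" for z
      using integral_mult_left[of "{0..2*pi}" "\<lambda>\<theta>. h j \<theta> z" "\<phi> z"] by (simp add: afj)
    then show ?thesis by simp
  qed
  also have "integral {0..2} (\<lambda>z. integral {0..2*pi} (\<lambda>\<theta>. h j \<theta> z * \<phi> z)) =
    integral {0..2*pi} (\<lambda>\<theta>. integral {0..2} (\<lambda>z. h j \<theta> z * \<phi> z))"
  proof -
    have "continuous_on (cbox (0, 0) (2*pi, 2)) (\<lambda>q. h j (fst q) (snd q) * \<phi> (snd q))"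
      by (intro continuous_intros hc continuous_on_compose2[OF \<phi>]) auto
    then show ?thesis using integral_swap_continuous[of 0 0 "2*pi" 2 "\<lambda>\<theta> z. h j \<theta> z * \<phi> z"] by (simp add: case_prod_unfold)
  qed
  also have "\<dots> = integral (cbox (0, 0) (2*pi, 2)) (\<lambda>q. h j (fst q) (snd q) * \<phi> (snd q))"
  proof -
    have "continuous_on (cbox (0, 0) (2*pi, 2)) (\<lambda>q. h j (fst q) (snd q) * \<phi> (snd q))"
      by (intro continuous_intros hc continuous_on_compose2[OF \<phi>]) auto
    from integral_prod_continuous[OF this] show ?thesis by simp
  qed
  also have "\<dots> = pseudo j \<phi> r + transposed j \<phi> r"
  proof -
    have cs: "continuous_on UNIV (cos :: real \<Rightarrow> real)" "continuous_on UNIV (sin :: real \<Rightarrow> real)" by (intro continuous_intros)+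
    note i = cint_integrable[OF eps uc_cont(2)[of 1 j] cs(1) \<phi> r] cint_integrable[OF eps uc_cont(2)[of 2 j] cs(2) \<phi> r]
      cint_integrable[OF eps uc_cont(4) cc1[of j] \<phi> r] cint_integrable[OF eps uc_cont(2)[of j 1] cs(1) \<phi> r]
      cint_integrable[OF eps uc_cont(2)[of j 2] cs(2) \<phi> r]
    show ?thesis
      unfolding pseudo_def transposed_def cint_def
        integral_add[OF i(1,2), symmetric] integral_add[OF i(4,5), symmetric]
        integral_diff[OF integrable_add[OF i(1,2)] i(3), symmetric]
        integral_add[OF integrable_diff[OF integrable_add[OF i(1,2)] i(3)] integrable_add[OF i(4,5)], symmetric]
      by (intro integral_cong) (simp add: h_def algebra_simps)
  qed
  finally show ?thesis .
qed

end

section \<open>Estimates for single modes\<close>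

lemma integral_cos_mode_zero:
  assumes n: "n \<in> \<int>" "n \<noteq> 0"
  shows "(LBINT \<theta>:{0..2*pi}. cos (n * \<theta> - b)) = 0"
proof -
  obtain k where k: "n = of_int k" using n by (auto elim: Ints_cases)
  then have e: "n * (2 * pi) = 2 * pi * of_int k" by simp
  have "integral {0..2*pi} (\<lambda>\<theta>. cos (n * \<theta> - b)) = 0"
  proof (rule integral_periodic_deriv_zero[of _ _ "\<lambda>\<theta>. sin (n * \<theta> - b) / n"])
    show "((\<lambda>\<theta>. sin (n * \<theta> - b) / n) has_real_derivative cos (n * x - b)) (at x)" for x
      using n by (auto intro!: derivative_eq_intros)
    show "sin (n * (2 * pi) - b) / n = sin (n * 0 - b) / n"
      by (simp only: e sin_diff cos_int_2pin sin_int_2pin) simp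
  qed auto
  moreover have "continuous_on {0..2*pi} (\<lambda>\<theta>. cos (n * \<theta> - b))" by (intro continuous_intros)
  from set_borel_integral_eq_integral(2)[OF borel_integrable_atLeastAtMost'[OF this]]
  have "(LBINT \<theta>:{0..2*pi}. cos (n * \<theta> - b)) = integral {0..2*pi} (\<lambda>\<theta>. cos (n * \<theta> - b))" .
  ultimately show ?thesis by simp
qed

context stokes_flow
begin

lemma cmode_trace_zero:
  assumes ub: "L2_T ubar" and "continuous_on UNIV \<gamma>" "n \<in> \<int>" "n \<noteq> 0"
  shows "(cmode (uc j) n b \<gamma> \<longlongrightarrow> 0) (at_right \<epsilon>)"
  using trace_limit[OF ub _ assms(2), of "\<lambda>\<theta>. cos (n * \<theta> - b)" j] integral_cos_mode_zero[OF assms(3,4), of b]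
  by (simp add: cmode_def continuous_intros)

lemma cint_one_trace:
  assumes ub: "L2_T ubar" and "continuous_on UNIV \<gamma>"
  shows "(cint (uc j) (\<lambda>_. 1) \<gamma> \<longlongrightarrow> 2 * pi * (LBINT z:{0..2}. ubar z $ j * \<gamma> z)) (at_right \<epsilon>)"
proof -
  have "(LBINT \<theta>:{0..2*pi}. 1) = 2 * pi" by (simp add: set_lebesgue_integral_def)
  then show ?thesis using trace_limit[OF ub continuous_on_const assms(2), of 1 j] by simp
qed

lemma cint_one_deriv:
  assumes "continuous_on UNIV \<gamma>" "\<epsilon> < r"
  shows "(cint (uc j) (\<lambda>_. 1) \<gamma> has_real_derivative
    cint (partial_deriv 1 (uc j)) cos \<gamma> r + cint (partial_deriv 2 (uc j)) sin \<gamma> r) (at r)"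
  using cint_deriv[OF eps uc_C1(1) continuous_on_const[of UNIV 1] assms, of j] by simp

text \<open>For \<open>m = 1\<close> the component \<open>Um\<close> has angular order zero; the
  phases \<open>b = 0\<close> and \<open>b = pi / 2\<close> make it the plain angular integral of
  \<open>u\<^sub>1\<close> and of \<open>u\<^sub>2\<close>. Its radial derivative minus the pressure
  coefficient is \<open>pseudo j\<close>, so \<open>pseudo j\<close> is \<open>2 / r\<close> times
  the traction, and its boundary value is \<open>2 * pi * c\<close>.\<close>

lemma pseudo_transverse:
  fixes a b \<kappa> :: real and k :: nat and j :: 3
  assumes ub: "L2_T ubar" and e1: "\<epsilon> < 1" and \<kappa>: "\<kappa> = pi * real k" and j: "j = 1 \<and> b = 0 \<or> j = 2 \<and> b = pi / 2"
  defines "\<gamma> \<equiv> \<lambda>z. cos (\<kappa> * z - a)"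
  defines "c \<equiv> LBINT z:{0..2}. ubar z $ j * \<gamma> z"
  obtains q where "(pseudo j \<gamma> \<longlongrightarrow> q) (at_right \<epsilon>)" "\<epsilon> * \<bar>q\<bar> \<le> 400 * pi * \<kappa> / ln (1 / \<epsilon>) * \<bar>c\<bar>"
    "\<And>\<rho>. \<epsilon> < \<rho> \<Longrightarrow> \<rho> < 1 \<Longrightarrow> \<rho> * \<bar>pseudo j \<gamma> \<rho>\<bar> \<le> 400 * pi * \<kappa> / ln (1 / \<rho>) * \<bar>c\<bar>"
proof -
  define \<gamma>s where "\<gamma>s z = sin (\<kappa> * z - a)" for z
  have \<kappa>2: "\<kappa> * 2 = 2 * pi * real k" by (simp add: \<kappa>)
  have cont: "continuous_on UNIV \<gamma>" "continuous_on UNIV \<gamma>s" unfolding \<gamma>_def \<gamma>s_def by (intro continuous_intros)+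
  let ?Up = "\<lambda>r. cmode (uc 1) (1+1) b \<gamma> r + cmode (uc 2) (1+1) (b + pi/2) \<gamma> r"
  let ?Um = "\<lambda>r. cmode (uc 1) (1-1) b \<gamma> r - cmode (uc 2) (1-1) (b + pi/2) \<gamma> r"
  let ?Um1 = "\<lambda>r. cmode1 (uc 1) (1-1) b \<gamma> r - cmode1 (uc 2) (1-1) (b + pi/2) \<gamma> r"
  let ?W = "cmode (uc 3) 1 b \<gamma>s" and ?W1 = "cmode1 (uc 3) 1 b \<gamma>s" and ?P = "cmode p 1 b \<gamma>"
  have R: "radial_stokes \<epsilon> \<kappa> 1 ?Up (\<lambda>r. cmode1 (uc 1) (1+1) b \<gamma> r + cmode1 (uc 2) (1+1) (b + pi/2) \<gamma> r)
     (\<lambda>r. cmode2 (uc 1) (1+1) b \<gamma> r + cmode2 (uc 2) (1+1) (b + pi/2) \<gamma> r)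
     ?Um ?Um1 (\<lambda>r. cmode2 (uc 1) (1-1) b \<gamma> r - cmode2 (uc 2) (1-1) (b + pi/2) \<gamma> r)
     ?W ?W1 (cmode2 (uc 3) 1 b \<gamma>s) ?P (cmode1 p 1 b \<gamma>)"
  proof (rule radial_system)
    show "(\<gamma> has_real_derivative - \<kappa> * \<gamma>s z) (at z)" "(\<gamma>s has_real_derivative \<kappa> * \<gamma> z) (at z)" for z
      unfolding \<gamma>_def \<gamma>s_def by (auto intro!: derivative_eq_intros)
    show "\<gamma> 2 = \<gamma> 0" "\<gamma>s 2 = \<gamma>s 0"
      unfolding \<gamma>_def \<gamma>s_def \<kappa>2 using cos_int_2pin[of "int k"] sin_int_2pin[of "int k"] by (simp_all add: cos_diff sin_diff)
  qed (auto simp: \<kappa> \<gamma>_def \<gamma>s_def)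
  interpret R: radial_stokes \<epsilon> \<kappa> 1 ?Up "\<lambda>r. cmode1 (uc 1) (1+1) b \<gamma> r + cmode1 (uc 2) (1+1) (b + pi/2) \<gamma> r"
     "\<lambda>r. cmode2 (uc 1) (1+1) b \<gamma> r + cmode2 (uc 2) (1+1) (b + pi/2) \<gamma> r"
     ?Um ?Um1 "\<lambda>r. cmode2 (uc 1) (1-1) b \<gamma> r - cmode2 (uc 2) (1-1) (b + pi/2) \<gamma> r"
     ?W ?W1 "cmode2 (uc 3) 1 b \<gamma>s" ?P "cmode1 p 1 b \<gamma>"
    by (rule R)
  have Um: "?Um = cint (uc j) (\<lambda>_. 1) \<gamma>"
  proof -
    have "cos b = (if j = 1 then 1 else 0)" "cos (- (b + pi/2)) = (if j = 1 then 0 else -1)"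
      using j cos_shift_pi_half[of 0 b] by (elim disjE conjE; hypsubst; simp)+
    then show ?thesis using j by (auto simp: cmode_def fun_eq_iff cint_def)
  qed
  have P: "?P = cint p (\<lambda>\<theta>. cyl 1 \<theta> 0 $ j) \<gamma>"
    using j by (elim disjE conjE; hypsubst; simp add: cmode_def cos_diff)
  have ps: "pseudo j \<gamma> r = 2 * R.traction r / r" if r: "\<epsilon> < r" for r
  proof -
    have "?Um1 r = cint (partial_deriv 1 (uc j)) cos \<gamma> r + cint (partial_deriv 2 (uc j)) sin \<gamma> r"
      using DERIV_unique[OF R.dUm[OF r, unfolded Um] cint_one_deriv[OF cont(1) r]] .
    then show ?thesis using r eps P unfolding R.traction_def by (simp add: pseudo_def)
  qed
  have lUp: "(?Up \<longlongrightarrow> 0) (at_right \<epsilon>)"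
    using tendsto_add[OF cmode_trace_zero[OF ub cont(1), of "1+1" 1 b] cmode_trace_zero[OF ub cont(1), of "1+1" 2 "b + pi/2"]] by simp
  have lUm: "(?Um \<longlongrightarrow> (if (1::real) = 0 then 0 else 2 * pi * c)) (at_right \<epsilon>)"
    unfolding Um c_def using cint_one_trace[OF ub cont(1), of j] by simp
  have lW: "(?W \<longlongrightarrow> (if (1::real) = 0 then 2 * pi * c else 0)) (at_right \<epsilon>)"
    using cmode_trace_zero[OF ub cont(2), of 1 3 b] by simp
  show ?thesis
  proof (cases "k = 0")
    case True
    have z: "pseudo j \<gamma> r = 0" if "\<epsilon> < r" for r using ps[OF that] R.traction_zero_mode[OF _ that] True \<kappa> by simp
    have "(pseudo j \<gamma> \<longlongrightarrow> 0) (at_right \<epsilon>)"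
      by (rule Lim_transform_eventually[OF tendsto_const])
        (use z in \<open>auto intro!: eventually_mono[OF eventually_at_right_less]\<close>)
    then show ?thesis by (rule that) (use z True in \<open>auto simp: \<kappa>\<close>)
  next
    case False
    have "1 \<le> \<kappa>" using mult_mono[of 1 pi 1 "real k"] pi_gt3 False unfolding \<kappa> by simp
    then obtain \<tau> where \<tau>: "(R.traction \<longlongrightarrow> \<tau>) (at_right \<epsilon>)" "\<bar>\<tau>\<bar> \<le> 100 * \<kappa> / ln (1 / \<epsilon>) * \<bar>2 * pi * c\<bar>"
      "\<And>\<rho>. \<epsilon> < \<rho> \<Longrightarrow> \<rho> < 1 \<Longrightarrow> \<bar>R.traction \<rho>\<bar> \<le> 100 * \<kappa> / ln (1 / \<rho>) * \<bar>2 * pi * c\<bar>"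
      using R.traction_estimate[OF _ e1 lUp lUm lW] by blast
    have e: "400 * pi * \<kappa> / ln (1 / \<rho>) * \<bar>c\<bar> = 2 * (100 * \<kappa> / ln (1 / \<rho>) * \<bar>2 * pi * c\<bar>)" for \<rho>
      by (simp add: abs_mult)
    have "((\<lambda>r. 2 * R.traction r / r) \<longlongrightarrow> 2 * \<tau> / \<epsilon>) (at_right \<epsilon>)"
      by (intro tendsto_intros \<tau>) (use eps in auto)
    then have "(pseudo j \<gamma> \<longlongrightarrow> 2 * \<tau> / \<epsilon>) (at_right \<epsilon>)"
      by (rule Lim_transform_eventually) (use ps in \<open>auto intro!: eventually_mono[OF eventually_at_right_less]\<close>)
    then show ?thesis
    proof (rule that)
      show "\<epsilon> * \<bar>2 * \<tau> / \<epsilon>\<bar> \<le> 400 * pi * \<kappa> / ln (1 / \<epsilon>) * \<bar>c\<bar>" unfolding e using \<tau>(2) eps by (simp add: abs_mult)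
      show "\<rho> * \<bar>pseudo j \<gamma> \<rho>\<bar> \<le> 400 * pi * \<kappa> / ln (1 / \<rho>) * \<bar>c\<bar>" if "\<epsilon> < \<rho>" "\<rho> < 1" for \<rho>
        unfolding e using \<tau>(3)[OF that] ps[OF that(1)] eps that by (simp add: abs_mult)
    qed
  qed
qed

text \<open>Here \<open>\<gamma>\<close> weighs the axial component, so the transverse ones get
  minus the sine, the sign that fits \<open>radial_system\<close>. The constant obtained is
  \<open>200 * pi\<close>; it is doubled to have one bound for all directions.\<close>

lemma pseudo_axial:
  fixes a \<kappa> :: real and k :: nat
  assumes ub: "L2_T ubar" and e1: "\<epsilon> < 1" and \<kappa>: "\<kappa> = pi * real k"
  defines "\<gamma> \<equiv> \<lambda>z. cos (\<kappa> * z - a)"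
  defines "c \<equiv> LBINT z:{0..2}. ubar z $ 3 * \<gamma> z"
  obtains q where "(pseudo 3 \<gamma> \<longlongrightarrow> q) (at_right \<epsilon>)" "\<epsilon> * \<bar>q\<bar> \<le> 400 * pi * \<kappa> / ln (1 / \<epsilon>) * \<bar>c\<bar>"
    "\<And>\<rho>. \<epsilon> < \<rho> \<Longrightarrow> \<rho> < 1 \<Longrightarrow> \<rho> * \<bar>pseudo 3 \<gamma> \<rho>\<bar> \<le> 400 * pi * \<kappa> / ln (1 / \<rho>) * \<bar>c\<bar>"
proof -
  define \<gamma>c where "\<gamma>c z = - sin (\<kappa> * z - a)" for z
  have \<kappa>2: "\<kappa> * 2 = 2 * pi * real k" by (simp add: \<kappa>)
  have cont: "continuous_on UNIV \<gamma>" "continuous_on UNIV \<gamma>c" unfolding \<gamma>_def \<gamma>c_def by (intro continuous_intros)+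
  let ?Up = "\<lambda>r. cmode (uc 1) (0+1) 0 \<gamma>c r + cmode (uc 2) (0+1) (0 + pi/2) \<gamma>c r"
  let ?Um = "\<lambda>r. cmode (uc 1) (0-1) 0 \<gamma>c r - cmode (uc 2) (0-1) (0 + pi/2) \<gamma>c r"
  let ?W = "cmode (uc 3) 0 0 \<gamma>" and ?W1 = "cmode1 (uc 3) 0 0 \<gamma>"
  have R: "radial_stokes \<epsilon> \<kappa> 0 ?Up (\<lambda>r. cmode1 (uc 1) (0+1) 0 \<gamma>c r + cmode1 (uc 2) (0+1) (0 + pi/2) \<gamma>c r)
     (\<lambda>r. cmode2 (uc 1) (0+1) 0 \<gamma>c r + cmode2 (uc 2) (0+1) (0 + pi/2) \<gamma>c r)
     ?Um (\<lambda>r. cmode1 (uc 1) (0-1) 0 \<gamma>c r - cmode1 (uc 2) (0-1) (0 + pi/2) \<gamma>c r)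
     (\<lambda>r. cmode2 (uc 1) (0-1) 0 \<gamma>c r - cmode2 (uc 2) (0-1) (0 + pi/2) \<gamma>c r)
     ?W ?W1 (cmode2 (uc 3) 0 0 \<gamma>) (cmode p 0 0 \<gamma>c) (cmode1 p 0 0 \<gamma>c)"
  proof (rule radial_system)
    show "(\<gamma>c has_real_derivative - \<kappa> * \<gamma> z) (at z)" "(\<gamma> has_real_derivative \<kappa> * \<gamma>c z) (at z)" for z
      unfolding \<gamma>_def \<gamma>c_def by (auto intro!: derivative_eq_intros)
    show "\<gamma>c 2 = \<gamma>c 0" "\<gamma> 2 = \<gamma> 0"
      unfolding \<gamma>_def \<gamma>c_def \<kappa>2 using cos_int_2pin[of "int k"] sin_int_2pin[of "int k"] by (simp_all add: cos_diff sin_diff)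
  qed (auto simp: \<kappa> \<gamma>_def \<gamma>c_def)
  interpret R: radial_stokes \<epsilon> \<kappa> 0 ?Up "\<lambda>r. cmode1 (uc 1) (0+1) 0 \<gamma>c r + cmode1 (uc 2) (0+1) (0 + pi/2) \<gamma>c r"
     "\<lambda>r. cmode2 (uc 1) (0+1) 0 \<gamma>c r + cmode2 (uc 2) (0+1) (0 + pi/2) \<gamma>c r"
     ?Um "\<lambda>r. cmode1 (uc 1) (0-1) 0 \<gamma>c r - cmode1 (uc 2) (0-1) (0 + pi/2) \<gamma>c r"
     "\<lambda>r. cmode2 (uc 1) (0-1) 0 \<gamma>c r - cmode2 (uc 2) (0-1) (0 + pi/2) \<gamma>c r"
     ?W ?W1 "cmode2 (uc 3) 0 0 \<gamma>" "cmode p 0 0 \<gamma>c" "cmode1 p 0 0 \<gamma>c"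
    by (rule R)
  have W: "?W = cint (uc 3) (\<lambda>_. 1) \<gamma>"
    by (simp add: cmode_def fun_eq_iff)
  have ps: "pseudo 3 \<gamma> r = R.traction r / r" if r: "\<epsilon> < r" for r
  proof -
    have "?W1 r = cint (partial_deriv 1 (uc 3)) cos \<gamma> r + cint (partial_deriv 2 (uc 3)) sin \<gamma> r"
      using DERIV_unique[OF R.dW[OF r, unfolded W] cint_one_deriv[OF cont(1) r]] .
    then show ?thesis using r eps unfolding R.traction_def by (simp add: pseudo_def cint_def)
  qed
  have lUp: "(?Up \<longlongrightarrow> 0) (at_right \<epsilon>)"
    using tendsto_add[OF cmode_trace_zero[OF ub cont(2), of "0+1" 1 0] cmode_trace_zero[OF ub cont(2), of "0+1" 2 "0 + pi/2"]] by simp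
  have lUm: "(?Um \<longlongrightarrow> (if (0::real) = 0 then 0 else 2 * pi * c)) (at_right \<epsilon>)"
    using tendsto_diff[OF cmode_trace_zero[OF ub cont(2), of "0-1" 1 0] cmode_trace_zero[OF ub cont(2), of "0-1" 2 "0 + pi/2"]] by simp
  have lW: "(?W \<longlongrightarrow> (if (0::real) = 0 then 2 * pi * c else 0)) (at_right \<epsilon>)"
    unfolding W c_def using cint_one_trace[OF ub cont(1), of 3] by simp
  show ?thesis
  proof (cases "k = 0")
    case True
    have z: "pseudo 3 \<gamma> r = 0" if "\<epsilon> < r" for r using ps[OF that] R.traction_zero_mode[OF _ that] True \<kappa> by simp
    have "(pseudo 3 \<gamma> \<longlongrightarrow> 0) (at_right \<epsilon>)"
      by (rule Lim_transform_eventually[OF tendsto_const])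
        (use z in \<open>auto intro!: eventually_mono[OF eventually_at_right_less]\<close>)
    then show ?thesis by (rule that) (use z True in \<open>auto simp: \<kappa>\<close>)
  next
    case False
    have k1: "1 \<le> \<kappa>" using mult_mono[of 1 pi 1 "real k"] pi_gt3 False unfolding \<kappa> by simp
    then obtain \<tau> where \<tau>: "(R.traction \<longlongrightarrow> \<tau>) (at_right \<epsilon>)" "\<bar>\<tau>\<bar> \<le> 100 * \<kappa> / ln (1 / \<epsilon>) * \<bar>2 * pi * c\<bar>"
      "\<And>\<rho>. \<epsilon> < \<rho> \<Longrightarrow> \<rho> < 1 \<Longrightarrow> \<bar>R.traction \<rho>\<bar> \<le> 100 * \<kappa> / ln (1 / \<rho>) * \<bar>2 * pi * c\<bar>"
      using R.traction_estimate[OF _ e1 lUp lUm lW] by blast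
    have weak: "100 * \<kappa> / ln (1 / \<rho>) * \<bar>2 * pi * c\<bar> \<le> 400 * pi * \<kappa> / ln (1 / \<rho>) * \<bar>c\<bar>" if "\<epsilon> \<le> \<rho>" "\<rho> < 1" for \<rho>
    proof -
      have "0 \<le> \<kappa> / ln (1 / \<rho>) * (pi * \<bar>c\<bar>)" using k1 that eps by (intro mult_nonneg_nonneg divide_nonneg_nonneg) auto
      moreover have "100 * \<kappa> / ln (1 / \<rho>) * \<bar>2 * pi * c\<bar> = 200 * (\<kappa> / ln (1 / \<rho>) * (pi * \<bar>c\<bar>))"
        "400 * pi * \<kappa> / ln (1 / \<rho>) * \<bar>c\<bar> = 400 * (\<kappa> / ln (1 / \<rho>) * (pi * \<bar>c\<bar>))" by (simp_all add: abs_mult)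
      ultimately show ?thesis by linarith
    qed
    have "((\<lambda>r. R.traction r / r) \<longlongrightarrow> \<tau> / \<epsilon>) (at_right \<epsilon>)"
      by (intro tendsto_intros \<tau>) (use eps in auto)
    then have "(pseudo 3 \<gamma> \<longlongrightarrow> \<tau> / \<epsilon>) (at_right \<epsilon>)"
      by (rule Lim_transform_eventually) (use ps in \<open>auto intro!: eventually_mono[OF eventually_at_right_less]\<close>)
    then show ?thesis
    proof (rule that)
      show "\<epsilon> * \<bar>\<tau> / \<epsilon>\<bar> \<le> 400 * pi * \<kappa> / ln (1 / \<epsilon>) * \<bar>c\<bar>" using order_trans[OF \<tau>(2) weak[OF order_refl e1]] eps by simp
      show "\<rho> * \<bar>pseudo 3 \<gamma> \<rho>\<bar> \<le> 400 * pi * \<kappa> / ln (1 / \<rho>) * \<bar>c\<bar>" if "\<epsilon> < \<rho>" "\<rho> < 1" for \<rho>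
        using order_trans[OF \<tau>(3)[OF that] weak[of \<rho>]] ps[OF that(1)] eps that by simp
    qed
  qed
qed

lemma pseudo_mode_estimate:
  fixes a :: real and k :: nat and j :: 3
  assumes ub: "L2_T ubar" and e1: "\<epsilon> < 1"
  defines "\<gamma> \<equiv> \<lambda>z. cos (pi * real k * z - a)"
  defines "c \<equiv> LBINT z:{0..2}. ubar z $ j * \<gamma> z"
  obtains q where "(pseudo j \<gamma> \<longlongrightarrow> q) (at_right \<epsilon>)" "\<epsilon> * \<bar>q\<bar> \<le> 400 * pi / ln (1 / \<epsilon>) * \<bar>pi * real k * c\<bar>"
    "\<And>\<rho>. \<epsilon> < \<rho> \<Longrightarrow> \<rho> < 1 \<Longrightarrow> \<rho> * \<bar>pseudo j \<gamma> \<rho>\<bar> \<le> 400 * pi / ln (1 / \<rho>) * \<bar>pi * real k * c\<bar>"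
proof -
  consider "j = 1" | "j = 2" | "j = 3" using exhaust_3 by blast
  then show ?thesis
  proof cases
    case 1
    show ?thesis
      by (rule pseudo_transverse[OF ub e1 refl, of j 0 k a]; use 1 that in \<open>simp add: \<gamma>_def c_def abs_mult mult_ac\<close>)
  next
    case 2
    show ?thesis
      by (rule pseudo_transverse[OF ub e1 refl, of j "pi/2" k a]; use 2 that in \<open>simp add: \<gamma>_def c_def abs_mult mult_ac\<close>)
  next
    case 3
    show ?thesis
      by (rule pseudo_axial[OF ub e1 refl, of k a]; use 3 that in \<open>simp add: \<gamma>_def c_def abs_mult mult_ac\<close>)
  qed
qed

end

section \<open>Orthonormal systems\<close>

text \<open>On a finite measure space the uniform bound makes the product of each \<open>e n\<close>
  with a square integrable function integrable, by Young's inequality alone.\<close>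

locale bounded_orthonormal = finite_measure M for M :: "'a measure" +
  fixes e :: "nat \<Rightarrow> 'a \<Rightarrow> real" and B :: real
  assumes e_meas [measurable]: "\<And>n. e n \<in> borel_measurable M"
    and e_bound: "\<And>n x. \<bar>e n x\<bar> \<le> B"
    and orthonormal: "\<And>m n. (\<integral>x. e m x * e n x \<partial>M) = (if m = n then 1 else 0)"
begin

lemma square_integrable_mult_bounded:
  fixes f g :: "'a \<Rightarrow> real" and K :: real
  assumes [measurable]: "f \<in> borel_measurable M" "g \<in> borel_measurable M" and f2: "integrable M (\<lambda>x. (f x)\<^sup>2)"
    and g: "\<And>x. x \<in> space M \<Longrightarrow> \<bar>g x\<bar> \<le> K"
  shows "integrable M (\<lambda>x. f x * g x)"
proof (rule Bochner_Integration.integrable_bound[where f="\<lambda>x. \<bar>K\<bar> * (1 + (f x)\<^sup>2)"])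
  show "integrable M (\<lambda>x. \<bar>K\<bar> * (1 + (f x)\<^sup>2))" using f2 by simp
  show "AE x in M. norm (f x * g x) \<le> norm (\<bar>K\<bar> * (1 + (f x)\<^sup>2))"
  proof (rule AE_I2)
    fix x assume x: "x \<in> space M"
    have "\<bar>f x\<bar> \<le> 1 + (f x)\<^sup>2 / (4 * 1)" by (rule abs_le_young) simp
    then have "\<bar>f x\<bar> \<le> 1 + (f x)\<^sup>2" using zero_le_power2[of "f x"] by linarith
    then have "\<bar>g x\<bar> * \<bar>f x\<bar> \<le> \<bar>K\<bar> * (1 + (f x)\<^sup>2)" using g[OF x] by (intro mult_mono) auto
    then show "norm (f x * g x) \<le> norm (\<bar>K\<bar> * (1 + (f x)\<^sup>2))" by (simp add: abs_mult mult.commute)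
  qed
qed auto

lemma bounded_integrable:
  fixes f :: "'a \<Rightarrow> real"
  assumes "f \<in> borel_measurable M" "\<And>x. x \<in> space M \<Longrightarrow> \<bar>f x\<bar> \<le> K"
  shows "integrable M f"
  using assms by (intro integrable_const_bound[of _ K]) auto

lemma ee_integrable: "integrable M (\<lambda>x. e m x * e n x)"
proof (rule bounded_integrable[where K="B * B"])
  show "\<bar>e m x * e n x\<bar> \<le> B * B" for x
    unfolding abs_mult using e_bound[of m x] e_bound[of n x] by (intro mult_mono) auto
qed auto

lemma combination_square:
  assumes "finite I"
  shows "integrable M (\<lambda>x. (\<Sum>i\<in>I. c i * e i x)\<^sup>2)" and "(\<integral>x. (\<Sum>i\<in>I. c i * e i x)\<^sup>2 \<partial>M) = (\<Sum>i\<in>I. (c i)\<^sup>2)"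
proof -
  have eq: "(\<Sum>i\<in>I. c i * e i x)\<^sup>2 = (\<Sum>i\<in>I. \<Sum>j\<in>I. (c i * c j) * (e i x * e j x))" for x
    by (simp add: power2_eq_square sum_product mult_ac)
  show "integrable M (\<lambda>x. (\<Sum>i\<in>I. c i * e i x)\<^sup>2)"
    unfolding eq by (intro Bochner_Integration.integrable_sum integrable_mult_right ee_integrable)
  have "(\<integral>x. (\<Sum>i\<in>I. c i * e i x)\<^sup>2 \<partial>M) = (\<Sum>i\<in>I. \<Sum>j\<in>I. (c i * c j) * (\<integral>x. e i x * e j x \<partial>M))"
    unfolding eq by (simp add: Bochner_Integration.integral_sum Bochner_Integration.integrable_sum ee_integrable)
  also have "\<dots> = (\<Sum>i\<in>I. (c i)\<^sup>2)"
    using assms by (simp add: orthonormal power2_eq_square if_distrib sum.delta' cong: if_cong)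
  finally show "(\<integral>x. (\<Sum>i\<in>I. c i * e i x)\<^sup>2 \<partial>M) = (\<Sum>i\<in>I. (c i)\<^sup>2)" .
qed

lemma bessel:
  fixes f :: "'a \<Rightarrow> real"
  assumes [measurable]: "f \<in> borel_measurable M" and f2: "integrable M (\<lambda>x. (f x)\<^sup>2)" and I: "finite I"
  shows "(\<Sum>i\<in>I. (\<integral>x. f x * e i x \<partial>M)\<^sup>2) \<le> (\<integral>x. (f x)\<^sup>2 \<partial>M)"
proof -
  define c where "c i = (\<integral>x. f x * e i x \<partial>M)" for i
  have fe: "integrable M (\<lambda>x. f x * e i x)" for i
    by (rule square_integrable_mult_bounded[OF _ _ f2 e_bound]) auto
  let ?S = "\<lambda>x. \<Sum>i\<in>I. c i * e i x"
  have eq: "(f x - ?S x)\<^sup>2 = (f x)\<^sup>2 - 2 * (\<Sum>i\<in>I. c i * (f x * e i x)) + (?S x)\<^sup>2" for x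
    by (simp add: power2_diff sum_distrib_left mult_ac)
  have i1: "integrable M (\<lambda>x. 2 * (\<Sum>i\<in>I. c i * (f x * e i x)))"
    by (intro integrable_mult_right Bochner_Integration.integrable_sum fe)
  have "0 \<le> (\<integral>x. (f x - ?S x)\<^sup>2 \<partial>M)" by simp
  also have "\<dots> = (\<integral>x. (f x)\<^sup>2 \<partial>M) - (\<integral>x. 2 * (\<Sum>i\<in>I. c i * (f x * e i x)) \<partial>M) + (\<integral>x. (?S x)\<^sup>2 \<partial>M)"
    unfolding eq Bochner_Integration.integral_add[OF Bochner_Integration.integrable_diff[OF f2 i1] combination_square(1)[OF I]]
      Bochner_Integration.integral_diff[OF f2 i1] ..
  also have "(\<integral>x. 2 * (\<Sum>i\<in>I. c i * (f x * e i x)) \<partial>M) = 2 * (\<Sum>i\<in>I. c i * c i)"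
    by (simp add: c_def Bochner_Integration.integral_sum fe)
  also have "(\<integral>x. (?S x)\<^sup>2 \<partial>M) = (\<Sum>i\<in>I. c i * c i)"
    using combination_square(2)[OF I, of c] by (simp only: power2_eq_square)
  finally show ?thesis by (simp add: c_def power2_eq_square)
qed

lemma bessel_summable:
  fixes f :: "'a \<Rightarrow> real"
  assumes "f \<in> borel_measurable M" and "integrable M (\<lambda>x. (f x)\<^sup>2)"
  shows "summable (\<lambda>i. (\<integral>x. f x * e i x \<partial>M)\<^sup>2)"
  by (rule summableI_nonneg_bounded[where x="\<integral>x. (f x)\<^sup>2 \<partial>M"]) (use bessel[OF assms] in auto)

text \<open>The function is the sum of blocks of the series whose \<open>L\<^sup>2\<close> norms decay geometrically, so that it
  converges absolutely almost everywhere.\<close>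

lemma riesz_fischer:
  assumes c: "summable (\<lambda>n. (c n)\<^sup>2)"
  obtains f where "f \<in> borel_measurable M" "integrable M (\<lambda>x. (f x)\<^sup>2)" "(\<integral>x. (f x)\<^sup>2 \<partial>M) \<le> (\<Sum>n. (c n)\<^sup>2)"
    "\<And>\<phi> K. \<phi> \<in> borel_measurable M \<Longrightarrow> (\<And>x. x \<in> space M \<Longrightarrow> \<bar>\<phi> x\<bar> \<le> K) \<Longrightarrow>
        summable (\<lambda>n. c n * (\<integral>x. \<phi> x * e n x \<partial>M)) \<Longrightarrow>
        (\<integral>x. \<phi> x * f x \<partial>M) = (\<Sum>n. c n * (\<integral>x. \<phi> x * e n x \<partial>M))"
proof -
  define T where "T = (\<Sum>n. (c n)\<^sup>2)"
  \<comment> \<open>The added 1 makes \<open>A\<close> positive, so that \<open>A / 4 ^ j\<close> is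
    a valid tolerance even if all \<open>c n\<close> vanish.\<close>
  define A where "A = T + 1"
  have T0: "0 \<le> T" unfolding T_def by (intro suminf_nonneg c) auto
  have A: "0 < A" using T0 by (simp add: A_def)
  have part: "(\<Sum>i\<in>I. (c i)\<^sup>2) \<le> T" if "finite I" for I
    unfolding T_def by (intro sum_le_suminf c that) auto
  have "\<exists>n0. \<forall>n\<ge>n0. T - (\<Sum>i<n. (c i)\<^sup>2) < A / 4 ^ j" for j :: nat
  proof -
    have "(\<lambda>n. T - (\<Sum>i<n. (c i)\<^sup>2)) \<longlonglongrightarrow> T - T"
      unfolding T_def by (intro tendsto_intros summable_LIMSEQ c)
    then show ?thesis using order_tendstoD(2)[of _ 0 sequentially "A / 4 ^ j"] A by (simp add: eventually_sequentially)
  qed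
  then obtain N' where N': "\<And>j n. N' j \<le> n \<Longrightarrow> T - (\<Sum>i<n. (c i)\<^sup>2) < A / 4 ^ j" by metis
  \<comment> \<open>Block boundaries: summing keeps \<open>N j\<close> above \<open>N' j\<close>,
    and the added 1 makes \<open>N\<close> strictly increasing. The first block has no tail bound
    and uses \<open>T \<le> A\<close>.\<close>
  define N where "N j = (\<Sum>i\<in>{1..j}. N' i + 1)" for j :: nat
  have N0: "N 0 = 0" by (simp add: N_def)
  have NS: "N (Suc j) = N j + N' (Suc j) + 1" for j by (simp add: N_def)
  have mono: "strict_mono N" by (intro strict_mono_Suc_iff[THEN iffD2] allI) (simp add: NS)
  have NN': "N' j \<le> N j" if "0 < j" for j using that NS[of "j - 1"] by simp
  have tail: "(\<Sum>i\<in>{N j..<N (Suc j)}. (c i)\<^sup>2) \<le> A / 4 ^ j" for j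
  proof (cases "j = 0")
    case True then show ?thesis using part[of "{N j..<N (Suc j)}"] by (simp add: A_def)
  next
    case False
    have "(\<Sum>i<N j. (c i)\<^sup>2) + (\<Sum>i\<in>{N j..<N (Suc j)}. (c i)\<^sup>2) = (\<Sum>i<N (Suc j). (c i)\<^sup>2)"
      using mono by (subst sum.union_disjoint[symmetric]) (auto simp: NS ivl_disj_un intro!: sum.cong)
    then show ?thesis using N'[OF NN'[of j]] False part[of "{..<N (Suc j)}"] by simp
  qed
  define D where "D j x = (\<Sum>i\<in>{N j..<N (Suc j)}. c i * e i x)" for j x
  have Dm [measurable]: "D j \<in> borel_measurable M" for j unfolding D_def[abs_def] by measurable
  have D2: "integrable M (\<lambda>x. (D j x)\<^sup>2)" "(\<integral>x. (D j x)\<^sup>2 \<partial>M) \<le> A / 4 ^ j" for j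
    unfolding D_def using combination_square[of "{N j..<N (Suc j)}" c] tail[of j] by auto
  have Dpart: "(\<Sum>j<J. D j x) = (\<Sum>i<N J. c i * e i x)" for J x
  proof (induction J)
    case (Suc J)
    have "(\<Sum>i<N J. c i * e i x) + (\<Sum>i\<in>{N J..<N (Suc J)}. c i * e i x) = (\<Sum>i<N (Suc J). c i * e i x)"
      by (subst sum.union_disjoint[symmetric]) (auto simp: NS ivl_disj_un intro!: sum.cong)
    then show ?case using Suc by (simp add: D_def)
  qed (simp add: N0)
  have Di: "integrable M (D j)" for j
    using square_integrable_mult_bounded[OF Dm _ D2(1), of "\<lambda>_. 1" 1] by simp
  define \<mu> where "\<mu> = measure M (space M)"
  have D1: "(\<integral>x. \<bar>D j x\<bar> \<partial>M) \<le> (\<mu> + A) * (1/2) ^ j" for j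
  proof -
    \<comment> \<open>In Young's inequality this parameter makes both the constant and the quadratic
      term of size \<open>(1/2) ^ j\<close>.\<close>
    define s :: real where "s = (1/2) ^ j"
    have s: "0 < s" by (simp add: s_def)
    have s4: "A / 4 ^ j = A * s * s" by (simp add: s_def power_one_over flip: power_mult_distrib)
    have "(\<integral>x. \<bar>D j x\<bar> \<partial>M) \<le> (\<integral>x. s + (D j x)\<^sup>2 * (1 / (4 * s)) \<partial>M)"
      using abs_le_young[OF s] by (intro integral_mono) (auto simp: D2 Di)
    also have "\<dots> = \<mu> * s + (\<integral>x. (D j x)\<^sup>2 \<partial>M) * (1 / (4 * s))" by (simp add: D2 \<mu>_def)
    also have "\<dots> \<le> \<mu> * s + (A * s * s) * (1 / (4 * s))"
      using D2(2)[of j] s unfolding s4 by (intro add_left_mono mult_right_mono) auto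
    also have "\<dots> \<le> (\<mu> + A) * s" using s A by (simp add: field_simps)
    finally show ?thesis by (simp add: s_def)
  qed
  have sumD1: "summable (\<lambda>j. \<integral>x. \<bar>D j x\<bar> \<partial>M)"
    by (rule summable_comparison_test'[where N=0 and g="\<lambda>j. (\<mu> + A) * (1/2) ^ j"])
      (use D1 in \<open>auto intro!: summable_mult summable_geometric simp: abs_of_nonneg\<close>)
  have AEs: "AE x in M. summable (\<lambda>j. \<bar>D j x\<bar>)"
  proof -
    have "(\<integral>\<^sup>+x. (\<Sum>j. ennreal \<bar>D j x\<bar>) \<partial>M) = (\<Sum>j. \<integral>\<^sup>+x. ennreal \<bar>D j x\<bar> \<partial>M)"
      by (intro nn_integral_suminf) auto
    also have "\<dots> = (\<Sum>j. ennreal (\<integral>x. \<bar>D j x\<bar> \<partial>M))"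
      by (intro suminf_cong nn_integral_eq_integral) (auto intro: Di)
    also have "\<dots> = ennreal (\<Sum>j. \<integral>x. \<bar>D j x\<bar> \<partial>M)"
      by (intro suminf_ennreal2 sumD1) auto
    finally have "(\<integral>\<^sup>+x. (\<Sum>j. ennreal \<bar>D j x\<bar>) \<partial>M) \<noteq> \<infinity>" by simp
    then have "AE x in M. (\<Sum>j. ennreal \<bar>D j x\<bar>) \<noteq> \<infinity>"
      by (intro nn_integral_noteq_infinite) auto
    then show ?thesis by eventually_elim (auto intro!: summable_suminf_not_top)
  qed
  define f where "f x = (\<Sum>j. D j x)" for x
  have fm [measurable]: "f \<in> borel_measurable M" unfolding f_def[abs_def] by measurable
  have AEl: "AE x in M. (\<lambda>J. \<Sum>i<N J. c i * e i x) \<longlonglongrightarrow> f x"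
    using AEs
  proof eventually_elim
    case (elim x)
    then have "(\<lambda>J. \<Sum>j<J. D j x) \<longlonglongrightarrow> f x" unfolding f_def by (rule summable_LIMSEQ[OF summable_rabs_cancel])
    then show ?case by (simp add: Dpart)
  qed
  \<comment> \<open>Fatou's lemma along the partial sums up to \<open>N J\<close>, whose squared
    norms are known exactly.\<close>
  have nn: "(\<integral>\<^sup>+x. ennreal ((f x)\<^sup>2) \<partial>M) \<le> ennreal T"
  proof -
    have "(\<integral>\<^sup>+x. ennreal ((f x)\<^sup>2) \<partial>M) = (\<integral>\<^sup>+x. liminf (\<lambda>J. ennreal ((\<Sum>i<N J. c i * e i x)\<^sup>2)) \<partial>M)"
      using AEl
    proof (intro nn_integral_cong_AE, eventually_elim)
      case (elim x)
      then have "(\<lambda>J. ennreal ((\<Sum>i<N J. c i * e i x)\<^sup>2)) \<longlonglongrightarrow> ennreal ((f x)\<^sup>2)" by (intro tendsto_intros)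
      then show ?case by (intro lim_imp_Liminf[symmetric]) auto
    qed
    also have "\<dots> \<le> liminf (\<lambda>J. \<integral>\<^sup>+x. ennreal ((\<Sum>i<N J. c i * e i x)\<^sup>2) \<partial>M)"
      by (intro nn_integral_liminf) measurable
    also have "\<dots> = liminf (\<lambda>J. ennreal (\<Sum>i<N J. (c i)\<^sup>2))"
      by (simp add: nn_integral_eq_integral combination_square)
    also have "\<dots> \<le> liminf (\<lambda>J::nat. ennreal T)" by (intro Liminf_mono always_eventually allI ennreal_leI part) auto
    finally show ?thesis by (simp add: Liminf_const)
  qed
  have f2: "integrable M (\<lambda>x. (f x)\<^sup>2)"
    by (rule integrableI_nonneg) (use nn in \<open>auto intro: le_less_trans\<close>)
  show ?thesis
  proof (rule that[OF fm f2])
    have "ennreal (\<integral>x. (f x)\<^sup>2 \<partial>M) \<le> ennreal T" using nn nn_integral_eq_integral[OF f2] by simp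
    then show "(\<integral>x. (f x)\<^sup>2 \<partial>M) \<le> (\<Sum>n. (c n)\<^sup>2)" using T0 by (simp add: T_def)
    fix \<phi> :: "'a \<Rightarrow> real" and K
    assume \<phi>m [measurable]: "\<phi> \<in> borel_measurable M" and K: "\<And>x. x \<in> space M \<Longrightarrow> \<bar>\<phi> x\<bar> \<le> K"
      and sm: "summable (\<lambda>n. c n * (\<integral>x. \<phi> x * e n x \<partial>M))"
    have K': "\<And>x. x \<in> space M \<Longrightarrow> \<bar>\<phi> x\<bar> \<le> \<bar>K\<bar>" using K by force
    have pe: "integrable M (\<lambda>x. \<phi> x * e n x)" for n
      by (rule bounded_integrable[where K="\<bar>K\<bar> * B"]) (auto simp: abs_mult intro!: mult_mono K' e_bound)
    have pD: "integrable M (\<lambda>x. \<phi> x * D j x)" for j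
      using square_integrable_mult_bounded[OF Dm \<phi>m D2(1) K] by (simp add: mult.commute)
    have s0: "(\<integral>x. \<phi> x * f x \<partial>M) = (\<integral>x. (\<Sum>j. \<phi> x * D j x) \<partial>M)"
      using AEs
    proof (intro integral_cong_AE, measurable, eventually_elim)
      case (elim x)
      then have "summable (\<lambda>j. D j x)" by (blast intro: summable_rabs_cancel)
      then show ?case by (simp add: f_def suminf_mult)
    qed
    have s1: "(\<lambda>j. \<integral>x. \<phi> x * D j x \<partial>M) sums (\<integral>x. (\<Sum>j. \<phi> x * D j x) \<partial>M)"
    proof (rule sums_integral[OF pD])
      show "AE x in M. summable (\<lambda>j. norm (\<phi> x * D j x))"
        using AEs by eventually_elim (auto simp: abs_mult intro: summable_mult)
      show "summable (\<lambda>j. \<integral>x. norm (\<phi> x * D j x) \<partial>M)"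
      proof (rule summable_comparison_test'[where N=0 and g="\<lambda>j. \<bar>K\<bar> * (\<integral>x. \<bar>D j x\<bar> \<partial>M)"])
        show "norm (\<integral>x. norm (\<phi> x * D j x) \<partial>M) \<le> \<bar>K\<bar> * (\<integral>x. \<bar>D j x\<bar> \<partial>M)" for j
        proof -
          have "(\<integral>x. norm (\<phi> x * D j x) \<partial>M) \<le> (\<integral>x. \<bar>K\<bar> * \<bar>D j x\<bar> \<partial>M)"
            by (intro integral_mono integrable_norm pD integrable_mult_right integrable_abs Di) (auto simp: abs_mult intro!: mult_right_mono K')
          then show ?thesis by simp
        qed
      qed (intro summable_mult sumD1)
    qed
    have s2: "(\<lambda>j. \<integral>x. \<phi> x * D j x \<partial>M) sums (\<Sum>n. c n * (\<integral>x. \<phi> x * e n x \<partial>M))"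
    proof -
      have "(\<Sum>j<J. \<integral>x. \<phi> x * D j x \<partial>M) = (\<Sum>i<N J. c i * (\<integral>x. \<phi> x * e i x \<partial>M))" for J
      proof -
        have "(\<Sum>j<J. \<integral>x. \<phi> x * D j x \<partial>M) = (\<integral>x. \<phi> x * (\<Sum>j<J. D j x) \<partial>M)"
          by (simp add: pD sum_distrib_left)
        also have "\<dots> = (\<integral>x. (\<Sum>i<N J. c i * (\<phi> x * e i x)) \<partial>M)"
          unfolding Dpart by (simp add: sum_distrib_left mult_ac)
        finally show ?thesis by (simp add: pe)
      qed
      \<comment> \<open>The blocks only give the partial sums up to \<open>N J\<close>; the assumed
        summability identifies their limit with the whole series.\<close>
      moreover have "(\<lambda>J. \<Sum>i<N J. c i * (\<integral>x. \<phi> x * e i x \<partial>M)) \<longlonglongrightarrow> (\<Sum>n. c n * (\<integral>x. \<phi> x * e n x \<partial>M))"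
        using LIMSEQ_subseq_LIMSEQ[OF summable_LIMSEQ[OF sm] mono] by (simp add: o_def)
      ultimately show ?thesis by (simp add: sums_def)
    qed
    show "(\<integral>x. \<phi> x * f x \<partial>M) = (\<Sum>n. c n * (\<integral>x. \<phi> x * e n x \<partial>M))"
      unfolding s0 by (rule sums_unique2[OF s1 s2])
  qed
qed

end

section \<open>Fourier series on the circle\<close>

text \<open>The system \<open>1/\<surd>2\<close>, \<open>cos (\<pi> z)\<close>, \<open>sin (\<pi> z)\<close>, \<open>cos (2 \<pi> z)\<close>, \<open>sin (2 \<pi> z)\<close>, \<open>\<dots>\<close>; \<open>tconj\<close> exchanges the cosine
  and the sine of the same frequency.\<close>

definition tfreq :: "nat \<Rightarrow> nat" where "tfreq n = (n + 1) div 2"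
definition tphase :: "nat \<Rightarrow> real" where "tphase n = (if n \<noteq> 0 \<and> even n then pi / 2 else 0)"
definition tscale :: "nat \<Rightarrow> real" where "tscale n = (if n = 0 then 1 / sqrt 2 else 1)"
definition trig :: "nat \<Rightarrow> real \<Rightarrow> real" where
  "trig n z = tscale n * cos (pi * real (tfreq n) * z - tphase n)"
definition tconj :: "nat \<Rightarrow> nat" where "tconj n = (if n = 0 then 0 else if odd n then n + 1 else n - 1)"
definition tsign :: "nat \<Rightarrow> real" where "tsign n = (if odd n then -1 else 1)"

lemma tscale_bounds: "0 \<le> tscale n" "tscale n \<le> 1"
  by (auto simp: tscale_def)

lemma trig_odd: "trig (2 * k + 1) z = cos (pi * real (k + 1) * z)"
  by (simp add: trig_def tscale_def tphase_def tfreq_def)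

lemma trig_even: "trig (2 * k + 2) z = sin (pi * real (k + 1) * z)"
  using cos_diff[of "pi * real (k + 1) * z" "pi / 2"] by (simp add: trig_def tscale_def tphase_def tfreq_def)

lemma trig_0: "trig 0 z = 1 / sqrt 2"
  by (simp add: trig_def tscale_def tphase_def tfreq_def)

lemma trig_cases:
  fixes n :: nat
  obtains "n = 0" | k where "n = 2 * k + 1" | k where "n = 2 * k + 2"
proof -
  consider "n = 0" | "odd n" | "even n" "n \<noteq> 0" by blast
  then show ?thesis
  proof cases
    case 2 then show ?thesis using that(2) oddE by blast
  next
    case 3
    then obtain m where "n = 2 * m" "m \<noteq> 0" by (auto elim: evenE)
    then show ?thesis using that(3)[of "m - 1"] by simp
  qed (use that in blast)
qed

lemma tconj_simps: "tconj 0 = 0" "tconj (2 * k + 1) = 2 * k + 2" "tconj (2 * k + 2) = 2 * k + 1"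
  by (auto simp: tconj_def)

lemma tfreq_simps: "tfreq 0 = 0" "tfreq (2 * k + 1) = k + 1" "tfreq (2 * k + 2) = k + 1"
  by (auto simp: tfreq_def)

lemma tsign_simps: "tsign 0 = 1" "tsign (2 * k + 1) = -1" "tsign (2 * k + 2) = 1"
  by (auto simp: tsign_def)

lemma tconj_tconj: "tconj (tconj n) = n" and tfreq_tconj: "tfreq (tconj n) = tfreq n"
  by (cases n rule: trig_cases; simp only: tconj_simps tfreq_simps)+

lemma inj_tconj: "inj tconj"
  by (rule inj_on_inverseI[of _ tconj]) (rule tconj_tconj)

lemma abs_tsign: "\<bar>tsign n\<bar> = 1"
  by (simp add: tsign_def)

lemma trig_deriv: "(trig n has_real_derivative tsign n * (pi * real (tfreq n)) * trig (tconj n) z) (at z)"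
proof (cases n rule: trig_cases)
  case 1
  then show ?thesis by (simp add: trig_0[abs_def] tfreq_simps)
next
  case (2 k)
  then show ?thesis unfolding 2 tconj_simps tfreq_simps tsign_simps trig_odd[abs_def] trig_even
    by (auto intro!: derivative_eq_intros)
next
  case (3 k)
  then show ?thesis unfolding 3 tconj_simps tfreq_simps tsign_simps trig_odd trig_even[abs_def]
    by (auto intro!: derivative_eq_intros)
qed

lemma trig_bound: "\<bar>trig n z\<bar> \<le> 1"
  unfolding trig_def abs_mult using tscale_bounds[of n] by (intro mult_le_one) auto

lemma trig_continuous: "continuous_on A (trig n)"
  unfolding trig_def by (intro continuous_intros)

lemma trig_continuous_compose [continuous_intros]: "continuous_on A f \<Longrightarrow> continuous_on A (\<lambda>x. trig n (f x))"
  for f :: "'a::t2_space \<Rightarrow> real"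
  unfolding trig_def by (intro continuous_intros)

lemma trig_measurable [measurable]: "trig n \<in> borel_measurable borel"
  by (intro borel_measurable_continuous_onI trig_continuous)

lemma trig_2: "trig n 2 = trig n 0"
proof -
  have e: "pi * real k * 2 = 2 * pi * of_int (int k)" for k by simp
  show ?thesis unfolding trig_def by (simp only: e cos_diff cos_int_2pin sin_int_2pin) simp
qed

lemma trig_periodic: "trig n (z + 2) = trig n z"
proof -
  have e: "pi * real k * (z + 2) - c = (pi * real k * z - c) + 2 * pi * of_int (int k)" for k c by (simp add: algebra_simps)
  show ?thesis unfolding trig_def e by (simp only: cos_add cos_int_2pin sin_int_2pin) simp
qed

abbreviation circle :: "real measure" where "circle \<equiv> restrict_space lborel {0..2}"

section \<open>Integration over one period\<close>

lemma circle_integral: "(\<integral>z. f z \<partial>circle) = (LBINT z:{0..2}. f z)"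
  for f :: "real \<Rightarrow> 'b::{banach, second_countable_topology}"
  by (simp add: integral_restrict_space set_lebesgue_integral_def)

lemma circle_integrable: "integrable circle f \<longleftrightarrow> set_integrable lborel {0..2} f"
  for f :: "real \<Rightarrow> 'b::{banach, second_countable_topology}"
  by (simp add: integrable_restrict_space set_integrable_def)

lemma circle_measurable: "f \<in> borel_measurable borel \<Longrightarrow> f \<in> borel_measurable circle"
  for f :: "real \<Rightarrow> 'b::{banach, second_countable_topology}"
  by (auto intro: measurable_restrict_space1)

lemma circle_continuous_integrable: "continuous_on {0..2} f \<Longrightarrow> integrable circle f"
  for f :: "real \<Rightarrow> 'b::{banach, second_countable_topology}"
  unfolding circle_integrable by (rule borel_integrable_atLeastAtMost')

lemma circle_continuous_measurable: "continuous_on {0..2} f \<Longrightarrow> f \<in> borel_measurable circle"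
  for f :: "real \<Rightarrow> 'b::{banach, second_countable_topology}"
  using borel_measurable_integrable[OF circle_continuous_integrable] .

lemma circle_FTC:
  fixes F F' :: "real \<Rightarrow> real"
  assumes "\<And>z. (F has_real_derivative F' z) (at z)" "continuous_on {0..2} F'"
  shows "(\<integral>z. F' z \<partial>circle) = F 2 - F 0"
proof -
  have "(F' has_integral (F 2 - F 0)) {0..2}"
    using assms(1) by (intro fundamental_theorem_of_calculus)
      (auto intro: has_field_derivative_at_within simp: has_real_derivative_iff_has_vector_derivative[symmetric])
  then show ?thesis
    using set_borel_integral_eq_integral(2)[OF borel_integrable_atLeastAtMost'[OF assms(2)]]
    by (simp add: circle_integral integral_unique)
qed

lemma circle_cos: "(\<integral>z. cos (pi * of_int m * z - c) \<partial>circle) = (if m = 0 then 2 * cos c else 0)"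
proof (cases "m = 0")
  case True
  have "(\<integral>z. cos c \<partial>circle) = cos c * 2 - cos c * 0"
    by (rule circle_FTC[of "\<lambda>z. cos c * z"]) (auto intro!: derivative_eq_intros)
  then show ?thesis using True by simp
next
  case False
  have "(\<integral>z. cos (pi * of_int m * z - c) \<partial>circle) = sin (pi * of_int m * 2 - c) / (pi * of_int m) - sin (pi * of_int m * 0 - c) / (pi * of_int m)"
    by (rule circle_FTC[of "\<lambda>z. sin (pi * of_int m * z - c) / (pi * of_int m)"])
      (use False in \<open>auto intro!: derivative_eq_intros continuous_intros\<close>)
  moreover have e: "pi * of_int m * 2 = 2 * pi * of_int m" by simp
  ultimately show ?thesis using False by (simp only: e sin_diff cos_int_2pin sin_int_2pin) simp
qed

lemma trig_orthonormal: "(\<integral>z. trig m z * trig n z \<partial>circle) = (if m = n then 1 else 0)"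
proof -
  let ?k = "int (tfreq m)" and ?l = "int (tfreq n)" and ?a = "tphase m" and ?b = "tphase n"
  have eq: "trig m z * trig n z = (tscale m * tscale n / 2) * (cos (pi * of_int (?k - ?l) * z - (?a - ?b)) + cos (pi * of_int (?k + ?l) * z - (?a + ?b)))" for z
  proof -
    define w where "w = pi * real (tfreq m) * z - ?a"
    define v where "v = pi * real (tfreq n) * z - ?b"
    have "pi * of_int (?k - ?l) * z - (?a - ?b) = w - v" "pi * of_int (?k + ?l) * z - (?a + ?b) = w + v"
      by (simp_all add: w_def v_def algebra_simps)
    then show ?thesis by (simp only: trig_def w_def[symmetric] v_def[symmetric]) (simp add: cos_add cos_diff)
  qed
  have i: "integrable circle (\<lambda>z. cos (pi * of_int j * z - c))" for j c
    by (intro circle_continuous_integrable continuous_intros)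
  have "(\<integral>z. trig m z * trig n z \<partial>circle) = (tscale m * tscale n / 2) *
     ((\<integral>z. cos (pi * of_int (?k - ?l) * z - (?a - ?b)) \<partial>circle) + (\<integral>z. cos (pi * of_int (?k + ?l) * z - (?a + ?b)) \<partial>circle))"
    unfolding eq by (simp only: integral_mult_right_zero Bochner_Integration.integral_add[OF i i])
  also have "\<dots> = (if m = n then 1 else 0)"
    unfolding circle_cos
    by (cases m rule: trig_cases; cases n rule: trig_cases)
      (auto simp: tfreq_def tscale_def tphase_def simp del: of_nat_Suc)
  finally show ?thesis .
qed

lemma finite_measure_circle: "finite_measure circle"
  by (intro finite_measureI) (simp add: emeasure_restrict_space)

interpretation trig: bounded_orthonormal circle trig 1
proof -
  interpret finite_measure circle by (rule finite_measure_circle)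
  show "bounded_orthonormal circle trig 1"
    by unfold_locales (auto intro: circle_measurable trig_bound trig_orthonormal simp: trig_orthonormal)
qed

definition fourier :: "(real \<Rightarrow> real) \<Rightarrow> nat \<Rightarrow> real" where
  "fourier f n = (\<integral>z. f z * trig n z \<partial>circle)"

section \<open>Fourier coefficients of differentiable functions\<close>

lemma fourier_deriv:
  assumes \<phi>: "\<And>z. (\<phi> has_real_derivative \<phi>' z) (at z)" and c: "continuous_on UNIV \<phi>'" and per: "\<phi> 2 = \<phi> 0"
  shows "\<bar>fourier \<phi>' (tconj n)\<bar> = pi * real (tfreq n) * \<bar>fourier \<phi> n\<bar>"
proof -
  have \<phi>c: "continuous_on A \<phi>" for A using \<phi> by (intro continuous_at_imp_continuous_on ballI DERIV_isCont) auto
  have i1: "integrable circle (\<lambda>z. \<phi>' z * trig (tconj n) z)"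
    by (intro circle_continuous_integrable continuous_intros continuous_on_subset[OF c] trig_continuous) auto
  have i2: "integrable circle (\<lambda>z. \<phi> z * (tsign (tconj n) * (pi * real (tfreq n)) * trig n z))"
    by (intro circle_continuous_integrable continuous_intros \<phi>c trig_continuous)
  have "(\<integral>z. \<phi>' z * trig (tconj n) z + \<phi> z * (tsign (tconj n) * (pi * real (tfreq n)) * trig n z) \<partial>circle)
      = \<phi> 2 * trig (tconj n) 2 - \<phi> 0 * trig (tconj n) 0"
  proof (rule circle_FTC)
    show "((\<lambda>z. \<phi> z * trig (tconj n) z) has_real_derivative \<phi>' z * trig (tconj n) z + \<phi> z * (tsign (tconj n) * (pi * real (tfreq n)) * trig n z)) (at z)" for z
      using DERIV_mult[OF \<phi>[of z] trig_deriv[of "tconj n" z]] by (simp add: tconj_tconj tfreq_tconj algebra_simps)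
    show "continuous_on {0..2} (\<lambda>z. \<phi>' z * trig (tconj n) z + \<phi> z * (tsign (tconj n) * (pi * real (tfreq n)) * trig n z))"
      by (intro continuous_intros continuous_on_subset[OF c] \<phi>c trig_continuous) auto
  qed
  also have "\<dots> = 0" by (simp add: per trig_2)
  also have "(\<integral>z. \<phi>' z * trig (tconj n) z + \<phi> z * (tsign (tconj n) * (pi * real (tfreq n)) * trig n z) \<partial>circle)
     = fourier \<phi>' (tconj n) + tsign (tconj n) * (pi * real (tfreq n)) * fourier \<phi> n"
    unfolding Bochner_Integration.integral_add[OF i1 i2] fourier_def
    by (simp add: mult.left_commute[of "\<phi> _"])
  finally have "fourier \<phi>' (tconj n) = - (tsign (tconj n) * (pi * real (tfreq n)) * fourier \<phi> n)" by simp
  then show ?thesis by (simp add: abs_mult abs_tsign)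
qed

text \<open>Integration by parts bounds the coefficient by \<open>2 / n\<close> times one of
  \<open>\<phi>'\<close>. The latter are square summable by Bessel's inequality, so are the factors
  \<open>2 / n\<close>, and a product is at most the sum of the squares.\<close>

lemma fourier_summable:
  assumes \<phi>: "\<And>z. (\<phi> has_real_derivative \<phi>' z) (at z)" and c: "continuous_on UNIV \<phi>'" and per: "\<phi> 2 = \<phi> 0"
  shows "summable (\<lambda>n. \<bar>fourier \<phi> n\<bar>)"
proof -
  have c2: "continuous_on {0..2} \<phi>'" by (rule continuous_on_subset[OF c]) simp
  have s1: "summable (\<lambda>n. (fourier \<phi>' n)\<^sup>2)"
    unfolding fourier_def
    by (intro trig.bessel_summable circle_continuous_measurable circle_continuous_integrable continuous_intros c2)
  have s2: "summable (\<lambda>n. (fourier \<phi>' (tconj n))\<^sup>2)"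
    using summable_reindex[OF s1 inj_tconj] by (simp add: o_def)
  have s3: "summable (\<lambda>n. 4 * (inverse ((real n)\<^sup>2)))"
    by (intro summable_mult inverse_power_summable) simp
  show ?thesis
  proof (rule summable_comparison_test'[OF summable_add[OF s3 s2], of 1])
    fix n :: nat assume n: "1 \<le> n"
    have "real n \<le> 2 * real (tfreq n)" unfolding tfreq_def by linarith
    also have "\<dots> \<le> 2 * (pi * real (tfreq n))" using pi_gt3 mult_right_mono[of 1 pi "real (tfreq n)"] by simp
    finally have le: "real n \<le> 2 * (pi * real (tfreq n))" .
    have "\<bar>fourier \<phi> n\<bar> * (real n / 2) \<le> \<bar>fourier \<phi> n\<bar> * (pi * real (tfreq n))" using le by (intro mult_left_mono) auto
    then have f: "\<bar>fourier \<phi> n\<bar> * (real n / 2) \<le> \<bar>fourier \<phi>' (tconj n)\<bar>"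
      using fourier_deriv[OF \<phi> c per, of n] by (simp add: mult.commute)
    define t where "t = \<bar>fourier \<phi>' (tconj n)\<bar>"
    have "\<bar>fourier \<phi> n\<bar> \<le> (2 * inverse (real n)) * t" using f n by (simp add: t_def field_simps)
    also have "\<dots> \<le> (2 * inverse (real n))\<^sup>2 + t\<^sup>2"
      using zero_le_power2[of "2 * inverse (real n) - t"] zero_le_power2[of "2 * inverse (real n)"] zero_le_power2[of t]
      unfolding power2_diff by linarith
    finally show "norm \<bar>fourier \<phi> n\<bar> \<le> 4 * inverse ((real n)\<^sup>2) + (fourier \<phi>' (tconj n))\<^sup>2"
      by (simp add: t_def power_mult_distrib power_inverse)
  qed
qed

section \<open>Pointwise convergence through the Dirichlet kernel\<close>

lemma dirichlet_kernel:
  "(\<Sum>n<2 * K + 1. trig n x * trig n z) = 1 / 2 + (\<Sum>k<K. cos (pi * real (k + 1) * (z - x)))"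
proof (induction K)
  case 0
  then show ?case by (simp add: trig_0)
next
  case (Suc K)
  \<comment> \<open>Each step adds a complete pair of a cosine and a sine, which is why partial sums
    of odd length are used.\<close>
  have "{..<2 * Suc K + 1} = insert (2 * K + 2) (insert (2 * K + 1) {..<2 * K + 1})" by auto
  then have "(\<Sum>n<2 * Suc K + 1. trig n x * trig n z) = trig (2 * K + 2) x * trig (2 * K + 2) z + (trig (2 * K + 1) x * trig (2 * K + 1) z
     + (\<Sum>n<2 * K + 1. trig n x * trig n z))" by simp
  also have "trig (2 * K + 2) x * trig (2 * K + 2) z + (trig (2 * K + 1) x * trig (2 * K + 1) z + (\<Sum>n<2 * K + 1. trig n x * trig n z))
     = cos (pi * real (K + 1) * z - pi * real (K + 1) * x) + (\<Sum>n<2 * K + 1. trig n x * trig n z)"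
    unfolding trig_odd trig_even cos_diff by simp
  also have "\<dots> = 1 / 2 + (\<Sum>k<Suc K. cos (pi * real (k + 1) * (z - x)))"
    unfolding Suc.IH by (simp add: right_diff_distrib)
  finally show ?case .
qed

lemma dirichlet_kernel_sin:
  "2 * sin (pi * t / 2) * (1 / 2 + (\<Sum>k<K. cos (pi * real (k + 1) * t))) = sin (pi * real K * t + pi * t / 2)"
proof (induction K)
  case (Suc K)
  have a: "pi * real (Suc K) * t + pi * t / 2 = pi * real (K + 1) * t + pi * t / 2"
    and b: "pi * real K * t + pi * t / 2 = pi * real (K + 1) * t - pi * t / 2" by (simp_all add: field_simps)
  have "2 * sin (pi * t / 2) * (1 / 2 + (\<Sum>k<Suc K. cos (pi * real (k + 1) * t))) =
    2 * sin (pi * t / 2) * (1 / 2 + (\<Sum>k<K. cos (pi * real (k + 1) * t))) + 2 * sin (pi * t / 2) * cos (pi * real (K + 1) * t)"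
    by (simp add: algebra_simps)
  also have "\<dots> = sin (pi * real (Suc K) * t + pi * t / 2)"
    unfolding Suc a b sin_add sin_diff by simp
  finally show ?case .
qed simp

text \<open>A weak form of Jordan's inequality: in \<open>sin y = 2 sin (y / 2) cos (y / 2)\<close>
  the mean value theorem gives \<open>sin (y / 2) = (y / 2) cos z\<close>, and both cosines are at
  least \<open>sqrt 2 / 2\<close>.\<close>

lemma sin_ge_half:
  assumes "0 \<le> y" "y \<le> pi / 2"
  shows "y / 2 \<le> sin (y::real)"
proof (cases "y = 0")
  case False
  then have y: "0 < y" using assms by simp
  have "\<exists>z>0. z < y / 2 \<and> sin (y / 2) - sin 0 = (y / 2 - 0) * cos z"
    by (rule MVT2) (use y in \<open>auto intro!: derivative_eq_intros\<close>)
  then obtain z where z: "0 < z" "z < y / 2" "sin (y / 2) = y / 2 * cos z" by auto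
  have c: "sqrt 2 / 2 \<le> cos w" if "0 \<le> w" "w \<le> pi / 4" for w
    using cos_monotone_0_pi_le[of w "pi/4"] that cos_45 by auto
  have c0: "0 \<le> cos z" using c[of z] z y assms real_sqrt_ge_zero[of 2] by linarith
  have "1 / 2 = (sqrt 2 / 2) * (sqrt 2 / 2)" by simp
  also have "\<dots> \<le> cos z * cos (y / 2)"
    using c[of z] c[of "y / 2"] z y assms c0 by (intro mult_mono) auto
  finally have "y * (1 / 2) \<le> y * (cos z * cos (y / 2))" using y by (intro mult_left_mono) auto
  also have "\<dots> = 2 * sin (y / 2) * cos (y / 2)" by (simp add: z(3))
  also have "\<dots> = sin y" using sin_double[of "y / 2"] by simp
  finally show ?thesis by simp
qed simp

text \<open>The sine has simple zeros at 0 and at both ends of \<open>[-2, 2]\<close>. The symmetry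
  exchanging \<open>s\<close> and \<open>2 - s\<close> reduces the far half to the near one.\<close>

lemma abs_sin_lower:
  assumes "\<bar>t\<bar> \<le> 2"
  shows "\<bar>t\<bar> * (2 - \<bar>t\<bar>) / 4 \<le> \<bar>sin (pi * t / 2)\<bar>"
proof -
  define s where "s = \<bar>t\<bar>"
  have s: "0 \<le> s" "s \<le> 2" using assms by (auto simp: s_def)
  have "\<bar>sin (pi * t / 2)\<bar> = \<bar>sin (pi * s / 2)\<bar>" by (cases "0 \<le> t") (auto simp: s_def)
  moreover have "s * (2 - s) / 4 \<le> sin (pi * s / 2)"
  proof (cases "s \<le> 1")
    case True
    have "pi * s \<le> pi * 1" using True by (intro mult_left_mono) auto
    then have 1: "pi * s / 2 / 2 \<le> sin (pi * s / 2)" using s by (intro sin_ge_half) auto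
    have "s * (2 - s) \<le> s * pi" using s pi_gt3 by (intro mult_left_mono) auto
    then show ?thesis using 1 by (simp add: mult.commute)
  next
    case False
    have e: "sin (pi * s / 2) = sin (pi * (2 - s) / 2)"
      using sin_pi_minus[of "pi * s / 2"] by (simp add: field_simps)
    have "pi * (2 - s) \<le> pi * 1" using False by (intro mult_left_mono) auto
    then have 1: "pi * (2 - s) / 2 / 2 \<le> sin (pi * (2 - s) / 2)" using s by (intro sin_ge_half) auto
    have "s * (2 - s) \<le> pi * (2 - s)" using s pi_gt3 by (intro mult_right_mono) auto
    then show ?thesis using 1 unfolding e by simp
  qed
  ultimately show ?thesis unfolding s_def[symmetric] by linarith
qed

lemma fourier_tendsto_0:
  assumes "f \<in> borel_measurable circle" "integrable circle (\<lambda>z. (f z)\<^sup>2)"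
  shows "fourier f \<longlonglongrightarrow> 0"
proof -
  have "(\<lambda>n. (fourier f n)\<^sup>2) \<longlonglongrightarrow> 0"
    unfolding fourier_def by (rule summable_LIMSEQ_zero[OF trig.bessel_summable[OF assms]])
  then have "(\<lambda>n. sqrt ((fourier f n)\<^sup>2)) \<longlonglongrightarrow> sqrt 0" by (intro tendsto_intros)
  then show ?thesis by (simp add: tendsto_rabs_zero_iff)
qed

text \<open>The half frequency is absorbed into \<open>g1\<close> and \<open>g2\<close>. The
  integral is then a combination of their Fourier coefficients, which tend to zero by Bessel's
  inequality, with the bounded factors \<open>cos (c K)\<close> and \<open>sin (c K)\<close>; so the
  phase may vary with \<open>K\<close>.\<close>

lemma riemann_lebesgue_dirichlet:
  assumes g [measurable]: "g \<in> borel_measurable circle" and bd: "\<And>z. z \<in> {0..2} \<Longrightarrow> \<bar>g z\<bar> \<le> C"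
  shows "(\<lambda>K. \<integral>z. g z * sin (pi * real K * z + pi * z / 2 - c K) \<partial>circle) \<longlonglongrightarrow> 0"
proof -
  have m[measurable]: "(\<lambda>z. cos (pi * z / 2)) \<in> borel_measurable circle" "(\<lambda>z. sin (pi * z / 2)) \<in> borel_measurable circle"
    by (intro circle_continuous_measurable continuous_intros; simp)+
  define g1 where "g1 z = g z * cos (pi * z / 2)" for z
  define g2 where "g2 z = g z * sin (pi * z / 2)" for z
  have gm[measurable]: "g1 \<in> borel_measurable circle" "g2 \<in> borel_measurable circle"
    unfolding g1_def[abs_def] g2_def[abs_def] by measurable
  have b: "\<bar>g1 z\<bar> \<le> C" "\<bar>g2 z\<bar> \<le> C" if "z \<in> {0..2}" for z
    using bd[OF that] mult_mono[of "\<bar>g z\<bar>" C "\<bar>cos (pi * z / 2)\<bar>" 1] mult_mono[of "\<bar>g z\<bar>" C "\<bar>sin (pi * z / 2)\<bar>" 1]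
    by (auto simp: g1_def g2_def abs_mult)
  have sp: "space circle = {0..2}" by (simp add: space_restrict_space)
  have sq: "integrable circle (\<lambda>z. (h z)\<^sup>2)" if [measurable]: "h \<in> borel_measurable circle" and "\<And>z. z \<in> {0..2} \<Longrightarrow> \<bar>h z\<bar> \<le> C" for h
    by (rule trig.bounded_integrable[where K="C\<^sup>2"]) (use that in \<open>auto simp: sp abs_le_square_iff[symmetric]\<close>, force simp: sp)
  have l: "fourier g1 \<longlonglongrightarrow> 0" "fourier g2 \<longlonglongrightarrow> 0" by (intro fourier_tendsto_0 gm sq b; simp)+
  have sub: "(\<lambda>K. h (2 * K + 1)) \<longlonglongrightarrow> 0" "(\<lambda>K. h (2 * K + 2)) \<longlonglongrightarrow> 0" if "h \<longlonglongrightarrow> 0" for h :: "nat \<Rightarrow> real"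
    using LIMSEQ_subseq_LIMSEQ[OF that, of "\<lambda>K. 2 * K + 1"] LIMSEQ_subseq_LIMSEQ[OF that, of "\<lambda>K. 2 * K + 2"]
    by (auto simp: strict_mono_def o_def)
  have I: "integrable circle (\<lambda>z. h z * trig n z)" if [measurable]: "h \<in> borel_measurable circle" and "\<And>z. z \<in> {0..2} \<Longrightarrow> \<bar>h z\<bar> \<le> C" for h n
    by (rule trig.square_integrable_mult_bounded[OF _ _ sq trig_bound]) (use that in auto)
  \<comment> \<open>Stated at \<open>Suc K\<close> because \<open>trig (2 * K + 1)\<close> and
    \<open>trig (2 * K + 2)\<close> have frequency \<open>K + 1\<close>.\<close>
  have eq: "(\<integral>z. g z * sin (pi * real (Suc K) * z + pi * z / 2 - c (Suc K)) \<partial>circle) =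
     cos (c (Suc K)) * (fourier g1 (2 * K + 2) + fourier g2 (2 * K + 1)) - sin (c (Suc K)) * (fourier g1 (2 * K + 1) - fourier g2 (2 * K + 2))" for K
  proof -
    define s where "s = sin (c (Suc K))"
    define d where "d = cos (c (Suc K))"
    have pt: "g z * sin (pi * real (Suc K) * z + pi * z / 2 - c (Suc K)) =
      d * (g1 z * trig (2 * K + 2) z + g2 z * trig (2 * K + 1) z) - s * (g1 z * trig (2 * K + 1) z - g2 z * trig (2 * K + 2) z)" for z
      unfolding trig_odd trig_even g1_def g2_def s_def d_def sin_diff sin_add cos_add by (simp add: algebra_simps)
    note J = I[OF gm(1) b(1), of "2 * K + 2"] I[OF gm(2) b(2), of "2 * K + 1"]
      I[OF gm(1) b(1), of "2 * K + 1"] I[OF gm(2) b(2), of "2 * K + 2"]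
    have A: "integrable circle (\<lambda>z. d * (g1 z * trig (2 * K + 2) z + g2 z * trig (2 * K + 1) z))"
      by (intro integrable_mult_right Bochner_Integration.integrable_add J)
    have B: "integrable circle (\<lambda>z. s * (g1 z * trig (2 * K + 1) z - g2 z * trig (2 * K + 2) z))"
      by (intro integrable_mult_right Bochner_Integration.integrable_diff J)
    show ?thesis
      unfolding pt fourier_def s_def[symmetric] d_def[symmetric] Bochner_Integration.integral_diff[OF A B]
      by (simp only: integral_mult_right_zero Bochner_Integration.integral_add[OF J(1,2)] Bochner_Integration.integral_diff[OF J(3,4)])
  qed
  have z: "(\<lambda>K. a K * h K) \<longlonglongrightarrow> 0" if "h \<longlonglongrightarrow> 0" "\<And>K. \<bar>a K\<bar> \<le> 1" for a h :: "nat \<Rightarrow> real"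
  proof (rule tendsto_rabs_zero_cancel, rule tendsto_sandwich[OF _ _ tendsto_const])
    show "(\<lambda>K. \<bar>h K\<bar>) \<longlonglongrightarrow> 0" using that(1) by (rule tendsto_rabs_zero)
    show "\<forall>\<^sub>F K in sequentially. \<bar>a K * h K\<bar> \<le> \<bar>h K\<bar>"
      using that(2) by (intro always_eventually allI) (simp add: abs_mult mult_left_le_one_le)
  qed auto
  have t1: "(\<lambda>K. fourier g1 (2 * K + 2) + fourier g2 (2 * K + 1)) \<longlonglongrightarrow> 0"
    by (rule tendsto_add_zero[OF sub(2)[OF l(1)] sub(1)[OF l(2)]])
  have t2: "(\<lambda>K. fourier g1 (2 * K + 1) - fourier g2 (2 * K + 2)) \<longlonglongrightarrow> 0"
    using tendsto_diff[OF sub(1)[OF l(1)] sub(2)[OF l(2)]] by simp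
  have "(\<lambda>K. \<integral>z. g z * sin (pi * real (Suc K) * z + pi * z / 2 - c (Suc K)) \<partial>circle) \<longlonglongrightarrow> 0 - 0"
    unfolding eq by (intro tendsto_diff z t1 t2) auto
  then show ?thesis unfolding diff_zero by (rule LIMSEQ_imp_Suc)
qed

text \<open>Dini's criterion: \<open>\<phi>\<close> is Lipschitz, so the quotient \<open>g\<close>
  is bounded and the error is a Riemann-Lebesgue integral. An interior \<open>x\<close> keeps
  \<open>\<bar>z - x\<bar>\<close> away from 2, the other zero of the denominator.\<close>

lemma fourier_inversion:
  assumes \<phi>: "\<And>z. (\<phi> has_real_derivative \<phi>' z) (at z)" and c: "continuous_on UNIV \<phi>'" and x: "0 < x" "x < 2"
  shows "(\<lambda>K. \<Sum>n<2 * K + 1. fourier \<phi> n * trig n x) \<longlonglongrightarrow> \<phi> x"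
proof -
  have \<phi>c: "continuous_on A \<phi>" for A using \<phi> by (intro continuous_at_imp_continuous_on ballI DERIV_isCont) auto
  have "bounded (\<phi>' ` {0..2})" by (intro compact_imp_bounded compact_continuous_image continuous_on_subset[OF c]) auto
  then obtain L where "\<forall>z\<in>{0..2}. \<bar>\<phi>' z\<bar> \<le> L" by (auto simp: bounded_iff)
  then have L: "\<And>z. z \<in> {0..2} \<Longrightarrow> \<bar>\<phi>' z\<bar> \<le> L" by blast
  have L0: "0 \<le> L" using L[of 0] by force
  have lip: "\<bar>\<phi> z - \<phi> x\<bar> \<le> L * \<bar>z - x\<bar>" if "z \<in> {0..2}" for z
  proof -
    have "norm (\<phi> z - \<phi> x) \<le> L * norm (z - x)"
      by (rule field_differentiable_bound[where S="{0..2}" and f'=\<phi>'])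
        (use that x L in \<open>auto intro: has_field_derivative_at_within \<phi>\<close>)
    then show ?thesis by simp
  qed
  define g where "g z = (\<phi> z - \<phi> x) / (2 * sin (pi * (z - x) / 2))" for z
  define m where "m = min x (2 - x)"
  have m: "0 < m" using x by (simp add: m_def)
  have ts: "\<bar>z - x\<bar> \<le> 2 - m" if "z \<in> {0..2}" for z using that x by (auto simp: m_def abs_le_iff)
  have gb: "\<bar>g z\<bar> \<le> 2 * L / m" if z: "z \<in> {0..2}" for z
  proof (cases "z = x")
    case True then show ?thesis using L0 m by (simp add: g_def)
  next
    case False
    define t where "t = \<bar>z - x\<bar>"
    have t: "0 < t" "t \<le> 2 - m" using False ts[OF z] by (auto simp: t_def)
    have s1: "t * (2 - t) / 4 \<le> \<bar>sin (pi * (z - x) / 2)\<bar>" unfolding t_def using ts[OF z] m by (intro abs_sin_lower) auto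
    have "t * m \<le> t * (2 - t)" using t by (intro mult_left_mono) auto
    then have s2: "t * m / 2 \<le> \<bar>2 * sin (pi * (z - x) / 2)\<bar>" using s1 by (simp add: abs_mult)
    have p: "0 < t * m / 2" using t m by simp
    have "\<bar>g z\<bar> \<le> (L * t) / (t * m / 2)"
      unfolding g_def abs_divide using lip[OF z] s2 p L0 t by (intro frac_le) (auto simp: t_def)
    also have "\<dots> = 2 * L / m" using t m by simp
    finally show ?thesis .
  qed
  have gm: "g \<in> borel_measurable circle"
    unfolding g_def[abs_def] by (intro borel_measurable_divide circle_continuous_measurable continuous_intros \<phi>c) auto
  define D where "D K t = 1 / 2 + (\<Sum>k<K. cos (pi * real (k + 1) * t))" for K t
  have Dc: "continuous_on A (\<lambda>z. D K (z - x))" for A K unfolding D_def by (intro continuous_intros)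
  have D1: "(\<integral>z. D K (z - x) \<partial>circle) = 1" for K
  proof -
    have e: "cos (pi * real (k + 1) * (z - x)) = cos (pi * of_int (int k + 1) * z - pi * real (k + 1) * x)" for k z
      by (simp add: algebra_simps)
    have i: "integrable circle (\<lambda>z. cos (pi * of_int (int k + 1) * z - pi * real (k + 1) * x))" for k
      by (intro circle_continuous_integrable continuous_intros)
    have i0: "integrable circle (\<lambda>z. 1 / 2 :: real)" by (intro circle_continuous_integrable continuous_intros)
    have "(\<integral>z. D K (z - x) \<partial>circle) = (\<integral>z. 1 / 2 \<partial>circle) + (\<Sum>k<K. \<integral>z. cos (pi * of_int (int k + 1) * z - pi * real (k + 1) * x) \<partial>circle)"
      unfolding D_def e using i i0 by (simp only: Bochner_Integration.integral_add Bochner_Integration.integral_sum Bochner_Integration.integrable_sum)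
    also have "(\<Sum>k<K. \<integral>z. cos (pi * of_int (int k + 1) * z - pi * real (k + 1) * x) \<partial>circle) = 0"
      by (intro sum.neutral ballI) (simp only: circle_cos, simp)
    also have "(\<integral>z. 1 / 2 \<partial>circle) = (1::real)" using circle_cos[of 0 0] by simp
    finally show ?thesis by simp
  qed
  have S: "(\<Sum>n<2 * K + 1. fourier \<phi> n * trig n x) - \<phi> x = (\<integral>z. g z * sin (pi * real K * z + pi * z / 2 - (pi * real K * x + pi * x / 2)) \<partial>circle)" for K
  proof -
    have i: "integrable circle (\<lambda>z. \<phi> z * trig n z * trig n x)" for n
      by (intro circle_continuous_integrable continuous_intros \<phi>c)
    have "(\<Sum>n<2 * K + 1. fourier \<phi> n * trig n x) = (\<integral>z. (\<Sum>n<2 * K + 1. \<phi> z * trig n z * trig n x) \<partial>circle)"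
      unfolding fourier_def by (simp only: Bochner_Integration.integral_sum[OF i] integral_mult_left_zero)
    also have "\<dots> = (\<integral>z. \<phi> z * D K (z - x) \<partial>circle)"
    proof -
      have "(\<Sum>n<2 * K + 1. \<phi> z * trig n z * trig n x) = \<phi> z * D K (z - x)" for z
        unfolding D_def dirichlet_kernel[symmetric] by (simp only: sum_distrib_left mult_ac)
      then show ?thesis by simp
    qed
    finally have 1: "(\<Sum>n<2 * K + 1. fourier \<phi> n * trig n x) = (\<integral>z. \<phi> z * D K (z - x) \<partial>circle)" .
    have i1: "integrable circle (\<lambda>z. \<phi> z * D K (z - x))" "integrable circle (\<lambda>z. \<phi> x * D K (z - x))"
      by (intro circle_continuous_integrable continuous_intros \<phi>c Dc)+
    have "(\<Sum>n<2 * K + 1. fourier \<phi> n * trig n x) - \<phi> x = (\<integral>z. \<phi> z * D K (z - x) - \<phi> x * D K (z - x) \<partial>circle)"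
      unfolding Bochner_Integration.integral_diff[OF i1] by (simp only: 1 integral_mult_right_zero D1 mult_1_right)
    also have "\<dots> = (\<integral>z. g z * sin (pi * real K * z + pi * z / 2 - (pi * real K * x + pi * x / 2)) \<partial>circle)"
    proof (rule Bochner_Integration.integral_cong[OF refl])
      fix z assume "z \<in> space circle"
      then have z: "z \<in> {0..2}" by (simp add: space_restrict_space)
      show "\<phi> z * D K (z - x) - \<phi> x * D K (z - x) = g z * sin (pi * real K * z + pi * z / 2 - (pi * real K * x + pi * x / 2))"
      proof (cases "z = x")
        \<comment> \<open>Both sides vanish: \<open>g x\<close> is 0 divided by 0, hence 0.\<close>
        case True then show ?thesis by (simp add: g_def)
      next
        case False
        have "0 < \<bar>z - x\<bar> * (2 - \<bar>z - x\<bar>) / 4" using False ts[OF z] m by (intro divide_pos_pos mult_pos_pos) auto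
        also have "\<dots> \<le> \<bar>sin (pi * (z - x) / 2)\<bar>" using ts[OF z] m by (intro abs_sin_lower) auto
        finally have nz: "sin (pi * (z - x) / 2) \<noteq> 0" by simp
        have "2 * sin (pi * (z - x) / 2) * D K (z - x) = sin (pi * real K * (z - x) + pi * (z - x) / 2)"
          unfolding D_def by (rule dirichlet_kernel_sin)
        also have "pi * real K * (z - x) + pi * (z - x) / 2 = pi * real K * z + pi * z / 2 - (pi * real K * x + pi * x / 2)"
          by (simp add: field_simps)
        finally show ?thesis using nz unfolding g_def by (simp add: field_simps)
      qed
    qed
    finally show ?thesis .
  qed
  have "(\<lambda>K. (\<Sum>n<2 * K + 1. fourier \<phi> n * trig n x) - \<phi> x) \<longlonglongrightarrow> 0"
    unfolding S by (rule riemann_lebesgue_dirichlet[OF gm gb])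
  then show ?thesis by (rule LIM_zero_cancel)
qed

text \<open>Absolute summability of the coefficients of \<open>\<phi>\<close> bounds all its partial
  sums by \<open>T\<close>, so dominated convergence applies against a merely continuous
  \<open>G\<close>. Inversion holds inside the interval, and the end points are a null set.\<close>

lemma parseval_smooth:
  assumes \<phi>: "\<And>z. (\<phi> has_real_derivative \<phi>' z) (at z)" and c: "continuous_on UNIV \<phi>'" and per: "\<phi> 2 = \<phi> 0"
    and G: "continuous_on {0..2} G"
  shows "(\<lambda>n. fourier \<phi> n * fourier G n) sums (\<integral>z. \<phi> z * G z \<partial>circle)"
proof -
  have \<phi>c: "continuous_on A \<phi>" for A using \<phi> by (intro continuous_at_imp_continuous_on ballI DERIV_isCont) auto
  note sm = fourier_summable[OF \<phi> c per]
  define T where "T = (\<Sum>n. \<bar>fourier \<phi> n\<bar>)"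
  have sp: "space circle = {0..2}" by (simp add: space_restrict_space)
  have GI: "integrable circle G" by (rule circle_continuous_integrable[OF G])
  have "bounded (G ` {0..2})" by (intro compact_imp_bounded compact_continuous_image G) auto
  then obtain C where C: "\<forall>z\<in>{0..2}. \<bar>G z\<bar> \<le> C" by (auto simp: bounded_iff)
  have Gb: "\<bar>fourier G n\<bar> \<le> (\<integral>z. \<bar>G z\<bar> \<partial>circle)" for n
  proof -
    have i: "integrable circle (\<lambda>z. G z * trig n z)" by (intro circle_continuous_integrable continuous_intros G trig_continuous)
    have "\<bar>fourier G n\<bar> \<le> (\<integral>z. \<bar>G z * trig n z\<bar> \<partial>circle)" unfolding fourier_def by (rule integral_abs_bound)
    also have "\<dots> \<le> (\<integral>z. \<bar>G z\<bar> \<partial>circle)"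
      by (intro integral_mono integrable_abs i GI) (auto simp: abs_mult intro!: mult_left_le trig_bound)
    finally show ?thesis .
  qed
  have s: "summable (\<lambda>n. fourier \<phi> n * fourier G n)"
    by (rule summable_comparison_test'[OF summable_mult2[OF sm, of "\<integral>z. \<bar>G z\<bar> \<partial>circle"], of 0])
      (use Gb in \<open>auto simp: abs_mult intro!: mult_left_mono\<close>)
  have "(\<lambda>K. \<integral>z. (\<Sum>n<2 * K + 1. fourier \<phi> n * trig n z) * G z \<partial>circle) \<longlonglongrightarrow> (\<integral>z. \<phi> z * G z \<partial>circle)"
  proof (rule integral_dominated_convergence[where w="\<lambda>z. T * \<bar>G z\<bar>"])
    show "(\<lambda>z. \<phi> z * G z) \<in> borel_measurable circle"
      by (intro circle_continuous_measurable continuous_intros \<phi>c G)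
    show "(\<lambda>z. (\<Sum>n<2 * K + 1. fourier \<phi> n * trig n z) * G z) \<in> borel_measurable circle" for K
      by (intro circle_continuous_measurable continuous_intros trig_continuous G)
    show "integrable circle (\<lambda>z. T * \<bar>G z\<bar>)" using GI by simp
    have null: "AE z in lborel. z \<noteq> 0 \<and> z \<noteq> (2::real)"
      by (intro AE_conjI AE_lborel_singleton)
    show "AE z in circle. (\<lambda>K. (\<Sum>n<2 * K + 1. fourier \<phi> n * trig n z) * G z) \<longlonglongrightarrow> \<phi> z * G z"
    proof (subst AE_restrict_space_iff, simp, use null in eventually_elim)
      case (elim z)
      show ?case by (intro impI tendsto_mult tendsto_const fourier_inversion[OF \<phi> c]) (use elim in auto)
    qed
    show "AE z in circle. norm ((\<Sum>n<2 * K + 1. fourier \<phi> n * trig n z) * G z) \<le> T * \<bar>G z\<bar>" for K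
    proof (intro AE_I2)
      fix z
      have "\<bar>\<Sum>n<N. fourier \<phi> n * trig n z\<bar> \<le> T" for N
      proof -
        have "\<bar>\<Sum>n<N. fourier \<phi> n * trig n z\<bar> \<le> (\<Sum>n<N. \<bar>fourier \<phi> n\<bar>)"
          by (rule order_trans[OF sum_abs]) (auto simp: abs_mult intro!: sum_mono mult_left_le trig_bound)
        also have "\<dots> \<le> T" unfolding T_def by (intro sum_le_suminf sm) auto
        finally show ?thesis .
      qed
      from this[of "2 * K + 1"] show "norm ((\<Sum>n<2 * K + 1. fourier \<phi> n * trig n z) * G z) \<le> T * \<bar>G z\<bar>"
        unfolding real_norm_def abs_mult by (intro mult_right_mono) auto
    qed
  qed
  moreover have "(\<integral>z. (\<Sum>n<2 * K + 1. fourier \<phi> n * trig n z) * G z \<partial>circle) = (\<Sum>n<2 * K + 1. fourier \<phi> n * fourier G n)" for K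
  proof -
    have i: "integrable circle (\<lambda>z. fourier \<phi> n * (G z * trig n z))" for n
      by (intro circle_continuous_integrable continuous_intros trig_continuous G)
    have "(\<integral>z. (\<Sum>n<2 * K + 1. fourier \<phi> n * trig n z) * G z \<partial>circle) = (\<integral>z. (\<Sum>n<2 * K + 1. fourier \<phi> n * (G z * trig n z)) \<partial>circle)"
      by (intro Bochner_Integration.integral_cong refl) (simp only: sum_distrib_right mult.assoc mult.commute[of "G _"])
    then show ?thesis by (simp only: Bochner_Integration.integral_sum[OF i] integral_mult_right_zero fourier_def[of G])
  qed
  moreover have "(\<lambda>K. \<Sum>n<2 * K + 1. fourier \<phi> n * fourier G n) \<longlonglongrightarrow> (\<Sum>n. fourier \<phi> n * fourier G n)"
    using LIMSEQ_subseq_LIMSEQ[OF summable_LIMSEQ[OF s], of "\<lambda>K. 2 * K + 1"] by (simp add: strict_mono_def o_def)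
  ultimately have "(\<Sum>n. fourier \<phi> n * fourier G n) = (\<integral>z. \<phi> z * G z \<partial>circle)" using LIMSEQ_unique by simp
  then show ?thesis using summable_sums[OF s] by simp
qed

section \<open>The force density\<close>

lemma norm_vec3_power2: "(norm (v :: real^3))\<^sup>2 = (\<Sum>j\<in>UNIV. (v $ j)\<^sup>2)"
  unfolding power2_norm_eq_inner inner_vec_def by (simp add: power2_eq_square)

lemma L2_T_measurable_component:
  assumes "L2_T f"
  shows "(\<lambda>z. f z $ j) \<in> borel_measurable circle"
proof -
  have [measurable]: "f \<in> borel_measurable borel" using assms by (simp add: L2_T_def)
  have "(\<lambda>v::real^3. v $ j) \<in> borel_measurable borel" by (intro borel_measurable_continuous_onI continuous_intros)
  then have "(\<lambda>z. f z $ j) \<in> borel_measurable borel" by measurable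
  then show ?thesis by (rule circle_measurable)
qed

lemma L2_T_component_square:
  assumes "L2_T f"
  shows "integrable circle (\<lambda>z. (f z $ j)\<^sup>2)"
proof (rule Bochner_Integration.integrable_bound)
  show "integrable circle (\<lambda>z. (norm (f z))\<^sup>2)" using assms by (simp add: L2_T_def circle_integrable)
  show "(\<lambda>z. (f z $ j)\<^sup>2) \<in> borel_measurable circle" using L2_T_measurable_component[OF assms] by measurable
  show "AE z in circle. norm ((f z $ j)\<^sup>2) \<le> norm ((norm (f z))\<^sup>2)"
    using component_le_norm_cart by (intro AE_I2) (simp add: abs_le_square_iff[symmetric])
qed

lemma L2_norm_power2:
  assumes "L2_T f"
  shows "(L2_norm f)\<^sup>2 = (\<Sum>j\<in>UNIV. \<integral>z. (f z $ j)\<^sup>2 \<partial>circle)"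
proof -
  have "0 \<le> (\<integral>z. (norm (f z))\<^sup>2 \<partial>circle)" by (intro integral_nonneg_AE) auto
  then have "(L2_norm f)\<^sup>2 = (\<integral>z. (norm (f z))\<^sup>2 \<partial>circle)" by (simp add: L2_norm_def circle_integral)
  also have "\<dots> = (\<Sum>j\<in>UNIV. \<integral>z. (f z $ j)\<^sup>2 \<partial>circle)"
    unfolding norm_vec3_power2 by (intro Bochner_Integration.integral_sum L2_T_component_square assms)
  finally show ?thesis .
qed

lemma L2_T_scaleR_component:
  assumes f: "L2_T f" and h: "continuous_on UNIV h"
  shows "(LBINT z:{0..2}. h z *\<^sub>R f z) $ j = (\<integral>z. f z $ j * h z \<partial>circle)"
proof -
  have i: "integrable circle (\<lambda>z. f z $ k * h z)" for k
    unfolding circle_integrable by (rule L2_T_component_integrable[OF f h])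
  have eq: "h z *\<^sub>R f z = (\<Sum>k\<in>UNIV. (f z $ k * h z) *\<^sub>R axis k 1)" for z
    by (simp add: vec_eq_iff axis_def if_distrib mult.commute cong: if_cong)
  have "integrable circle (\<lambda>z. h z *\<^sub>R f z)"
    unfolding eq by (intro Bochner_Integration.integrable_sum integrable_scaleR_left i)
  from integral_bounded_linear[OF bounded_linear_vec_nth this, of j] show ?thesis
    by (simp add: circle_integral mult.commute)
qed

lemma test_function_trig: "test_function (trig n)"
proof -
  have "\<exists>A k. (deriv ^^ m) (trig n) = (\<lambda>z. A * trig k z)" for m
  proof (induction m)
    case 0
    show ?case by (rule exI[of _ 1], rule exI[of _ n]) simp
  next
    case (Suc m)
    then obtain A k where e: "(deriv ^^ m) (trig n) = (\<lambda>z. A * trig k z)" by blast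
    have "deriv (\<lambda>z. A * trig k z) z = A * (tsign k * (pi * real (tfreq k))) * trig (tconj k) z" for z
      using DERIV_imp_deriv[OF DERIV_cmult[OF trig_deriv[of k z], of A]] by simp
    then show ?case using e by auto
  qed
  then have "(deriv ^^ m) (trig n) differentiable (at z)" for m z
    using DERIV_cmult[OF trig_deriv] by (metis real_differentiable_def)
  then show ?thesis by (simp add: test_function_def periodic2_def trig_periodic)
qed

text \<open>The test function \<open>trig (tconj n)\<close> has a derivative proportional to
  \<open>trig n\<close>, so the definition of the weak derivative is itself the relation between the
  coefficients.\<close>

lemma weak_deriv_fourier:
  assumes f: "L2_T f" and g: "L2_T g" and w: "has_weak_deriv f g"
  shows "pi * real (tfreq n) * \<bar>fourier (\<lambda>z. f z $ j) n\<bar> = \<bar>fourier (\<lambda>z. g z $ j) (tconj n)\<bar>"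
proof -
  have d: "deriv (trig (tconj n)) = (\<lambda>z. (tsign (tconj n) * (pi * real (tfreq n))) * trig n z)"
    using DERIV_imp_deriv[OF trig_deriv[of "tconj n"]] by (auto simp: fun_eq_iff tfreq_tconj tconj_tconj)
  have c: "continuous_on UNIV (deriv (trig (tconj n)))" unfolding d by (intro continuous_intros trig_continuous)
  have "(LBINT z:{0..2}. deriv (trig (tconj n)) z *\<^sub>R f z) = - (LBINT z:{0..2}. trig (tconj n) z *\<^sub>R g z)"
    using w test_function_trig by (simp add: has_weak_deriv_def)
  from arg_cong[OF this, of "\<lambda>v. v $ j"]
  have "(\<integral>z. f z $ j * deriv (trig (tconj n)) z \<partial>circle) = - (\<integral>z. g z $ j * trig (tconj n) z \<partial>circle)"
    using L2_T_scaleR_component[OF f c, where j=j] L2_T_scaleR_component[OF g trig_continuous, where j=j] by simp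
  then have "(tsign (tconj n) * (pi * real (tfreq n))) * fourier (\<lambda>z. f z $ j) n = - fourier (\<lambda>z. g z $ j) (tconj n)"
    unfolding d fourier_def by (simp add: mult.left_commute[of "f _ $ j"])
  from arg_cong[OF this, of abs] show ?thesis by (simp add: abs_mult abs_tsign)
qed

text \<open>The Riesz-Fischer functions live on one period only. They are cut off there, which makes
  them Borel measurable on the line, and extended periodically.\<close>

lemma L2_T_of_components:
  assumes F: "\<And>j::3. F j \<in> borel_measurable circle" and F2: "\<And>j. integrable circle (\<lambda>z. (F j z)\<^sup>2)"
  obtains f where "L2_T f" "\<forall>j. AE z in circle. f z $ j = F j z"
proof -
  define E where "E j z = indicator {0..2} z *\<^sub>R F j z" for j z
  have Em [measurable]: "E j \<in> borel_measurable borel" for j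
    using F[of j] borel_measurable_restrict_space_iff[of "{0..2::real}" lborel "F j"] by (simp add: E_def[abs_def])
  \<comment> \<open>\<open>per\<close> maps into \<open>[0, 2)\<close>, so \<open>f\<close> takes at
    2 its value at 0; this is why equality holds only almost everywhere.\<close>
  define per where "per z = z - 2 * of_int \<lfloor>z / 2\<rfloor>" for z :: real
  have [measurable]: "per \<in> borel_measurable borel" unfolding per_def[abs_def] by measurable
  define f where "f z = (\<Sum>j\<in>UNIV. E j (per z) *\<^sub>R axis j (1::real))" for z
  have fj: "f z $ j = E j (per z)" for z j
    by (simp add: f_def axis_def if_distrib cong: if_cong)
  have null: "AE z in circle. z \<noteq> 2"
    by (subst AE_restrict_space_iff, simp, use AE_lborel_singleton[of "2::real"] in eventually_elim) auto
  have "AE z in circle. z \<in> {0..2}"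
    using AE_space[of circle] by (simp add: space_restrict_space)
  then have AEall: "AE z in circle. \<forall>j. f z $ j = F j z"
    using null
  proof eventually_elim
    case (elim z)
    then have "\<lfloor>z / 2\<rfloor> = 0" by (intro floor_unique) auto
    then show ?case using elim by (simp add: fj per_def E_def)
  qed
  have fm: "f \<in> borel_measurable borel"
    unfolding f_def[abs_def] by measurable
  have "integrable circle (\<lambda>z. (norm (f z))\<^sup>2)"
  proof (rule integrable_cong_AE_imp)
    show "integrable circle (\<lambda>z. \<Sum>j\<in>UNIV. (F j z)\<^sup>2)" by (intro Bochner_Integration.integrable_sum F2)
    show "(\<lambda>z. (norm (f z))\<^sup>2) \<in> borel_measurable circle" using fm by (intro circle_measurable) measurable
    show "AE z in circle. (\<Sum>j\<in>UNIV. (F j z)\<^sup>2) = (norm (f z))\<^sup>2"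
      using AEall by eventually_elim (simp add: norm_vec3_power2)
  qed
  moreover have "periodic2 f"
  proof -
    have "per (z + 2) = per z" for z
    proof -
      have "\<lfloor>(z + 2) / 2\<rfloor> = \<lfloor>z / 2\<rfloor> + 1" by (simp add: add_divide_distrib)
      then show ?thesis by (simp add: per_def)
    qed
    then show ?thesis by (simp add: periodic2_def f_def)
  qed
  ultimately have "L2_T f" using fm by (simp add: L2_T_def circle_integrable)
  moreover have "\<forall>j. AE z in circle. f z $ j = F j z"
  proof
    show "AE z in circle. f z $ j = F j z" for j using AEall by eventually_elim simp
  qed
  ultimately show ?thesis by (rule that)
qed

context stokes_flow
begin

text \<open>At a fixed radius above \<open>\<epsilon>\<close> the integrand is continuous, so
  pairing with an axial weight is integration against a continuous function of \<open>z\<close>.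
  This is the form that \<open>parseval_smooth\<close> needs.\<close>

lemma cint_as_circle:
  assumes h: "continuous_on \<Omega> h" and a: "continuous_on UNIV \<alpha>" and r: "\<epsilon> < r"
  obtains G where "continuous_on {0..2} G" "\<And>\<gamma>. continuous_on UNIV \<gamma> \<Longrightarrow> cint h \<alpha> \<gamma> r = (\<integral>z. \<gamma> z * G z \<partial>circle)"
proof -
  have c1: "continuous_on A (\<lambda>q. h (cyl r (fst q) (snd q)) * \<alpha> (fst q))" for A
    using cint_continuous[OF eps h a continuous_on_const r, of A 1] by simp
  define G where "G z = integral {0..2*pi} (\<lambda>\<theta>. h (cyl r \<theta> z) * \<alpha> \<theta>)" for z
  have "continuous_on ({0..2} \<times> cbox 0 (2*pi)) (\<lambda>q. h (cyl r (snd q) (fst q)) * \<alpha> (snd q))"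
    using continuous_on_compose2[OF c1[of UNIV] continuous_on_swap, of "{0..2} \<times> cbox 0 (2*pi)"] by (simp add: prod.swap_def)
  then have Gc: "continuous_on {0..2} G"
    unfolding G_def[abs_def] using integral_continuous_on_param[of "{0..2}" 0 "2*pi" "\<lambda>z \<theta>. h (cyl r \<theta> z) * \<alpha> \<theta>"]
    by (simp add: case_prod_unfold)
  have "cint h \<alpha> \<gamma> r = (\<integral>z. \<gamma> z * G z \<partial>circle)" if \<gamma>: "continuous_on UNIV \<gamma>" for \<gamma>
  proof -
    let ?f = "\<lambda>q. h (cyl r (fst q) (snd q)) * \<alpha> (fst q) * \<gamma> (snd q)"
    have c: "continuous_on (cbox (0, 0) (2*pi, 2)) ?f" by (rule cint_continuous[OF eps h a \<gamma> r])
    have "cint h \<alpha> \<gamma> r = integral {0..2*pi} (\<lambda>\<theta>. integral {0..2} (\<lambda>z. ?f (\<theta>, z)))"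
      unfolding cint_def using integral_prod_continuous[OF c] by simp
    also have "\<dots> = integral {0..2} (\<lambda>z. integral {0..2*pi} (\<lambda>\<theta>. ?f (\<theta>, z)))"
      using integral_swap_continuous[of 0 0 "2*pi" 2 "\<lambda>\<theta> z. ?f (\<theta>, z)"] c by (simp add: case_prod_unfold)
    also have "\<dots> = integral {0..2} (\<lambda>z. \<gamma> z * G z)"
      unfolding G_def by (simp add: mult.commute[of "\<gamma> _"])
    also have "\<dots> = (LBINT z:{0..2}. \<gamma> z * G z)"
      by (intro set_borel_integral_eq_integral(2)[symmetric] borel_integrable_atLeastAtMost' continuous_intros Gc continuous_on_subset[OF \<gamma>]) auto
    finally show ?thesis by (simp add: circle_integral)
  qed
  then show ?thesis using that Gc by blast
qed

lemma pseudo_as_circle: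
  assumes r: "\<epsilon> < r"
  obtains G where "continuous_on {0..2} G" "\<And>\<gamma>. continuous_on UNIV \<gamma> \<Longrightarrow> pseudo j \<gamma> r = (\<integral>z. \<gamma> z * G z \<partial>circle)"
proof -
  have cs: "continuous_on UNIV (cos :: real \<Rightarrow> real)" "continuous_on UNIV (sin :: real \<Rightarrow> real)"
    and cn: "continuous_on UNIV (\<lambda>\<theta>::real. cyl 1 \<theta> 0 $ j)" by (intro continuous_intros)+
  obtain G1 where G1: "continuous_on {0..2} G1" "\<And>\<gamma>. continuous_on UNIV \<gamma> \<Longrightarrow> cint (partial_deriv 1 (uc j)) cos \<gamma> r = (\<integral>z. \<gamma> z * G1 z \<partial>circle)"
    using cint_as_circle[OF uc_cont(2) cs(1) r] by blast
  obtain G2 where G2: "continuous_on {0..2} G2" "\<And>\<gamma>. continuous_on UNIV \<gamma> \<Longrightarrow> cint (partial_deriv 2 (uc j)) sin \<gamma> r = (\<integral>z. \<gamma> z * G2 z \<partial>circle)"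
    using cint_as_circle[OF uc_cont(2) cs(2) r] by blast
  obtain G3 where G3: "continuous_on {0..2} G3" "\<And>\<gamma>. continuous_on UNIV \<gamma> \<Longrightarrow> cint p (\<lambda>\<theta>. cyl 1 \<theta> 0 $ j) \<gamma> r = (\<integral>z. \<gamma> z * G3 z \<partial>circle)"
    using cint_as_circle[OF uc_cont(4) cn r] by blast
  show ?thesis
  proof (rule that[of "\<lambda>z. G1 z + G2 z - G3 z"])
    show "continuous_on {0..2} (\<lambda>z. G1 z + G2 z - G3 z)" by (intro continuous_intros G1 G2 G3)
    fix \<gamma> :: "real \<Rightarrow> real" assume \<gamma>: "continuous_on UNIV \<gamma>"
    have i: "integrable circle (\<lambda>z. \<gamma> z * H z)" if "continuous_on {0..2} H" for H
      by (intro circle_continuous_integrable continuous_intros that continuous_on_subset[OF \<gamma>]) auto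
    note J = i[OF G1(1)] i[OF G2(1)] i[OF G3(1)]
    have "(\<integral>z. \<gamma> z * (G1 z + G2 z - G3 z) \<partial>circle) = (\<integral>z. \<gamma> z * G1 z + \<gamma> z * G2 z - \<gamma> z * G3 z \<partial>circle)"
      by (simp add: algebra_simps)
    also have "\<dots> = pseudo j \<gamma> r"
      unfolding Bochner_Integration.integral_diff[OF Bochner_Integration.integrable_add[OF J(1,2)] J(3)]
        Bochner_Integration.integral_add[OF J(1,2)]
      by (simp add: pseudo_def G1(2)[OF \<gamma>] G2(2)[OF \<gamma>] G3(2)[OF \<gamma>])
    finally show "pseudo j \<gamma> r = (\<integral>z. \<gamma> z * (G1 z + G2 z - G3 z) \<partial>circle)" by simp
  qed
qed

lemma pseudo_fourier_sums:
  assumes \<phi>: "\<And>z. (\<phi> has_real_derivative \<phi>' z) (at z)" and c: "continuous_on UNIV \<phi>'" and per: "\<phi> 2 = \<phi> 0" and r: "\<epsilon> < r"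
  shows "(\<lambda>n. fourier \<phi> n * pseudo j (trig n) r) sums pseudo j \<phi> r"
proof -
  obtain G where G: "continuous_on {0..2} G" "\<And>\<gamma>. continuous_on UNIV \<gamma> \<Longrightarrow> pseudo j \<gamma> r = (\<integral>z. \<gamma> z * G z \<partial>circle)"
    using pseudo_as_circle[OF r] by blast
  have "pseudo j (trig n) r = fourier G n" for n
    by (simp add: G(2)[OF trig_continuous] fourier_def mult.commute)
  then show ?thesis
    using parseval_smooth[OF \<phi> c per G(1)] by (simp add: G(2)[OF continuous_on_deriv_UNIV[OF \<phi>]])
qed

text \<open>Here the frequency in the mode bound turns into a derivative:
  \<open>pi * real (tfreq n)\<close> times a coefficient of \<open>ubar\<close> is, up to sign, a
  coefficient of \<open>g\<close> with cosine and sine exchanged. The normalisation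
  \<open>tscale\<close> passes through by linearity.\<close>

lemma pseudo_trig_estimate:
  assumes ub: "L2_T ubar" and e1: "\<epsilon> < 1" and g: "L2_T g" and w: "has_weak_deriv ubar g"
  obtains q where "(pseudo j (trig n) \<longlongrightarrow> q) (at_right \<epsilon>)"
    "\<epsilon> * \<bar>q\<bar> \<le> 400 * pi / ln (1 / \<epsilon>) * \<bar>fourier (\<lambda>z. g z $ j) (tconj n)\<bar>"
    "\<And>\<rho>. \<epsilon> < \<rho> \<Longrightarrow> \<rho> < 1 \<Longrightarrow> \<rho> * \<bar>pseudo j (trig n) \<rho>\<bar> \<le> 400 * pi / ln (1 / \<rho>) * \<bar>fourier (\<lambda>z. g z $ j) (tconj n)\<bar>"
proof -
  define \<gamma> where "\<gamma> z = cos (pi * real (tfreq n) * z - tphase n)" for z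
  define c where "c = (LBINT z:{0..2}. ubar z $ j * \<gamma> z)"
  define s where "s = tscale n"
  have s: "0 \<le> s" by (simp add: s_def tscale_bounds)
  have tg: "trig n = (\<lambda>z. s * \<gamma> z)" by (simp add: fun_eq_iff trig_def s_def \<gamma>_def)
  have ps: "pseudo j (trig n) r = s * pseudo j \<gamma> r" for r
    unfolding tg pseudo_def cint_zscale[OF eps] by (simp add: algebra_simps)
  have "fourier (\<lambda>z. ubar z $ j) n = s * c"
    unfolding fourier_def tg by (simp add: c_def circle_integral mult.left_commute[of _ s])
  then have gc: "\<bar>fourier (\<lambda>z. g z $ j) (tconj n)\<bar> = s * \<bar>pi * real (tfreq n) * c\<bar>"
    using weak_deriv_fourier[OF ub g w, of n j] s by (simp add: abs_mult mult_ac)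
  obtain q where q: "(pseudo j \<gamma> \<longlongrightarrow> q) (at_right \<epsilon>)" "\<epsilon> * \<bar>q\<bar> \<le> 400 * pi / ln (1 / \<epsilon>) * \<bar>pi * real (tfreq n) * c\<bar>"
    "\<And>\<rho>. \<epsilon> < \<rho> \<Longrightarrow> \<rho> < 1 \<Longrightarrow> \<rho> * \<bar>pseudo j \<gamma> \<rho>\<bar> \<le> 400 * pi / ln (1 / \<rho>) * \<bar>pi * real (tfreq n) * c\<bar>"
    using pseudo_mode_estimate[OF ub e1, of j "tfreq n" "tphase n"] unfolding \<gamma>_def[abs_def] c_def by blast
  show ?thesis
  proof (rule that[of "s * q"])
    show "(pseudo j (trig n) \<longlongrightarrow> s * q) (at_right \<epsilon>)" unfolding ps[abs_def] by (intro tendsto_intros q)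
    show "\<epsilon> * \<bar>s * q\<bar> \<le> 400 * pi / ln (1 / \<epsilon>) * \<bar>fourier (\<lambda>z. g z $ j) (tconj n)\<bar>"
      using mult_left_mono[OF q(2) s] s unfolding gc by (simp add: abs_mult mult_ac)
    show "\<rho> * \<bar>pseudo j (trig n) \<rho>\<bar> \<le> 400 * pi / ln (1 / \<rho>) * \<bar>fourier (\<lambda>z. g z $ j) (tconj n)\<bar>" if "\<epsilon> < \<rho>" "\<rho> < 1" for \<rho>
      using mult_left_mono[OF q(3)[OF that] s] s unfolding gc ps by (simp add: abs_mult mult_ac)
  qed
qed

text \<open>The coefficients \<open>- \<epsilon> * q j n\<close> are dominated by \<open>K\<close>
  times those of \<open>g\<close>, so Bessel's inequality for \<open>g\<close> gives both the
  existence of \<open>f\<close> and its norm. That \<open>f\<close> is the force density is an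
  exchange of the limit in \<open>r\<close> with the Fourier series of the test function.\<close>

lemma force_density_estimate:
  assumes ub: "L2_T ubar" and e1: "\<epsilon> < 1" and g: "L2_T g" and w: "has_weak_deriv ubar g"
  obtains f where "L2_T f" "has_force_density \<epsilon> u p f" "L2_norm f \<le> 400 * pi / ln (1 / \<epsilon>) * L2_norm g"
proof -
  define K where "K = 400 * pi / ln (1 / \<epsilon>)"
  have K: "0 \<le> K" using eps e1 by (simp add: K_def)
  define gh where "gh j n = fourier (\<lambda>z. g z $ j) (tconj n)" for j n
  define I where "I j = (\<integral>z. (g z $ j)\<^sup>2 \<partial>circle)" for j
  have "\<exists>q. (pseudo j (trig n) \<longlongrightarrow> q) (at_right \<epsilon>) \<and> \<epsilon> * \<bar>q\<bar> \<le> K * \<bar>gh j n\<bar>" for j n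
    using pseudo_trig_estimate[OF ub e1 g w, of j n] unfolding K_def gh_def by blast
  then obtain q where q: "\<And>j n. (pseudo j (trig n) \<longlongrightarrow> q j n) (at_right \<epsilon>)" "\<And>j n. \<epsilon> * \<bar>q j n\<bar> \<le> K * \<bar>gh j n\<bar>"
    by metis
  have qb: "\<rho> * \<bar>pseudo j (trig n) \<rho>\<bar> \<le> 400 * pi / ln (1 / \<rho>) * \<bar>gh j n\<bar>" if "\<epsilon> < \<rho>" "\<rho> < 1" for j n \<rho>
    using pseudo_trig_estimate[OF ub e1 g w, of j n] that unfolding gh_def by blast
  note gm = L2_T_measurable_component[OF g] and g2 = L2_T_component_square[OF g]
  have gs: "summable (\<lambda>n. (fourier (\<lambda>z. g z $ j) n)\<^sup>2)" for j
    unfolding fourier_def by (rule trig.bessel_summable[OF gm g2])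
  have ghs: "summable (\<lambda>n. (gh j n)\<^sup>2)" for j
    using summable_reindex[OF gs inj_tconj] by (simp add: gh_def o_def)
  have ghI: "(\<Sum>n. (gh j n)\<^sup>2) \<le> I j" for j
  proof -
    have "(\<Sum>n. (gh j n)\<^sup>2) \<le> (\<Sum>n. (fourier (\<lambda>z. g z $ j) n)\<^sup>2)"
      using suminf_reindex_mono[OF gs inj_tconj] by (simp add: gh_def o_def)
    also have "\<dots> \<le> I j"
      unfolding fourier_def I_def
      by (intro suminf_le_const trig.bessel_summable gm g2 trig.bessel[OF gm g2]) auto
    finally show ?thesis .
  qed
  have gh1: "\<bar>gh j n\<bar> \<le> sqrt (I j)" for j n
  proof -
    have "(gh j n)\<^sup>2 \<le> I j"
      using trig.bessel[OF gm g2, of "{tconj n}" j] by (simp add: gh_def fourier_def I_def)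
    then show ?thesis by (intro real_le_rsqrt) simp
  qed
  \<comment> \<open>The factor \<open>- \<epsilon>\<close> is the one in
    \<open>force_component\<close>.\<close>
  define cf where "cf j n = - \<epsilon> * q j n" for j n
  have cfb: "(cf j n)\<^sup>2 \<le> K\<^sup>2 * (gh j n)\<^sup>2" for j n
  proof -
    have "\<bar>cf j n\<bar> \<le> K * \<bar>gh j n\<bar>" using q(2)[of j n] eps by (simp add: cf_def abs_mult)
    then have "\<bar>cf j n\<bar>\<^sup>2 \<le> (K * \<bar>gh j n\<bar>)\<^sup>2" by (intro power_mono) auto
    then show ?thesis by (simp add: power_mult_distrib)
  qed
  have cfs: "summable (\<lambda>n. (cf j n)\<^sup>2)" for j
    by (rule summable_comparison_test'[OF summable_mult[OF ghs[of j], of "K\<^sup>2"], of 0]) (use cfb in auto)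
  have cfI: "(\<Sum>n. (cf j n)\<^sup>2) \<le> K\<^sup>2 * I j" for j
  proof -
    have "(\<Sum>n. (cf j n)\<^sup>2) \<le> (\<Sum>n. K\<^sup>2 * (gh j n)\<^sup>2)" by (intro suminf_le cfb cfs summable_mult ghs)
    also have "\<dots> = K\<^sup>2 * (\<Sum>n. (gh j n)\<^sup>2)" by (intro suminf_mult ghs)
    also have "\<dots> \<le> K\<^sup>2 * I j" by (intro mult_left_mono ghI) auto
    finally show ?thesis .
  qed
  \<comment> \<open>Bundling the conclusions of \<open>riesz_fischer\<close> allows one choice of
    \<open>F\<close> for all three components.\<close>
  define PF where "PF j F \<longleftrightarrow> F \<in> borel_measurable circle \<and> integrable circle (\<lambda>z. (F z)\<^sup>2) \<and> (\<integral>z. (F z)\<^sup>2 \<partial>circle) \<le> (\<Sum>n. (cf j n)\<^sup>2) \<and>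
     (\<forall>\<phi> C. \<phi> \<in> borel_measurable circle \<longrightarrow> (\<forall>x\<in>space circle. \<bar>\<phi> x\<bar> \<le> C) \<longrightarrow>
        summable (\<lambda>n. cf j n * (\<integral>x. \<phi> x * trig n x \<partial>circle)) \<longrightarrow>
        (\<integral>x. \<phi> x * F x \<partial>circle) = (\<Sum>n. cf j n * (\<integral>x. \<phi> x * trig n x \<partial>circle)))" for j F
  have "\<exists>F. PF j F" for j
  proof -
    obtain F where "F \<in> borel_measurable circle" "integrable circle (\<lambda>z. (F z)\<^sup>2)" "(\<integral>z. (F z)\<^sup>2 \<partial>circle) \<le> (\<Sum>n. (cf j n)\<^sup>2)"
      "\<And>\<phi> C. \<phi> \<in> borel_measurable circle \<Longrightarrow> (\<And>x. x \<in> space circle \<Longrightarrow> \<bar>\<phi> x\<bar> \<le> C) \<Longrightarrow>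
        summable (\<lambda>n. cf j n * (\<integral>x. \<phi> x * trig n x \<partial>circle)) \<Longrightarrow>
        (\<integral>x. \<phi> x * F x \<partial>circle) = (\<Sum>n. cf j n * (\<integral>x. \<phi> x * trig n x \<partial>circle))"
      using trig.riesz_fischer[OF cfs[of j]] by blast
    then show ?thesis unfolding PF_def by blast
  qed
  then obtain F where PF: "\<And>j. PF j (F j)" by metis
  have Fm: "F j \<in> borel_measurable circle" and F2: "integrable circle (\<lambda>z. (F j z)\<^sup>2)"
    and Fn: "(\<integral>z. (F j z)\<^sup>2 \<partial>circle) \<le> (\<Sum>n. (cf j n)\<^sup>2)" for j using PF[of j] by (auto simp: PF_def)
  have Fp: "(\<integral>x. \<phi> x * F j x \<partial>circle) = (\<Sum>n. cf j n * (\<integral>x. \<phi> x * trig n x \<partial>circle))"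
    if "\<phi> \<in> borel_measurable circle" "\<And>x. x \<in> space circle \<Longrightarrow> \<bar>\<phi> x\<bar> \<le> C"
      "summable (\<lambda>n. cf j n * (\<integral>x. \<phi> x * trig n x \<partial>circle))" for j \<phi> C
    using PF[of j] that unfolding PF_def by blast
  obtain f where f: "L2_T f" and f_eq: "\<forall>j. AE z in circle. f z $ j = F j z"
    by (rule L2_T_of_components[of F, OF Fm F2])
  have fint: "(\<integral>z. H (f z $ j) z \<partial>circle) = (\<integral>z. H (F j z) z \<partial>circle)"
    if "(\<lambda>z. H (f z $ j) z) \<in> borel_measurable circle" "(\<lambda>z. H (F j z) z) \<in> borel_measurable circle" for H :: "real \<Rightarrow> real \<Rightarrow> real" and j
    using that by (rule integral_cong_AE) (use f_eq[rule_format, of j] in eventually_elim, simp)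
  note fm[measurable] = L2_T_measurable_component[OF f] and Fm[measurable]
  have "(L2_norm f)\<^sup>2 = (\<Sum>j\<in>UNIV. \<integral>z. (F j z)\<^sup>2 \<partial>circle)"
    unfolding L2_norm_power2[OF f] by (intro sum.cong refl fint[of "\<lambda>x z. x\<^sup>2"]) measurable
  also have "\<dots> \<le> (\<Sum>j\<in>UNIV. K\<^sup>2 * I j)" by (intro sum_mono order_trans[OF Fn cfI])
  also have "\<dots> = (K * L2_norm g)\<^sup>2"
    by (simp add: power_mult_distrib L2_norm_power2[OF g] I_def sum_distrib_left)
  finally have norm: "L2_norm f \<le> K * L2_norm g"
    by (rule power2_le_imp_le) (use K in \<open>simp add: L2_norm_def set_lebesgue_integral_def\<close>)
  have "has_force_density \<epsilon> u p f"
    unfolding has_force_density_def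
  proof (intro allI impI)
    fix \<phi> :: "real \<Rightarrow> real" assume tf: "test_function \<phi>"
    have dd: "((deriv ^^ n) \<phi>) differentiable (at z)" for n z using tf by (simp add: test_function_def)
    have \<phi>: "(\<phi> has_real_derivative deriv \<phi> z) (at z)" for z
      using dd[of 0 z] by (simp add: DERIV_deriv_iff_real_differentiable)
    have "(deriv \<phi> has_real_derivative deriv (deriv \<phi>) z) (at z)" for z
      using dd[of 1 z] by (simp add: DERIV_deriv_iff_real_differentiable)
    then have \<phi>': "continuous_on UNIV (deriv \<phi>)" by (rule continuous_on_deriv_UNIV)
    have \<phi>c: "continuous_on A \<phi>" for A using continuous_on_subset[OF continuous_on_deriv_UNIV[OF \<phi>]] by blast
    have per: "\<phi> 2 = \<phi> 0" using tf by (auto simp: test_function_def periodic2_def dest: spec[of _ 0])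
    note fs = fourier_summable[OF \<phi> \<phi>' per]
    \<comment> \<open>Radii are kept below a fixed number less than 1, since the mode bound blows up
      as \<open>r\<close> approaches 1.\<close>
    define \<rho>1 where "\<rho>1 = (1 + \<epsilon>) / 2"
    have \<rho>1: "\<epsilon> < \<rho>1" "\<rho>1 < 1" using e1 by (auto simp: \<rho>1_def)
    have lim: "((\<lambda>r. (LBINT z:{0..2}. \<phi> z *\<^sub>R angular_force \<epsilon> u p r z) $ j) \<longlongrightarrow> (LBINT z:{0..2}. \<phi> z *\<^sub>R f z) $ j) (at_right \<epsilon>)" for j
    proof -
      define Bd where "Bd = 400 * pi / ln (1 / \<rho>1) * sqrt (I j) / \<epsilon>"
      have pb: "\<bar>pseudo j (trig n) r\<bar> \<le> Bd" if r: "\<epsilon> < r" "r < \<rho>1" for r n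
      proof -
        have r1: "r < 1" using r \<rho>1 by simp
        have "ln (1 / \<rho>1) \<le> ln (1 / r)" using r \<rho>1 eps by (intro ln_mono divide_left_mono) auto
        then have le: "400 * pi / ln (1 / r) \<le> 400 * pi / ln (1 / \<rho>1)"
          using \<rho>1 eps r r1 by (intro divide_left_mono mult_pos_pos) auto
        have "\<epsilon> * \<bar>pseudo j (trig n) r\<bar> \<le> r * \<bar>pseudo j (trig n) r\<bar>" using r by (intro mult_right_mono) auto
        also have "\<dots> \<le> 400 * pi / ln (1 / r) * \<bar>gh j n\<bar>" by (rule qb[OF r(1) r1])
        also have "\<dots> \<le> 400 * pi / ln (1 / \<rho>1) * sqrt (I j)"
          using le gh1[of j n] \<rho>1 eps by (intro mult_mono) auto
        finally show ?thesis unfolding Bd_def pos_le_divide_eq[OF eps] by (simp only: mult.commute[of _ \<epsilon>])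
      qed
      have T: "((\<lambda>r. \<Sum>n. fourier \<phi> n * pseudo j (trig n) r) \<longlongrightarrow> (\<Sum>n. fourier \<phi> n * q j n)) (at_right \<epsilon>)"
        and sq: "summable (\<lambda>n. norm (fourier \<phi> n * q j n))"
      proof -
        \<comment> \<open>Domination for Tannery's theorem: \<open>Bd\<close> is uniform in the mode
          and in the radius, and the coefficients of \<open>\<phi>\<close> are absolutely
          summable.\<close>
        have "eventually (\<lambda>(n, r). norm (fourier \<phi> n * pseudo j (trig n) r) \<le> \<bar>fourier \<phi> n\<bar> * Bd) (at_top \<times>\<^sub>F at_right \<epsilon>)"
          unfolding eventually_prod_filter
        proof (intro exI conjI allI impI)
          show "\<forall>\<^sub>F n::nat in at_top. True" by simp
          show "\<forall>\<^sub>F r in at_right \<epsilon>. \<epsilon> < r \<and> r < \<rho>1"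
            unfolding eventually_at_right_field using \<rho>1 by blast
          fix n :: nat and r assume "\<epsilon> < r \<and> r < \<rho>1"
          then show "case (n, r) of (n, r) \<Rightarrow> norm (fourier \<phi> n * pseudo j (trig n) r) \<le> \<bar>fourier \<phi> n\<bar> * Bd"
            using pb by (auto simp: abs_mult intro!: mult_left_mono)
        qed
        from tannerys_theorem[OF tendsto_mult[OF tendsto_const q(1)] this summable_mult2[OF fs] trivial_limit_at_right_real]
        show "((\<lambda>r. \<Sum>n. fourier \<phi> n * pseudo j (trig n) r) \<longlongrightarrow> (\<Sum>n. fourier \<phi> n * q j n)) (at_right \<epsilon>)"
          "summable (\<lambda>n. norm (fourier \<phi> n * q j n))" by auto
      qed
      have P: "(pseudo j \<phi> \<longlongrightarrow> (\<Sum>n. fourier \<phi> n * q j n)) (at_right \<epsilon>)"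
        by (rule Lim_transform_eventually[OF T])
          (auto intro!: eventually_mono[OF eventually_at_right_less] sums_unique[symmetric] pseudo_fourier_sums[OF \<phi> \<phi>' per])
      have "((\<lambda>r. - \<epsilon> * (pseudo j \<phi> r + transposed j \<phi> r)) \<longlongrightarrow> - \<epsilon> * ((\<Sum>n. fourier \<phi> n * q j n) + 0)) (at_right \<epsilon>)"
        by (intro tendsto_intros P transposed_tendsto_0[OF ub \<phi> \<phi>' per])
      then have L: "((\<lambda>r. (LBINT z:{0..2}. \<phi> z *\<^sub>R angular_force \<epsilon> u p r z) $ j) \<longlongrightarrow> - \<epsilon> * ((\<Sum>n. fourier \<phi> n * q j n) + 0)) (at_right \<epsilon>)"
        by (rule Lim_transform_eventually)
          (use force_component[OF \<phi>c] in \<open>auto intro!: eventually_mono[OF eventually_at_right_less]\<close>)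
      have sq': "summable (\<lambda>n. fourier \<phi> n * q j n)" by (rule summable_norm_cancel[OF sq])
      have cfeq: "cf j n * fourier \<phi> n = - \<epsilon> * (fourier \<phi> n * q j n)" for n by (simp add: cf_def)
      have scf: "summable (\<lambda>n. cf j n * fourier \<phi> n)" unfolding cfeq by (intro summable_mult sq')
      have "bounded (\<phi> ` {0..2})" by (intro compact_imp_bounded compact_continuous_image \<phi>c) auto
      then obtain C where C: "\<forall>z\<in>{0..2}. \<bar>\<phi> z\<bar> \<le> C" by (auto simp: bounded_iff)
      have \<phi>m[measurable]: "\<phi> \<in> borel_measurable circle" by (intro circle_continuous_measurable \<phi>c)
      have "(LBINT z:{0..2}. \<phi> z *\<^sub>R f z) $ j = (\<integral>z. f z $ j * \<phi> z \<partial>circle)"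
        by (rule L2_T_scaleR_component[OF f \<phi>c])
      also have "\<dots> = (\<integral>z. F j z * \<phi> z \<partial>circle)"
        by (rule fint[of "\<lambda>x z. x * \<phi> z"]) measurable
      also have "\<dots> = (\<Sum>n. cf j n * fourier \<phi> n)"
      proof -
        have "(\<integral>z. \<phi> z * F j z \<partial>circle) = (\<Sum>n. cf j n * fourier \<phi> n)"
          unfolding fourier_def
          by (rule Fp[OF \<phi>m _ scf[unfolded fourier_def], of C]) (use C in \<open>simp add: space_restrict_space\<close>)
        then show ?thesis by (simp add: mult.commute)
      qed
      also have "\<dots> = - \<epsilon> * (\<Sum>n. fourier \<phi> n * q j n)"
        unfolding cfeq by (intro suminf_mult sq')
      finally show ?thesis using L by simp
    qed
    show "((\<lambda>r. LBINT z:{0..2}. \<phi> z *\<^sub>R angular_force \<epsilon> u p r z) \<longlongrightarrow> (LBINT z:{0..2}. \<phi> z *\<^sub>R f z)) (at_right \<epsilon>)"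
      by (rule vec_tendstoI) (rule lim)
  qed
  then show ?thesis by (rule that[OF f]) (use norm in \<open>simp add: K_def\<close>)
qed

end

theorem theorem1p6:
  "\<exists>C::real. \<forall>(\<epsilon>::real) ubar u p.
     0 < \<epsilon> \<and> \<epsilon> < 1 \<and> H1_T ubar \<and> zero_mean ubar \<and> stokes_solution \<epsilon> ubar u p \<longrightarrow>
     (\<exists>f. L2_T f \<and> has_force_density \<epsilon> u p f \<and>
          L2_norm f \<le> C / \<bar>ln \<epsilon>\<bar> * H1_norm ubar)"
proof (rule exI[of _ "400 * pi"], intro allI impI)
  fix \<epsilon> :: real and ubar u p
  assume h: "0 < \<epsilon> \<and> \<epsilon> < 1 \<and> H1_T ubar \<and> zero_mean ubar \<and> stokes_solution \<epsilon> ubar u p"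
  interpret stokes_flow \<epsilon> ubar u p using h by unfold_locales auto
  have ub: "L2_T ubar" and "\<exists>g. L2_T g \<and> has_weak_deriv ubar g" using h by (auto simp: H1_T_def)
  then have g: "L2_T (weak_deriv ubar)" "has_weak_deriv ubar (weak_deriv ubar)"
    unfolding weak_deriv_def by (metis (mono_tags, lifting) someI_ex)+
  have ln: "ln (1 / \<epsilon>) = \<bar>ln \<epsilon>\<bar>" using h by (simp add: ln_div)
  obtain f where f: "L2_T f" "has_force_density \<epsilon> u p f" "L2_norm f \<le> 400 * pi / \<bar>ln \<epsilon>\<bar> * L2_norm (weak_deriv ubar)"
    using force_density_estimate[OF ub _ g] h unfolding ln by blast
  have "L2_norm (weak_deriv ubar) \<le> H1_norm ubar"
    unfolding H1_norm_def by (rule real_le_rsqrt) simp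
  then have "400 * pi / \<bar>ln \<epsilon>\<bar> * L2_norm (weak_deriv ubar) \<le> 400 * pi / \<bar>ln \<epsilon>\<bar> * H1_norm ubar"
    by (intro mult_left_mono) auto
  then show "\<exists>f. L2_T f \<and> has_force_density \<epsilon> u p f \<and> L2_norm f \<le> 400 * pi / \<bar>ln \<epsilon>\<bar> * H1_norm ubar"
    using f by (blast intro: order_trans)
qed

end
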